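(* Let $q\colon Y\to B$ and $p\colon X\to A$ be coCartesian fibrations of simplicial sets, and suppose given a pullback square of simplicial sets $$\begin{array}{ccc} X & \xrightarrow{\ j\ } & Y\\ {\scriptstyle p}\downarrow & & \downarrow{\scriptstyle q}\\ A & \xrightarrow{\ i\ } & B\end{array}$$ in which $i\colon A\to B$ is inner anodyne. Then $j\colon X\to Y$ is a Joyal equivalence.
   Context: A map of simplicial sets is inner anodyne if it belongs to the smallest saturated class (closed under pushouts, transfinite compositions and retracts) containing the inner horn inclusions $\Lambda^n_k\to\Delta^n$, $n\ge 2$, $0<k<n$. A Joyal equivalence is a weak equivalence of the Joyal model structure on simplicial sets. CoCartesian fibrations of simplicial sets are understood in the usual sense (inner fibrations such that every edge of the base admits a coCartesian lift with any prescribed lift of its source). *)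

theory Defs
  imports Main "HOL-Library.FuncSet"
begin

section \<open>Simplicial sets\<close>

text \<open>
  The object \<open>[n]\<close> of the simplex category is \<open>{..n}\<close>. A morphism \<open>[m] \<rightarrow> [n]\<close> is a monotone
  map that is \<open>undefined\<close> outside \<open>{..m}\<close>, so equality of such functions is equality of morphisms.
\<close>

definition ord_maps :: "nat \<Rightarrow> nat \<Rightarrow> (nat \<Rightarrow> nat) set" where
  "ord_maps m n = {\<theta> \<in> {..m} \<rightarrow>\<^sub>E {..n}. mono_on {..m} \<theta>}"

definition ord_id :: "nat \<Rightarrow> nat \<Rightarrow> nat" where
  "ord_id n = (\<lambda>i\<in>{..n}. i)"

definition vertex :: "nat \<Rightarrow> nat \<Rightarrow> nat" where
  "vertex i = (\<lambda>_\<in>{..0}. i)"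

definition coface :: "nat \<Rightarrow> nat \<Rightarrow> nat \<Rightarrow> nat" where
  "coface n i = (\<lambda>j\<in>{..n}. if j < i then j else Suc j)"

text \<open>
  For \<open>\<theta>\<close> a morphism \<open>[m] \<rightarrow> [n]\<close>, the function \<open>act X m n \<theta>\<close> is the induced map from
  \<open>n\<close>-simplices to \<open>m\<close>-simplices. The cell sets of different degrees need not be disjoint.
\<close>

record 'a sset =
  cells :: "nat \<Rightarrow> 'a set"
  act :: "nat \<Rightarrow> nat \<Rightarrow> (nat \<Rightarrow> nat) \<Rightarrow> 'a \<Rightarrow> 'a"

definition simplicial_set :: "'a sset \<Rightarrow> bool" where
  "simplicial_set X \<longleftrightarrow>
     (\<forall>m n \<theta> x. \<theta> \<in> ord_maps m n \<longrightarrow> x \<in> cells X n \<longrightarrow> act X m n \<theta> x \<in> cells X m) \<and>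
     (\<forall>n x. x \<in> cells X n \<longrightarrow> act X n n (ord_id n) x = x) \<and>
     (\<forall>l m n \<phi> \<theta> x. \<phi> \<in> ord_maps l m \<longrightarrow> \<theta> \<in> ord_maps m n \<longrightarrow> x \<in> cells X n \<longrightarrow>
        act X l m \<phi> (act X m n \<theta> x) = act X l n (compose {..l} \<theta> \<phi>) x)"

text \<open>Maps of simplicial sets are extensional in every degree, so that their equality is \<open>=\<close>.\<close>

type_synonym ('a, 'b) smap = "nat \<Rightarrow> 'a \<Rightarrow> 'b"

definition shom :: "'a sset \<Rightarrow> 'b sset \<Rightarrow> ('a, 'b) smap set" where
  "shom X Y = {f. simplicial_set X \<and> simplicial_set Y \<and>
     (\<forall>n. f n \<in> cells X n \<rightarrow>\<^sub>E cells Y n) \<and>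
     (\<forall>m n \<theta> x. \<theta> \<in> ord_maps m n \<longrightarrow> x \<in> cells X n \<longrightarrow>
        f m (act X m n \<theta> x) = act Y m n \<theta> (f n x))}"

definition sid :: "'a sset \<Rightarrow> ('a, 'a) smap" where
  "sid X = (\<lambda>n. \<lambda>x\<in>cells X n. x)"

definition scomp :: "'a sset \<Rightarrow> ('b, 'c) smap \<Rightarrow> ('a, 'b) smap \<Rightarrow> ('a, 'c) smap" where
  "scomp X g f = (\<lambda>n. compose (cells X n) (g n) (f n))"

definition siso :: "'a sset \<Rightarrow> 'b sset \<Rightarrow> ('a, 'b) smap \<Rightarrow> bool" where
  "siso X Y f \<longleftrightarrow> f \<in> shom X Y \<and> (\<exists>g\<in>shom Y X. scomp X g f = sid X \<and> scomp Y f g = sid Y)"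

section \<open>Simplices, horns, products and mapping spaces\<close>

definition simplex :: "nat \<Rightarrow> (nat \<Rightarrow> nat) sset" where
  "simplex n = \<lparr>cells = (\<lambda>m. ord_maps m n), act = (\<lambda>l m \<phi> \<theta>. compose {..l} \<theta> \<phi>)\<rparr>"

definition horn :: "nat \<Rightarrow> nat \<Rightarrow> (nat \<Rightarrow> nat) sset" where
  "horn n k = \<lparr>cells = (\<lambda>m. {\<theta> \<in> ord_maps m n. \<exists>j\<le>n. j \<noteq> k \<and> j \<notin> \<theta> ` {..m}}),
               act = (\<lambda>l m \<phi> \<theta>. compose {..l} \<theta> \<phi>)\<rparr>"

definition horn_incl :: "nat \<Rightarrow> nat \<Rightarrow> (nat \<Rightarrow> nat, nat \<Rightarrow> nat) smap" where
  "horn_incl n k = sid (horn n k)"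

definition sprod :: "'a sset \<Rightarrow> 'b sset \<Rightarrow> ('a \<times> 'b) sset" where
  "sprod X Y = \<lparr>cells = (\<lambda>n. cells X n \<times> cells Y n),
                act = (\<lambda>m n \<theta> (x, y). (act X m n \<theta> x, act Y m n \<theta> y))\<rparr>"

text \<open>The internal hom: \<open>n\<close>-simplices of \<open>sfun X C\<close> are maps from \<open>X \<times> \<Delta>\<^sup>n\<close> to \<open>C\<close>.\<close>

definition sfun :: "'a sset \<Rightarrow> 'c sset \<Rightarrow> ('a \<times> (nat \<Rightarrow> nat), 'c) smap sset" where
  "sfun X C = \<lparr>cells = (\<lambda>n. shom (sprod X (simplex n)) C),
     act = (\<lambda>m n \<theta> h. \<lambda>k. \<lambda>(x, \<alpha>)\<in>cells (sprod X (simplex m)) k. h k (x, compose {..k} \<theta> \<alpha>))\<rparr>"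

definition sfun_pre :: "'a sset \<Rightarrow> 'b sset \<Rightarrow> ('a, 'b) smap \<Rightarrow> 'c sset \<Rightarrow>
    (('b \<times> (nat \<Rightarrow> nat), 'c) smap, ('a \<times> (nat \<Rightarrow> nat), 'c) smap) smap" where
  "sfun_pre X Y f C = (\<lambda>n. \<lambda>h\<in>cells (sfun Y C) n.
     \<lambda>k. \<lambda>(x, \<alpha>)\<in>cells (sprod X (simplex n)) k. h k (f k x, \<alpha>))"

section \<open>Limits and colimits\<close>

text \<open>
  Limits and colimits of simplicial sets are computed degreewise, and the following definitions
  spell out what that means for sets. Being a pullback (pushout) is a property of a given square,
  so both notions are invariant under isomorphism.
\<close>

text \<open>\<open>is_pullback P Y A B j p i q\<close>: \<open>P\<close> is the pullback of \<open>i : A \<rightarrow> B\<close> and \<open>q : Y \<rightarrow> B\<close>.\<close>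

definition is_pullback :: "'x sset \<Rightarrow> 'y sset \<Rightarrow> 'a sset \<Rightarrow> 'b sset \<Rightarrow>
    ('x, 'y) smap \<Rightarrow> ('x, 'a) smap \<Rightarrow> ('a, 'b) smap \<Rightarrow> ('y, 'b) smap \<Rightarrow> bool" where
  "is_pullback P Y A B j p i q \<longleftrightarrow>
     j \<in> shom P Y \<and> p \<in> shom P A \<and> i \<in> shom A B \<and> q \<in> shom Y B \<and>
     scomp P q j = scomp P i p \<and>
     (\<forall>n. bij_betw (\<lambda>x. (p n x, j n x)) (cells P n)
            {(a, y). a \<in> cells A n \<and> y \<in> cells Y n \<and> i n a = q n y})"

text \<open>
  \<open>is_pushout A B C D f g h k\<close>: \<open>D\<close> is the pushout of \<open>f : A \<rightarrow> B\<close> and \<open>g : A \<rightarrow> C\<close>, with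
  coprojections \<open>h : B \<rightarrow> D\<close> and \<open>k : C \<rightarrow> D\<close>. In each degree, \<open>D\<close> is the quotient of the
  disjoint union of \<open>B\<close> and \<open>C\<close> by the equivalence relation generated by \<open>f a \<sim> g a\<close>.
\<close>

definition glue_rel :: "'a set \<Rightarrow> ('a \<Rightarrow> 'b) \<Rightarrow> ('a \<Rightarrow> 'c) \<Rightarrow> ('b + 'c) rel" where
  "glue_rel S f g = (let E = (\<lambda>a. (Inl (f a), Inr (g a))) ` S in (E \<union> E\<inverse>)\<^sup>*)"

definition is_pushout :: "'a sset \<Rightarrow> 'b sset \<Rightarrow> 'c sset \<Rightarrow> 'd sset \<Rightarrow>
    ('a, 'b) smap \<Rightarrow> ('a, 'c) smap \<Rightarrow> ('b, 'd) smap \<Rightarrow> ('c, 'd) smap \<Rightarrow> bool" where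
  "is_pushout A B C D f g h k \<longleftrightarrow>
     f \<in> shom A B \<and> g \<in> shom A C \<and> h \<in> shom B D \<and> k \<in> shom C D \<and>
     scomp A h f = scomp A k g \<and>
     (\<forall>n. cells D n = h n ` cells B n \<union> k n ` cells C n) \<and>
     (\<forall>n. \<forall>u \<in> cells B n <+> cells C n. \<forall>v \<in> cells B n <+> cells C n.
        case_sum (h n) (k n) u = case_sum (h n) (k n) v \<longrightarrow>
          (u, v) \<in> glue_rel (cells A n) (f n) (g n))"

text \<open>
  Diagrams indexed by a well-ordered set: \<open>r\<close> is the (reflexive) well-order on \<open>Field r\<close>, and
  \<open>t \<beta> \<gamma> : F \<beta> \<rightarrow> F \<gamma>\<close> for \<open>\<beta> \<le> \<gamma>\<close>. The colimit of a chain of sets is the union of the images,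
  two elements being identified iff they become equal at a later stage.
\<close>

definition chain_diagram :: "'i rel \<Rightarrow> ('i \<Rightarrow> 'a sset) \<Rightarrow> ('i \<Rightarrow> 'i \<Rightarrow> ('a, 'a) smap) \<Rightarrow> bool" where
  "chain_diagram r F t \<longleftrightarrow>
     (\<forall>\<beta> \<gamma>. (\<beta>, \<gamma>) \<in> r \<longrightarrow> t \<beta> \<gamma> \<in> shom (F \<beta>) (F \<gamma>)) \<and>
     (\<forall>\<beta>\<in>Field r. t \<beta> \<beta> = sid (F \<beta>)) \<and>
     (\<forall>\<beta> \<gamma> \<delta>. (\<beta>, \<gamma>) \<in> r \<longrightarrow> (\<gamma>, \<delta>) \<in> r \<longrightarrow> scomp (F \<beta>) (t \<gamma> \<delta>) (t \<beta> \<gamma>) = t \<beta> \<delta>)"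

definition is_chain_colimit :: "'i set \<Rightarrow> 'i rel \<Rightarrow> ('i \<Rightarrow> 'a sset) \<Rightarrow> ('i \<Rightarrow> 'i \<Rightarrow> ('a, 'a) smap) \<Rightarrow>
    'b sset \<Rightarrow> ('i \<Rightarrow> ('a, 'b) smap) \<Rightarrow> bool" where
  "is_chain_colimit I r F t T c \<longleftrightarrow>
     (\<forall>\<beta>\<in>I. c \<beta> \<in> shom (F \<beta>) T) \<and>
     (\<forall>\<beta>\<in>I. \<forall>\<gamma>\<in>I. (\<beta>, \<gamma>) \<in> r \<longrightarrow> scomp (F \<beta>) (c \<gamma>) (t \<beta> \<gamma>) = c \<beta>) \<and>
     (\<forall>n. cells T n = (\<Union>\<beta>\<in>I. c \<beta> n ` cells (F \<beta>) n)) \<and>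
     (\<forall>n. \<forall>\<beta>\<in>I. \<forall>\<gamma>\<in>I. \<forall>x\<in>cells (F \<beta>) n. \<forall>y\<in>cells (F \<gamma>) n. c \<beta> n x = c \<gamma> n y \<longrightarrow>
        (\<exists>\<delta>\<in>I. (\<beta>, \<delta>) \<in> r \<and> (\<gamma>, \<delta>) \<in> r \<and> t \<beta> \<delta> n x = t \<gamma> \<delta> n y))"

definition imm_succ :: "'i rel \<Rightarrow> 'i \<Rightarrow> 'i \<Rightarrow> bool" where
  "imm_succ r \<beta> \<gamma> \<longleftrightarrow> \<beta> \<in> underS r \<gamma> \<and> (\<forall>\<delta>\<in>underS r \<gamma>. (\<delta>, \<beta>) \<in> r)"

definition limit_elem :: "'i rel \<Rightarrow> 'i \<Rightarrow> bool" where
  "limit_elem r \<gamma> \<longleftrightarrow> \<gamma> \<in> Field r \<and> underS r \<gamma> \<noteq> {} \<and> (\<nexists>\<beta>. imm_succ r \<beta> \<gamma>)"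

definition continuous_chain ::
    "'i rel \<Rightarrow> ('i \<Rightarrow> 'a sset) \<Rightarrow> ('i \<Rightarrow> 'i \<Rightarrow> ('a, 'a) smap) \<Rightarrow> bool" where
  "continuous_chain r F t \<longleftrightarrow> chain_diagram r F t \<and>
     (\<forall>\<gamma>. limit_elem r \<gamma> \<longrightarrow> is_chain_colimit (underS r \<gamma>) r F t (F \<gamma>) (\<lambda>\<beta>. t \<beta> \<gamma>))"

definition is_retract :: "'a sset \<Rightarrow> 'b sset \<Rightarrow> ('a, 'b) smap \<Rightarrow>
    'c sset \<Rightarrow> 'd sset \<Rightarrow> ('c, 'd) smap \<Rightarrow> bool" where
  "is_retract A B f C D g \<longleftrightarrow> f \<in> shom A B \<and> g \<in> shom C D \<and>
     (\<exists>s\<in>shom A C. \<exists>r\<in>shom C A. \<exists>s'\<in>shom B D. \<exists>r'\<in>shom D B.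
        scomp A r s = sid A \<and> scomp B r' s' = sid B \<and>
        scomp A g s = scomp A s' f \<and> scomp C f r = scomp C r' g)"

section \<open>Inner anodyne maps\<close>

text \<open>
  The smallest saturated class in the category of simplicial sets with simplices in \<open>'u\<close>; the
  generators are the maps isomorphic to an inner horn inclusion. Ordinals are represented by
  well-orders on subsets of \<open>'u\<close>. If \<open>'u\<close> is infinite, these have all lengths below the successor
  cardinal of \<open>'u\<close>, which is enough for the small object argument in this category; if \<open>'u\<close> is
  finite, there are no generators and the class consists of isomorphisms only.
\<close>

inductive inner_anodyne :: "'u sset \<Rightarrow> 'u sset \<Rightarrow> ('u, 'u) smap \<Rightarrow> bool" where
  inner_horn:
    "0 < k \<Longrightarrow> k < n \<Longrightarrow> siso (horn n k) A a \<Longrightarrow> siso (simplex n) B b \<Longrightarrow> f \<in> shom A B \<Longrightarrow>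
     scomp (horn n k) f a = scomp (horn n k) b (horn_incl n k) \<Longrightarrow> inner_anodyne A B f"
| pushout:
    "inner_anodyne A B f \<Longrightarrow> is_pushout A B C D f g h k \<Longrightarrow> inner_anodyne C D k"
| transfinite_composition:
    "Well_order (r :: 'u rel) \<Longrightarrow> \<beta>0 \<in> Field r \<Longrightarrow> \<forall>\<beta>\<in>Field r. (\<beta>0, \<beta>) \<in> r \<Longrightarrow> continuous_chain r F t \<Longrightarrow>
     (\<forall>\<beta> \<gamma>. imm_succ r \<beta> \<gamma> \<longrightarrow> inner_anodyne (F \<beta>) (F \<gamma>) (t \<beta> \<gamma>)) \<Longrightarrow>
     is_chain_colimit (Field r) r F t T c \<Longrightarrow> inner_anodyne (F \<beta>0) T (c \<beta>0)"
| retract: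
    "inner_anodyne C D g \<Longrightarrow> is_retract A B f C D g \<Longrightarrow> inner_anodyne A B f"

section \<open>CoCartesian fibrations\<close>

definition horn_filler :: "nat \<Rightarrow> nat \<Rightarrow> 'a sset \<Rightarrow> ('a, 'b) smap \<Rightarrow>
    (nat \<Rightarrow> nat, 'a) smap \<Rightarrow> (nat \<Rightarrow> nat, 'b) smap \<Rightarrow> bool" where
  "horn_filler n k X p u v \<longleftrightarrow> (\<exists>h\<in>shom (simplex n) X.
     scomp (horn n k) h (horn_incl n k) = u \<and> scomp (simplex n) p h = v)"

definition inner_fibration :: "'a sset \<Rightarrow> 'b sset \<Rightarrow> ('a, 'b) smap \<Rightarrow> bool" where
  "inner_fibration X S p \<longleftrightarrow> p \<in> shom X S \<and>
     (\<forall>n k. 0 < k \<longrightarrow> k < n \<longrightarrow> (\<forall>u\<in>shom (horn n k) X. \<forall>v\<in>shom (simplex n) S.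
        scomp (horn n k) p u = scomp (horn n k) v (horn_incl n k) \<longrightarrow> horn_filler n k X p u v))"

definition source :: "'a sset \<Rightarrow> 'a \<Rightarrow> 'a" where
  "source X e = act X 0 1 (vertex 0) e"

definition target :: "'a sset \<Rightarrow> 'a \<Rightarrow> 'a" where
  "target X e = act X 0 1 (vertex 1) e"

text \<open>
  For \<open>n \<ge> 2\<close>, the initial edge \<open>{0,1}\<close> of \<open>\<Delta>\<^sup>n\<close> lies in the horn \<open>horn n 0\<close>, where it is
  represented by the function \<open>ord_id 1\<close>.
\<close>

definition cocartesian_edge :: "'a sset \<Rightarrow> 'b sset \<Rightarrow> ('a, 'b) smap \<Rightarrow> 'a \<Rightarrow> bool" where
  "cocartesian_edge X S p e \<longleftrightarrow> e \<in> cells X 1 \<and>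
     (\<forall>n\<ge>2. \<forall>u\<in>shom (horn n 0) X. \<forall>v\<in>shom (simplex n) S.
        u 1 (ord_id 1) = e \<longrightarrow> scomp (horn n 0) p u = scomp (horn n 0) v (horn_incl n 0) \<longrightarrow>
        horn_filler n 0 X p u v)"

definition cocartesian_fibration :: "'a sset \<Rightarrow> 'b sset \<Rightarrow> ('a, 'b) smap \<Rightarrow> bool" where
  "cocartesian_fibration X S p \<longleftrightarrow> inner_fibration X S p \<and>
     (\<forall>e\<in>cells S 1. \<forall>x\<in>cells X 0. p 0 x = source S e \<longrightarrow>
        (\<exists>e'\<in>cells X 1. cocartesian_edge X S p e' \<and> source X e' = x \<and> p 1 e' = e))"

section \<open>Joyal equivalences\<close>

definition quasi_category :: "'a sset \<Rightarrow> bool" where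
  "quasi_category C \<longleftrightarrow> simplicial_set C \<and>
     (\<forall>n k. 0 < k \<longrightarrow> k < n \<longrightarrow> (\<forall>u\<in>shom (horn n k) C.
        \<exists>h\<in>shom (simplex n) C. scomp (horn n k) h (horn_incl n k) = u))"

definition face :: "'a sset \<Rightarrow> nat \<Rightarrow> nat \<Rightarrow> 'a \<Rightarrow> 'a" where
  "face X n i x = act X n (Suc n) (coface n i) x"

definition degenerate_edge :: "'a sset \<Rightarrow> 'a \<Rightarrow> 'a" where
  "degenerate_edge X x = act X 1 0 (\<lambda>_\<in>{..1}. 0) x"

text \<open>
  \<open>composite Q e f g\<close>: some 2-simplex exhibits \<open>g\<close> as a composite of \<open>e\<close> followed by \<open>f\<close>.
  In a quasi-category, \<open>equivalence_edge\<close> says that the edge becomes invertible in the homotopy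
  category.
\<close>

definition composite :: "'a sset \<Rightarrow> 'a \<Rightarrow> 'a \<Rightarrow> 'a \<Rightarrow> bool" where
  "composite Q e f g \<longleftrightarrow>
     (\<exists>\<sigma>\<in>cells Q 2. face Q 1 2 \<sigma> = e \<and> face Q 1 0 \<sigma> = f \<and> face Q 1 1 \<sigma> = g)"

definition equivalence_edge :: "'a sset \<Rightarrow> 'a \<Rightarrow> bool" where
  "equivalence_edge Q e \<longleftrightarrow> e \<in> cells Q 1 \<and>
     (\<exists>e'\<in>cells Q 1. composite Q e e' (degenerate_edge Q (source Q e)) \<and>
                       composite Q e' e (degenerate_edge Q (target Q e)))"

definition equiv_objects :: "'a sset \<Rightarrow> 'a rel" where
  "equiv_objects Q = {(x, y). x \<in> cells Q 0 \<and> y \<in> cells Q 0 \<and>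
     (\<exists>e. equivalence_edge Q e \<and> source Q e = x \<and> target Q e = y)}"

definition iso_classes :: "'a sset \<Rightarrow> 'a set set" where
  "iso_classes Q = cells Q 0 // equiv_objects Q"

definition iso_classes_map :: "'b sset \<Rightarrow> ('a, 'b) smap \<Rightarrow> 'a set \<Rightarrow> 'b set" where
  "iso_classes_map Q F K = equiv_objects Q `` (F 0 ` K)"

text \<open>
  The weak equivalences of the Joyal model structure, following Joyal: \<open>f : X \<rightarrow> Y\<close> is a weak
  categorical equivalence if for every quasi-category \<open>C\<close>, restriction along \<open>f\<close> from \<open>Fun(Y, C)\<close>
  to \<open>Fun(X, C)\<close> induces a bijection on isomorphism classes of objects. A definition cannot
  quantify over types, so the type \<open>'c\<close> of simplices of \<open>C\<close> is a parameter; leaving it as a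
  type variable in a theorem gives all quasi-categories \<open>C\<close>.
\<close>

definition joyal_equivalence :: "'c itself \<Rightarrow> 'a sset \<Rightarrow> 'b sset \<Rightarrow> ('a, 'b) smap \<Rightarrow> bool" where
  "joyal_equivalence _ X Y f \<longleftrightarrow> f \<in> shom X Y \<and>
     (\<forall>C :: 'c sset. quasi_category C \<longrightarrow>
        bij_betw (iso_classes_map (sfun X C) (sfun_pre X Y f C))
          (iso_classes (sfun Y C)) (iso_classes (sfun X C)))"

end

theory Submission
  imports Defs
begin

text \<open>
  Restriction along \<open>j\<close> is shown to be a trivial fibration \<open>Fun(Y, C) \<rightarrow> Fun(X, C)\<close> for every
  quasi-category \<open>C\<close>: every map to \<open>C\<close> defined on \<open>X \<times> \<Delta>\<^sup>m \<union> Y \<times> \<partial>\<Delta>\<^sup>m\<close> extends to \<open>Y \<times> \<Delta>\<^sup>m\<close>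
  (\<open>extend_along_pullback\<close>). Lifting objects, edges and triangles is enough for a bijection on
  isomorphism classes (\<open>iso_classes_bij\<close>): objects give surjectivity, and an equivalence between
  restricted objects lifts together with its inverse and the two triangles relating them.

  The extension problem is local on \<open>B\<close>. Let an \<open>n\<close>-simplex of \<open>sec\<close> be an \<open>n\<close>-simplex \<open>b\<close> of \<open>B\<close>
  together with a map \<open>b\<^sup>*Y \<times> \<Delta>\<^sup>m \<rightarrow> C\<close> that is prescribed on \<open>b\<^sup>*Y \<times> \<partial>\<Delta>\<^sup>m\<close>. Extending a map amounts to
  extending a section of \<open>sec \<rightarrow> B\<close> from \<open>A\<close> to \<open>B\<close>. Since inner anodyne maps have the left lifting
  property against inner fibrations (\<open>inner_anodyne_lifts\<close>), all that is needed is that \<open>sec \<rightarrow> B\<close> is an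
  inner fibration, which is the original problem for a coCartesian fibration \<open>Y \<rightarrow> \<Delta>\<^sup>n\<close> and the
  inclusion of an inner horn \<open>\<Lambda>\<^sup>n\<^sub>k\<close> (\<open>extend_from_horn\<close>).

  In that case, let a vertex of \<open>Y\<close> that lies over some \<open>i < k\<close> be transported to the fibre over \<open>k\<close>
  along a coCartesian edge, and leave the other vertices where they are. This is made
  into a map \<open>H : D \<rightarrow> Y\<close> (\<open>transport\<close>) from the cylinder \<open>D\<close> whose simplices are the strings
  \<open>x\<^sub>0 \<dots> x\<^sub>c y\<^sub>c\<^sub>+\<^sub>1 \<dots> y\<^sub>N\<close>, where \<open>x\<close> is a simplex of \<open>Y\<close>, \<open>y\<^sub>i\<close> stands for the transport of \<open>x\<^sub>i\<close>, and
  \<open>x\<^sub>0, \<dots>, x\<^sub>c\<close> lie over vertices less than \<open>k\<close>. It retracts the copy of \<open>Y\<close> in \<open>D\<close> consisting of the strings that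
  transport nothing. Let \<open>V \<subseteq> D\<close> consist of the strings with \<open>x\<close> over the horn and of those that are fully
  transported. Then \<open>H\<close> sends \<open>V\<close> into the part over the horn: if the image of \<open>x\<close> in \<open>\<Delta>\<^sup>n\<close> misses a vertex
  other than \<open>k\<close>, so does the image of its transport, and a fully transported simplex misses the vertex \<open>0 < k\<close>.
  So a map defined over the horn may be pulled back to \<open>V\<close>, extended to \<open>D\<close> and restricted to \<open>Y\<close>.

  Both the extension from \<open>V\<close> to \<open>D\<close> and the construction of \<open>H\<close> proceed prism by prism. The
  prism \<open>x\<^sub>0 \<dots> x\<^sub>c y\<^sub>c \<dots> y\<^sub>N\<close> has the faces without \<open>x\<^sub>c\<close> and without \<open>y\<^sub>c\<close> as the only ones that are not prisms
  over faces of \<open>x\<close>. Extending from \<open>V\<close>, the face without \<open>y\<^sub>c\<close> is the missing one; the horn is inner since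
  \<open>x\<close>, not lying over \<open>\<Lambda>\<^sup>n\<^sub>k\<close>, has a last vertex over \<open>n > k\<close>, so \<open>c < N\<close>. Constructing \<open>H\<close>, the face without \<open>x\<^sub>c\<close> is the
  missing one; the horn is inner for \<open>c > 0\<close>, and for \<open>c = 0\<close> its initial edge is coCartesian (or, if \<open>x\<close> is a
  vertex, the prism is an edge, for which a coCartesian lift is chosen).

  The same extension, for the identity of \<open>\<Delta>\<^sup>n\<close> in place of \<open>Y \<rightarrow> \<Delta>\<^sup>n\<close>, shows that \<open>Fun(X, C)\<close> is a quasi-category, so that
  equivalence of its objects is an equivalence relation.
\<close>

(* The degree 1 is to be kept as a numeral, as in simplex 1 and cells X 1. *)
declare One_nat_def [simp del]

section \<open>The simplex category\<close>

lemma ord_mapsI: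
  assumes "\<And>i. i \<le> m \<Longrightarrow> f i \<le> n" "\<And>i j. i \<le> j \<Longrightarrow> j \<le> m \<Longrightarrow> f i \<le> f j"
  shows "(\<lambda>i\<in>{..m}. f i) \<in> ord_maps m n"
  using assms by (auto simp: ord_maps_def mono_on_def)

lemma ord_maps_le: "\<theta> \<in> ord_maps m n \<Longrightarrow> i \<le> m \<Longrightarrow> \<theta> i \<le> n"
  by (auto simp: ord_maps_def)

lemma ord_maps_mono: "\<theta> \<in> ord_maps m n \<Longrightarrow> i \<le> j \<Longrightarrow> j \<le> m \<Longrightarrow> \<theta> i \<le> \<theta> j"
  by (auto simp: ord_maps_def mono_on_def)

lemma ord_maps_eqI:
  assumes "\<theta> \<in> ord_maps m n" "\<phi> \<in> ord_maps m n'" "\<And>i. i \<le> m \<Longrightarrow> \<theta> i = \<phi> i"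
  shows "\<theta> = \<phi>"
  using assms by (intro extensionalityI[of _ "{..m}"]) (auto simp: ord_maps_def PiE_def)

lemma compose_le [simp]: "i \<le> l \<Longrightarrow> compose {..l} \<theta> \<phi> i = \<theta> (\<phi> i)"
  by (simp add: compose_def)

lemma ord_maps_compose:
  "\<theta> \<in> ord_maps m n \<Longrightarrow> \<phi> \<in> ord_maps l m \<Longrightarrow> compose {..l} \<theta> \<phi> \<in> ord_maps l n"
  unfolding compose_def
  by (rule ord_mapsI) (auto intro: ord_maps_le ord_maps_mono)

lemma compose_ord_assoc:
  "\<phi> \<in> ord_maps l m \<Longrightarrow>
    compose {..l} \<chi> (compose {..l} \<theta> \<phi>) = compose {..l} (compose {..m} \<chi> \<theta>) \<phi>"
  by (rule extensionalityI[of _ "{..l}"]) (auto simp: ord_maps_le)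

lemma ord_id_in [simp]: "ord_id n \<in> ord_maps n n"
  unfolding ord_id_def by (rule ord_mapsI)

lemma ord_id_le [simp]: "i \<le> n \<Longrightarrow> ord_id n i = i"
  by (simp add: ord_id_def)

lemma compose_ord_id_left: "\<theta> \<in> ord_maps m n \<Longrightarrow> compose {..m} (ord_id n) \<theta> = \<theta>"
  by (rule ord_maps_eqI[OF ord_maps_compose[OF ord_id_in]]) (auto simp: ord_maps_le)

lemma compose_ord_id_right: "\<theta> \<in> ord_maps m n \<Longrightarrow> compose {..m} \<theta> (ord_id m) = \<theta>"
  by (rule ord_maps_eqI[OF ord_maps_compose[OF _ ord_id_in]]) (auto simp: ord_maps_le)

lemma coface_in: "i \<le> Suc n \<Longrightarrow> coface n i \<in> ord_maps n (Suc n)"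
  unfolding coface_def by (rule ord_mapsI) auto

lemma coface_le [simp]: "j \<le> n \<Longrightarrow> coface n i j = (if j < i then j else Suc j)"
  by (simp add: coface_def)

lemma vertex_in: "i \<le> n \<Longrightarrow> vertex i \<in> ord_maps 0 n"
  unfolding vertex_def by (rule ord_mapsI) auto

lemma vertex_0 [simp]: "vertex i 0 = i"
  by (simp add: vertex_def)

definition codegeneracy :: "nat \<Rightarrow> nat \<Rightarrow> nat \<Rightarrow> nat" where
  "codegeneracy n c = (\<lambda>i\<in>{..Suc n}. if i \<le> c then i else i - 1)"

lemma codegeneracy_in: "c \<le> n \<Longrightarrow> codegeneracy n c \<in> ord_maps (Suc n) n"
  unfolding codegeneracy_def by (rule ord_mapsI) auto

lemma codegeneracy_le [simp]: "i \<le> Suc n \<Longrightarrow> codegeneracy n c i = (if i \<le> c then i else i - 1)"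
  by (simp add: codegeneracy_def)

definition threshold :: "nat \<Rightarrow> nat \<Rightarrow> nat \<Rightarrow> nat" where
  "threshold n c = (\<lambda>i\<in>{..n}. if i < c then 0 else 1)"

lemma threshold_in [simp]: "threshold n c \<in> ord_maps n 1"
  unfolding threshold_def by (rule ord_mapsI) auto

lemma threshold_le [simp]: "i \<le> n \<Longrightarrow> threshold n c i = (if i < c then 0 else 1)"
  by (simp add: threshold_def)

lemma ord_maps_1_threshold:
  assumes "\<epsilon> \<in> ord_maps n 1"
  obtains c where "c \<le> Suc n" "\<epsilon> = threshold n c"
proof -
  define c where "c = (LEAST c. c \<le> n \<longrightarrow> \<epsilon> c \<noteq> 0)"
  have c: "c \<le> n \<longrightarrow> \<epsilon> c \<noteq> 0" unfolding c_def by (rule LeastI[of _ "Suc n"]) simp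
  have cle: "c \<le> Suc n" unfolding c_def by (rule Least_le) simp
  have less: "\<epsilon> i = 0" if "i < c" for i
    using not_less_Least[OF that[unfolded c_def]] by auto
  have "\<epsilon> = threshold n c"
  proof (rule ord_maps_eqI[OF assms threshold_in])
    fix i assume i: "i \<le> n"
    show "\<epsilon> i = threshold n c i"
    proof (cases "i < c")
      case False
      then have "\<epsilon> c \<le> \<epsilon> i" "\<epsilon> c \<noteq> 0" "\<epsilon> i \<le> 1"
        using ord_maps_mono[OF assms, of c i] ord_maps_le[OF assms i] c i by auto
      then show ?thesis using False i by simp
    qed (use i less in simp)
  qed
  with cle show ?thesis by (rule that)
qed

text \<open>
  Any choice of preimages of an increasing sequence is increasing. The section can therefore be
  made to pass through a given point \<open>i\<close>; this freedom makes \<open>operator_unique\<close> work.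
\<close>

lemma partial_section:
  assumes \<theta>: "\<theta> \<in> ord_maps m (Suc N)" and hit: "\<And>j. j \<le> Suc N \<Longrightarrow> j \<noteq> k \<Longrightarrow> j \<in> \<theta> ` {..m}"
    and k: "k \<le> Suc N" and i: "i \<le> m" "\<theta> i \<noteq> k"
  obtains \<delta> where "\<delta> \<in> ord_maps N m" "compose {..N} \<theta> \<delta> = coface N k" "i \<in> \<delta> ` {..N}"
proof -
  define pre where "pre j = (if j = \<theta> i then i else SOME a. a \<le> m \<and> \<theta> a = j)" for j
  have pre: "pre j \<le> m \<and> \<theta> (pre j) = j" if "j \<le> Suc N" "j \<noteq> k" for j
  proof (cases "j = \<theta> i")
    case False
    have "\<exists>a. a \<le> m \<and> \<theta> a = j" using hit[OF that] by auto
    from someI_ex[OF this] show ?thesis unfolding pre_def using False by simp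
  qed (use i in \<open>simp add: pre_def\<close>)
  define \<delta> where "\<delta> = (\<lambda>j\<in>{..N}. pre (coface N k j))"
  have cf: "coface N k j \<le> Suc N" "coface N k j \<noteq> k" if "j \<le> N" for j using that by auto
  have 1: "\<delta> \<in> ord_maps N m"
    unfolding \<delta>_def
  proof (rule ord_mapsI)
    fix a b assume ab: "a \<le> b" "b \<le> N"
    show "pre (coface N k a) \<le> pre (coface N k b)"
    proof (cases "a = b")
      case False
      then have "coface N k a < coface N k b" using ab by auto
      then show ?thesis
        using pre[OF cf[of a]] pre[OF cf[of b]] ab ord_maps_mono[OF \<theta>, of "pre (coface N k b)" "pre (coface N k a)"]
        by (metis (no_types, lifting) le_cases le_trans not_le)
    qed simp
  qed (use pre[OF cf] in auto)
  have 2: "compose {..N} \<theta> \<delta> = coface N k"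
  proof (rule ord_maps_eqI[OF ord_maps_compose[OF \<theta> 1] coface_in[OF k]])
    fix j assume "j \<le> N"
    then show "compose {..N} \<theta> \<delta> j = coface N k j"
      using pre[OF cf[of j]] by (simp add: \<delta>_def)
  qed
  have ti: "\<theta> i \<le> Suc N" using ord_maps_le[OF \<theta> i(1)] .
  define j where "j = (if \<theta> i < k then \<theta> i else \<theta> i - 1)"
  have "j \<le> N" "coface N k j = \<theta> i" using ti i(2) k by (auto simp: j_def)
  then have "\<delta> j = i" "j \<in> {..N}" by (auto simp: \<delta>_def pre_def)
  then have "i \<in> \<delta> ` {..N}" by force
  with 1 2 show ?thesis by (rule that)
qed

lemma factor_coface:
  assumes \<theta>: "\<theta> \<in> ord_maps m (Suc N)" and j: "j \<le> Suc N" "j \<notin> \<theta> ` {..m}"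
  obtains \<theta>' where "\<theta>' \<in> ord_maps m N" "\<theta> = compose {..m} (coface N j) \<theta>'"
proof -
  define \<theta>' where "\<theta>' = (\<lambda>i\<in>{..m}. if \<theta> i < j then \<theta> i else \<theta> i - 1)"
  have ne: "\<theta> i \<noteq> j" if "i \<le> m" for i using j that by auto
  have 1: "\<theta>' \<in> ord_maps m N" unfolding \<theta>'_def
  proof (rule ord_mapsI)
    fix i assume "i \<le> m"
    then show "(if \<theta> i < j then \<theta> i else \<theta> i - 1) \<le> N"
      using ord_maps_le[OF \<theta>, of i] j ne[of i] by auto
  next
    fix a b assume ab: "a \<le> b" "b \<le> m"
    then show "(if \<theta> a < j then \<theta> a else \<theta> a - 1) \<le> (if \<theta> b < j then \<theta> b else \<theta> b - 1)"
      using ord_maps_mono[OF \<theta>, of a b] ne[of a] ne[of b] by auto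
  qed
  have "\<theta> = compose {..m} (coface N j) \<theta>'"
  proof (rule ord_maps_eqI[OF \<theta> ord_maps_compose[OF coface_in[OF j(1)] 1]])
    fix i assume i: "i \<le> m"
    have "\<theta>' i \<le> N" using ord_maps_le[OF 1 i] .
    then show "\<theta> i = compose {..m} (coface N j) \<theta>' i"
      using i ne[OF i] ord_maps_le[OF \<theta> i] by (auto simp: \<theta>'_def)
  qed
  with 1 show ?thesis by (rule that)
qed

lemma ord_maps_strict:
  assumes \<theta>: "\<theta> \<in> ord_maps m n" and inj: "inj_on \<theta> {..m}"
  shows "strict_mono_on {..m} \<theta>"
proof (rule strict_mono_onI)
  fix a b assume ab: "a \<in> {..m}" "b \<in> {..m}" "a < b"
  then have "\<theta> a \<le> \<theta> b" "\<theta> a \<noteq> \<theta> b"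
    using ord_maps_mono[OF \<theta>, of a b] inj_onD[OF inj, of a b] by auto
  then show "\<theta> a < \<theta> b" by simp
qed

lemma strict_mono_image_unique:
  fixes f g :: "nat \<Rightarrow> nat"
  assumes f: "strict_mono_on {..N} f" and g: "strict_mono_on {..N} g" and img: "f ` {..N} = g ` {..N}"
    and "a \<le> N"
  shows "f a = g a"
  using \<open>a \<le> N\<close>
proof (induction a rule: less_induct)
  case (less a)
  obtain b where b: "b \<le> N" "g a = f b"
  proof -
    have "g a \<in> f ` {..N}" unfolding img using less.prems by simp
    then show ?thesis using that by auto
  qed
  obtain c where c: "c \<le> N" "f a = g c"
  proof -
    have "f a \<in> g ` {..N}" unfolding img[symmetric] using less.prems by simp
    then show ?thesis using that by auto
  qed
  have inj: "inj_on f {..N}" "inj_on g {..N}" using f g by (simp_all add: strict_mono_on_imp_inj_on)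
  have "\<not> b < a"
    using less.IH[of b] inj_onD[OF inj(2), of a b] b less.prems by auto
  moreover have "\<not> c < a"
    using less.IH[of c] inj_onD[OF inj(1), of a c] c less.prems by auto
  ultimately have "f a \<le> f b" "g a \<le> g c"
    using strict_mono_on_leD[OF f, of a b] strict_mono_on_leD[OF g, of a c] b c less.prems by auto
  with b c show ?case by simp
qed

section \<open>Simplicial sets and their maps\<close>

lemma act_in: "simplicial_set X \<Longrightarrow> \<theta> \<in> ord_maps m n \<Longrightarrow> x \<in> cells X n \<Longrightarrow> act X m n \<theta> x \<in> cells X m"
  by (simp add: simplicial_set_def)

lemma act_id: "simplicial_set X \<Longrightarrow> x \<in> cells X n \<Longrightarrow> act X n n (ord_id n) x = x"
  by (simp add: simplicial_set_def)

lemma act_act: "simplicial_set X \<Longrightarrow> \<phi> \<in> ord_maps l m \<Longrightarrow> \<theta> \<in> ord_maps m n \<Longrightarrow> x \<in> cells X n \<Longrightarrow>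
    act X l m \<phi> (act X m n \<theta> x) = act X l n (compose {..l} \<theta> \<phi>) x"
  by (simp add: simplicial_set_def)

lemma shom_in: "f \<in> shom X Y \<Longrightarrow> x \<in> cells X n \<Longrightarrow> f n x \<in> cells Y n"
  by (auto simp: shom_def)

lemma shom_act: "f \<in> shom X Y \<Longrightarrow> \<theta> \<in> ord_maps m n \<Longrightarrow> x \<in> cells X n \<Longrightarrow>
    f m (act X m n \<theta> x) = act Y m n \<theta> (f n x)"
  by (auto simp: shom_def)

lemma shom_ss: "f \<in> shom X Y \<Longrightarrow> simplicial_set X" "f \<in> shom X Y \<Longrightarrow> simplicial_set Y"
  by (auto simp: shom_def)

lemma shom_eqI:
  assumes "f \<in> shom X Y" "g \<in> shom X Y'" "\<And>n x. x \<in> cells X n \<Longrightarrow> f n x = g n x"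
  shows "f = g"
proof
  fix n
  show "f n = g n"
    using assms by (intro extensionalityI[of _ "cells X n"]) (auto simp: shom_def PiE_def)
qed

lemma shomI:
  assumes "simplicial_set X" "simplicial_set Y" "\<And>n x. x \<in> cells X n \<Longrightarrow> f n x \<in> cells Y n"
    "\<And>m n \<theta> x. \<theta> \<in> ord_maps m n \<Longrightarrow> x \<in> cells X n \<Longrightarrow> f m (act X m n \<theta> x) = act Y m n \<theta> (f n x)"
  shows "(\<lambda>n. \<lambda>x\<in>cells X n. f n x) \<in> shom X Y"
  using assms by (auto simp: shom_def act_in)

lemma scomp_apply [simp]: "x \<in> cells X n \<Longrightarrow> scomp X g f n x = g n (f n x)"
  by (simp add: scomp_def compose_def)

lemma sid_apply [simp]: "x \<in> cells X n \<Longrightarrow> sid X n x = x"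
  by (simp add: sid_def)

lemma scomp_in: "f \<in> shom X Y \<Longrightarrow> g \<in> shom Y Z \<Longrightarrow> scomp X g f \<in> shom X Z"
  unfolding scomp_def compose_def
  by (rule shomI) (auto simp: shom_act shom_in intro: shom_ss)

lemma sid_in: "simplicial_set X \<Longrightarrow> sid X \<in> shom X X"
  unfolding sid_def by (rule shomI) auto

lemma scomp_eqD: "scomp X g f = scomp X g' f' \<Longrightarrow> x \<in> cells X n \<Longrightarrow> g n (f n x) = g' n (f' n x)"
  using scomp_apply by metis

lemma scomp_eqI:
  assumes "\<And>n x. x \<in> cells X n \<Longrightarrow> g n (f n x) = h n x" "h \<in> shom X Z"
  shows "scomp X g f = h"
proof
  fix n
  show "scomp X g f n = h n"
    using assms by (intro extensionalityI[of _ "cells X n"]) (auto simp: scomp_def compose_def shom_def PiE_def)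
qed

lemma simplicial_setI:
  assumes "\<And>m n \<theta> x. \<theta> \<in> ord_maps m n \<Longrightarrow> x \<in> cells X n \<Longrightarrow> act X m n \<theta> x \<in> cells X m"
    "\<And>n x. x \<in> cells X n \<Longrightarrow> act X n n (ord_id n) x = x"
    "\<And>l m n \<phi> \<theta> x. \<phi> \<in> ord_maps l m \<Longrightarrow> \<theta> \<in> ord_maps m n \<Longrightarrow> x \<in> cells X n \<Longrightarrow>
        act X l m \<phi> (act X m n \<theta> x) = act X l n (compose {..l} \<theta> \<phi>) x"
  shows "simplicial_set X"
  using assms by (simp add: simplicial_set_def)

lemma simplex_simps [simp]: "cells (simplex n) m = ord_maps m n"
    "act (simplex n) l m \<phi> \<theta> = compose {..l} \<theta> \<phi>"
  by (simp_all add: simplex_def)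

lemma horn_simps: "cells (horn n k) m = {\<theta> \<in> ord_maps m n. \<exists>j\<le>n. j \<noteq> k \<and> j \<notin> \<theta> ` {..m}}"
  and act_horn [simp]: "act (horn n k) l m \<phi> \<theta> = compose {..l} \<theta> \<phi>"
  by (simp_all add: horn_def)

lemma sprod_simps [simp]: "cells (sprod X Y) n = cells X n \<times> cells Y n"
    "act (sprod X Y) m n \<theta> (x, y) = (act X m n \<theta> x, act Y m n \<theta> y)"
  by (simp_all add: sprod_def)

lemma simplicial_simplex [simp]: "simplicial_set (simplex n)"
  by (rule simplicial_setI)
    (auto simp: ord_maps_compose compose_ord_id_right compose_ord_assoc)

lemma horn_subset: "\<theta> \<in> cells (horn n k) m \<Longrightarrow> \<theta> \<in> ord_maps m n"
  by (simp add: horn_simps)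

lemma horn_compose: "\<phi> \<in> ord_maps l m \<Longrightarrow> \<theta> \<in> cells (horn n k) m \<Longrightarrow> compose {..l} \<theta> \<phi> \<in> cells (horn n k) l"
  by (fastforce simp: horn_simps ord_maps_compose ord_maps_le image_iff)

lemma simplicial_horn [simp]: "simplicial_set (horn n k)"
  by (rule simplicial_setI)
    (auto simp: horn_compose compose_ord_id_right compose_ord_assoc dest: horn_subset)

lemma simplicial_sprod: "simplicial_set X \<Longrightarrow> simplicial_set Y \<Longrightarrow> simplicial_set (sprod X Y)"
  by (rule simplicial_setI) (auto simp: act_in act_id act_act)

lemma horn_filler_iff:
  assumes p: "p \<in> shom X S" and u: "u \<in> shom (horn n k) X" and v: "v \<in> shom (simplex n) S"
  shows "horn_filler n k X p u v \<longleftrightarrow> (\<exists>h\<in>shom (simplex n) X.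
    (\<forall>m. \<forall>\<theta>\<in>cells (horn n k) m. h m \<theta> = u m \<theta>) \<and> (\<forall>m. \<forall>\<theta>\<in>ord_maps m n. p m (h m \<theta>) = v m \<theta>))"
proof -
  have "scomp (horn n k) h (horn_incl n k) = u \<longleftrightarrow> (\<forall>m. \<forall>\<theta>\<in>cells (horn n k) m. h m \<theta> = u m \<theta>)" for h
    using scomp_eqI[OF _ u, of h "horn_incl n k"] by (auto simp: horn_incl_def)
  moreover have "scomp (simplex n) p h = v \<longleftrightarrow> (\<forall>m. \<forall>\<theta>\<in>ord_maps m n. p m (h m \<theta>) = v m \<theta>)" for h
    using scomp_eqI[OF _ v, of p h] by auto
  ultimately show ?thesis unfolding horn_filler_def by simp
qed

lemma horn_square_iff:
  assumes p: "p \<in> shom X S" and u: "u \<in> shom (horn n k) X" and v: "v \<in> shom (simplex n) S"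
  shows "scomp (horn n k) p u = scomp (horn n k) v (horn_incl n k) \<longleftrightarrow>
    (\<forall>m. \<forall>\<theta>\<in>cells (horn n k) m. p m (u m \<theta>) = v m \<theta>)" (is "?L \<longleftrightarrow> ?R")
proof
  assume ?L
  then show ?R using scomp_eqD[of "horn n k" p u v "horn_incl n k"] by (auto simp: horn_incl_def)
next
  have hi: "horn_incl n k \<in> shom (horn n k) (simplex n)"
    unfolding horn_incl_def sid_def by (rule shomI) (auto simp: horn_compose dest: horn_subset)
  assume ?R
  then show ?L
    by (intro scomp_eqI[OF _ scomp_in[OF hi v]]) (simp add: horn_incl_def)
qed

lemma quasi_category_filler:
  assumes C: "quasi_category C" and k: "0 < k" "k < n" and u: "u \<in> shom (horn n k) C"
  obtains h where "h \<in> shom (simplex n) C" "\<And>m \<theta>. \<theta> \<in> cells (horn n k) m \<Longrightarrow> h m \<theta> = u m \<theta>"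
proof -
  obtain h where h: "h \<in> shom (simplex n) C" "scomp (horn n k) h (horn_incl n k) = u"
    using assms unfolding quasi_category_def by blast
  have "h m \<theta> = u m \<theta>" if "\<theta> \<in> cells (horn n k) m" for m \<theta>
    unfolding h(2)[symmetric] using that by (simp add: horn_incl_def)
  with h(1) show ?thesis by (rule that)
qed

definition yoneda :: "'a sset \<Rightarrow> nat \<Rightarrow> 'a \<Rightarrow> (nat \<Rightarrow> nat, 'a) smap" where
  "yoneda X n x = (\<lambda>m. \<lambda>\<theta>\<in>ord_maps m n. act X m n \<theta> x)"

lemma yoneda_in: "simplicial_set X \<Longrightarrow> x \<in> cells X n \<Longrightarrow> yoneda X n x \<in> shom (simplex n) X"
  unfolding yoneda_def
  using shomI[of "simplex n" X "\<lambda>m \<theta>. act X m n \<theta> x"] by (simp add: act_in act_act)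

lemma yoneda_apply [simp]: "\<theta> \<in> ord_maps m n \<Longrightarrow> yoneda X n x m \<theta> = act X m n \<theta> x"
  by (simp add: yoneda_def)

section \<open>Partial simplicial maps\<close>

text \<open>
  A simplicial map defined on a subcomplex of \<open>D\<close> is represented by its graph: inclusion of graphs is
  extension of maps, and the union of a chain of graphs is a graph, as Zorn's lemma requires.
\<close>

definition partial_map :: "'a sset \<Rightarrow> 'b sset \<Rightarrow> (nat \<times> 'a \<times> 'b) set \<Rightarrow> bool" where
  "partial_map D P \<Gamma> \<longleftrightarrow> (\<forall>n x y. (n, x, y) \<in> \<Gamma> \<longrightarrow> x \<in> cells D n \<and> y \<in> cells P n) \<and>
     (\<forall>n x y y'. (n, x, y) \<in> \<Gamma> \<longrightarrow> (n, x, y') \<in> \<Gamma> \<longrightarrow> y = y') \<and>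
     (\<forall>m n \<theta> x y. \<theta> \<in> ord_maps m n \<longrightarrow> (n, x, y) \<in> \<Gamma> \<longrightarrow> (m, act D m n \<theta> x, act P m n \<theta> y) \<in> \<Gamma>)"

definition dom_at :: "(nat \<times> 'a \<times> 'b) set \<Rightarrow> nat \<Rightarrow> 'a set" where
  "dom_at \<Gamma> n = {x. \<exists>y. (n, x, y) \<in> \<Gamma>}"

definition value_at :: "(nat \<times> 'a \<times> 'b) set \<Rightarrow> nat \<Rightarrow> 'a \<Rightarrow> 'b" where
  "value_at \<Gamma> n x = (THE y. (n, x, y) \<in> \<Gamma>)"

lemma partial_map_cells: "partial_map D P \<Gamma> \<Longrightarrow> (n, x, y) \<in> \<Gamma> \<Longrightarrow> x \<in> cells D n \<and> y \<in> cells P n"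
  and partial_map_fun: "partial_map D P \<Gamma> \<Longrightarrow> (n, x, y) \<in> \<Gamma> \<Longrightarrow> (n, x, y') \<in> \<Gamma> \<Longrightarrow> y = y'"
  and partial_map_act: "partial_map D P \<Gamma> \<Longrightarrow> \<theta> \<in> ord_maps m n \<Longrightarrow> (n, x, y) \<in> \<Gamma> \<Longrightarrow>
     (m, act D m n \<theta> x, act P m n \<theta> y) \<in> \<Gamma>"
  unfolding partial_map_def by blast+

lemma value_at_eq: "partial_map D P \<Gamma> \<Longrightarrow> (n, x, y) \<in> \<Gamma> \<Longrightarrow> value_at \<Gamma> n x = y"
  unfolding value_at_def by (blast intro: partial_map_fun)

lemma value_at_in: "partial_map D P \<Gamma> \<Longrightarrow> x \<in> dom_at \<Gamma> n \<Longrightarrow> (n, x, value_at \<Gamma> n x) \<in> \<Gamma>"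
  by (auto simp: dom_at_def value_at_eq)

lemma dom_at_act: "partial_map D P \<Gamma> \<Longrightarrow> x \<in> dom_at \<Gamma> n \<Longrightarrow> \<theta> \<in> ord_maps m n \<Longrightarrow> act D m n \<theta> x \<in> dom_at \<Gamma> m"
  by (auto simp: dom_at_def dest: partial_map_act)

lemma total_partial_map:
  assumes \<Gamma>: "partial_map D P \<Gamma>" and D: "simplicial_set D" and P: "simplicial_set P"
    and total: "\<And>n x. x \<in> cells D n \<Longrightarrow> x \<in> dom_at \<Gamma> n"
  shows "(\<lambda>n. \<lambda>x\<in>cells D n. value_at \<Gamma> n x) \<in> shom D P"
proof (rule shomI[OF D P])
  fix n x assume x: "x \<in> cells D n"
  show "value_at \<Gamma> n x \<in> cells P n"
    using value_at_in[OF \<Gamma> total[OF x]] partial_map_cells[OF \<Gamma>] by blast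
  fix m \<theta> assume "\<theta> \<in> ord_maps m n"
  then show "value_at \<Gamma> m (act D m n \<theta> x) = act P m n \<theta> (value_at \<Gamma> n x)"
    using value_at_in[OF \<Gamma> total[OF x]] partial_map_act[OF \<Gamma>] value_at_eq[OF \<Gamma>] by blast
qed

lemma partial_map_Union:
  assumes \<C>: "\<And>\<Gamma>. \<Gamma> \<in> \<C> \<Longrightarrow> partial_map D P \<Gamma>" and chain: "\<And>\<Gamma> \<Delta>. \<Gamma> \<in> \<C> \<Longrightarrow> \<Delta> \<in> \<C> \<Longrightarrow> \<Gamma> \<subseteq> \<Delta> \<or> \<Delta> \<subseteq> \<Gamma>"
  shows "partial_map D P (\<Union>\<C>)"
  unfolding partial_map_def
proof (intro conjI allI impI)
  fix n x y y' assume "(n, x, y) \<in> \<Union>\<C>" "(n, x, y') \<in> \<Union>\<C>"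
  then obtain \<Gamma> \<Delta> where "\<Gamma> \<in> \<C>" "\<Delta> \<in> \<C>" "(n, x, y) \<in> \<Gamma>" "(n, x, y') \<in> \<Delta>" by blast
  then show "y = y'"
    using chain[of \<Gamma> \<Delta>] partial_map_fun[OF \<C>[of \<Gamma>]] partial_map_fun[OF \<C>[of \<Delta>]] by blast
next
  fix n x y assume "(n, x, y) \<in> \<Union>\<C>"
  then obtain \<Gamma> where "\<Gamma> \<in> \<C>" "(n, x, y) \<in> \<Gamma>" by blast
  then show "x \<in> cells D n" "y \<in> cells P n" using partial_map_cells[OF \<C>[of \<Gamma>]] by blast+
next
  fix m n \<theta> x y assume \<theta>: "\<theta> \<in> ord_maps m n" and "(n, x, y) \<in> \<Union>\<C>"
  then obtain \<Gamma> where "\<Gamma> \<in> \<C>" "(n, x, y) \<in> \<Gamma>" by blast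
  then show "(m, act D m n \<theta> x, act P m n \<theta> y) \<in> \<Union>\<C>"
    using partial_map_act[OF \<C>[of \<Gamma>] \<theta>] by blast
qed

text \<open>
  If all faces of \<open>\<sigma>\<close> but the \<open>k\<close>-th are in the domain, then the domain pulls back along \<open>\<sigma>\<close> to a horn, and
  a filler of that horn extends the partial map to \<open>\<sigma>\<close>. The new values are well defined although \<open>\<sigma>\<close> may be
  badly non-injective on its boundary: outside the horn, distinct operators applied to \<open>\<sigma>\<close> give distinct
  simplices (\<open>operator_unique\<close>), as in the proof of the Eilenberg--Zilber lemma.
\<close>

locale horn_attachment =
  fixes D :: "'a sset" and P :: "'b sset" and \<Gamma> :: "(nat \<times> 'a \<times> 'b) set"
    and N k :: nat and \<sigma> :: 'a
  assumes D: "simplicial_set D" and P: "simplicial_set P" and \<Gamma>: "partial_map D P \<Gamma>"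
    and \<sigma>: "\<sigma> \<in> cells D (Suc N)" and k: "k \<le> Suc N"
    and faces: "\<And>j. j \<le> Suc N \<Longrightarrow> j \<noteq> k \<Longrightarrow> act D N (Suc N) (coface N j) \<sigma> \<in> dom_at \<Gamma> N"
    and missing: "act D N (Suc N) (coface N k) \<sigma> \<notin> dom_at \<Gamma> N"
begin

definition data :: "(nat \<Rightarrow> nat, 'b) smap" where
  "data = (\<lambda>m. \<lambda>\<theta>\<in>cells (horn (Suc N) k) m. value_at \<Gamma> m (act D m (Suc N) \<theta> \<sigma>))"

lemma horn_in_dom:
  assumes "\<theta> \<in> cells (horn (Suc N) k) m"
  shows "act D m (Suc N) \<theta> \<sigma> \<in> dom_at \<Gamma> m"
proof -
  obtain j where j: "j \<le> Suc N" "j \<noteq> k" "j \<notin> \<theta> ` {..m}" and \<theta>: "\<theta> \<in> ord_maps m (Suc N)"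
    using assms by (auto simp: horn_simps)
  obtain \<theta>' where \<theta>': "\<theta>' \<in> ord_maps m N" "\<theta> = compose {..m} (coface N j) \<theta>'"
    using factor_coface[OF \<theta> j(1,3)] .
  show ?thesis
    using dom_at_act[OF \<Gamma> faces[OF j(1,2)] \<theta>'(1)]
    by (simp add: \<theta>' act_act[OF D \<theta>'(1) coface_in[OF j(1)] \<sigma>])
qed

lemma not_in_dom:
  assumes \<theta>: "\<theta> \<in> ord_maps m (Suc N)" and hit: "\<theta> \<notin> cells (horn (Suc N) k) m"
  shows "act D m (Suc N) \<theta> \<sigma> \<notin> dom_at \<Gamma> m"
proof
  assume dom: "act D m (Suc N) \<theta> \<sigma> \<in> dom_at \<Gamma> m"
  have hit: "\<And>j. j \<le> Suc N \<Longrightarrow> j \<noteq> k \<Longrightarrow> j \<in> \<theta> ` {..m}" using hit \<theta> by (auto simp: horn_simps)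
  obtain i where i: "i \<le> m" "\<theta> i \<noteq> k"
    using hit[of 0] hit[of 1] by (cases "k = 0") auto
  obtain \<delta> where "\<delta> \<in> ord_maps N m" "compose {..N} \<theta> \<delta> = coface N k"
    using partial_section[OF \<theta> hit k i] by blast
  then have "act D N (Suc N) (coface N k) \<sigma> \<in> dom_at \<Gamma> N"
    using dom_at_act[OF \<Gamma> dom, of \<delta> N] act_act[OF D _ \<theta> \<sigma>, of \<delta> N] by simp
  with missing show False by simp
qed

lemma data_graph: "\<theta> \<in> cells (horn (Suc N) k) m \<Longrightarrow> (m, act D m (Suc N) \<theta> \<sigma>, data m \<theta>) \<in> \<Gamma>"
  unfolding data_def using value_at_in[OF \<Gamma> horn_in_dom] by simp

lemma data_in: "data \<in> shom (horn (Suc N) k) P"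
  unfolding data_def
proof (rule shomI)
  fix n \<theta> assume \<theta>: "\<theta> \<in> cells (horn (Suc N) k) n"
  note g = value_at_in[OF \<Gamma> horn_in_dom[OF \<theta>]]
  show "value_at \<Gamma> n (act D n (Suc N) \<theta> \<sigma>) \<in> cells P n"
    using partial_map_cells[OF \<Gamma> g] by simp
  fix m \<phi> assume \<phi>: "\<phi> \<in> ord_maps m n"
  show "value_at \<Gamma> m (act D m (Suc N) (act (horn (Suc N) k) m n \<phi> \<theta>) \<sigma>) =
      act P m n \<phi> (value_at \<Gamma> n (act D n (Suc N) \<theta> \<sigma>))"
    using value_at_eq[OF \<Gamma> partial_map_act[OF \<Gamma> \<phi> g]] act_act[OF D \<phi> horn_subset[OF \<theta>] \<sigma>]
    by simp
qed (use P in simp_all)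

text \<open>
  Compose \<open>\<theta>\<close> with a section of it through \<open>i\<close>. Then \<open>\<theta>'\<close> composed with the same section gives the missing
  face of \<open>\<sigma>\<close> too, so it cannot lie in the horn and has to be the \<open>k\<close>-th coface itself.
\<close>

lemma operator_unique_aux:
  assumes \<theta>: "\<theta> \<in> ord_maps m (Suc N)" "\<theta> \<notin> cells (horn (Suc N) k) m"
    and \<theta>': "\<theta>' \<in> ord_maps m (Suc N)"
    and eq: "act D m (Suc N) \<theta> \<sigma> = act D m (Suc N) \<theta>' \<sigma>" and i: "i \<le> m" "\<theta> i \<noteq> k"
  shows "\<theta>' i = \<theta> i"
proof -
  have hit: "\<And>j. j \<le> Suc N \<Longrightarrow> j \<noteq> k \<Longrightarrow> j \<in> \<theta> ` {..m}" using \<theta> by (auto simp: horn_simps)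
  obtain \<delta> where \<delta>: "\<delta> \<in> ord_maps N m" "compose {..N} \<theta> \<delta> = coface N k" "i \<in> \<delta> ` {..N}"
    using partial_section[OF \<theta>(1) hit k i] by blast
  let ?\<psi> = "compose {..N} \<theta>' \<delta>"
  have \<psi>: "?\<psi> \<in> ord_maps N (Suc N)" using ord_maps_compose[OF \<theta>' \<delta>(1)] .
  have "act D N (Suc N) ?\<psi> \<sigma> = act D N (Suc N) (coface N k) \<sigma>"
    using act_act[OF D \<delta>(1) \<theta>(1) \<sigma>] act_act[OF D \<delta>(1) \<theta>' \<sigma>] eq \<delta>(2) by simp
  then have "?\<psi> \<notin> cells (horn (Suc N) k) N" using horn_in_dom missing by metis
  then have sub: "{..Suc N} - {k} \<subseteq> ?\<psi> ` {..N}" using \<psi> by (auto simp: horn_simps)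
  have fin: "card (?\<psi> ` {..N}) \<le> card ({..Suc N} - {k})"
    using card_image_le[of "{..N}" ?\<psi>] k by simp
  have img: "{..Suc N} - {k} = ?\<psi> ` {..N}"
    by (rule card_seteq[OF _ sub fin]) simp
  have "?\<psi> = coface N k"
  proof (rule ord_maps_eqI[OF \<psi> coface_in[OF k]])
    have inj: "inj_on ?\<psi> {..N}"
      using k by (intro eq_card_imp_inj_on) (simp_all flip: img del: compose_le)
    have inj': "inj_on (coface N k) {..N}" by (auto simp: inj_on_def split: if_splits)
    have img': "coface N k ` {..N} = ?\<psi> ` {..N}"
    proof (rule card_seteq[OF _ _ ])
      show "coface N k ` {..N} \<subseteq> ?\<psi> ` {..N}" unfolding img[symmetric] by (auto split: if_splits)
      show "card (?\<psi> ` {..N}) \<le> card (coface N k ` {..N})"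
        using card_image[OF inj'] card_image_le[of "{..N}" ?\<psi>] by simp
    qed simp
    have sm: "strict_mono_on {..N} ?\<psi>" "strict_mono_on {..N} (coface N k)"
      by (rule ord_maps_strict[OF \<psi> inj], rule ord_maps_strict[OF coface_in[OF k] inj'])
    fix a assume "a \<le> N"
    then show "?\<psi> a = coface N k a" using strict_mono_image_unique[OF sm img'[symmetric]] by blast
  qed
  then have "compose {..N} \<theta>' \<delta> = compose {..N} \<theta> \<delta>" using \<delta>(2) by simp
  moreover obtain a where "a \<le> N" "i = \<delta> a" using \<delta>(3) by blast
  ultimately show ?thesis using compose_le by metis
qed

lemma operator_unique:
  assumes \<theta>: "\<theta> \<in> ord_maps m (Suc N)" "\<theta> \<notin> cells (horn (Suc N) k) m"
    and \<theta>': "\<theta>' \<in> ord_maps m (Suc N)"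
    and eq: "act D m (Suc N) \<theta> \<sigma> = act D m (Suc N) \<theta>' \<sigma>"
  shows "\<theta> = \<theta>'"
proof (rule ord_maps_eqI[OF \<theta>(1) \<theta>'])
  have \<theta>'2: "\<theta>' \<notin> cells (horn (Suc N) k) m" using not_in_dom[OF \<theta>] horn_in_dom eq by metis
  fix i assume "i \<le> m"
  then show "\<theta> i = \<theta>' i"
    using operator_unique_aux[OF \<theta> \<theta>' eq, of i] operator_unique_aux[OF \<theta>' \<theta>'2 \<theta>(1) eq[symmetric], of i]
    by metis
qed

definition attach :: "(nat \<Rightarrow> nat, 'b) smap \<Rightarrow> (nat \<times> 'a \<times> 'b) set" where
  "attach F = \<Gamma> \<union> {(m, act D m (Suc N) \<theta> \<sigma>, F m \<theta>) |m \<theta>. \<theta> \<in> ord_maps m (Suc N)}"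

lemma attach_cases:
  assumes "\<forall>m. \<forall>\<theta>\<in>cells (horn (Suc N) k) m. F m \<theta> = data m \<theta>" and "(m, x, y) \<in> attach F"
  obtains "(m, x, y) \<in> \<Gamma>"
  | \<theta> where "\<theta> \<in> ord_maps m (Suc N)" "\<theta> \<notin> cells (horn (Suc N) k) m" "x = act D m (Suc N) \<theta> \<sigma>" "y = F m \<theta>"
  using assms data_graph unfolding attach_def by fastforce

lemma attach_partial_map:
  assumes F: "F \<in> shom (simplex (Suc N)) P"
    and Fd: "\<forall>m. \<forall>\<theta>\<in>cells (horn (Suc N) k) m. F m \<theta> = data m \<theta>"
  shows "partial_map D P (attach F)"
  unfolding partial_map_def
proof (intro conjI allI impI)
  fix n x y assume "(n, x, y) \<in> attach F"
  then show "x \<in> cells D n" "y \<in> cells P n"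
    unfolding attach_def
    using partial_map_cells[OF \<Gamma>] shom_in[OF F] act_in[OF D _ \<sigma>] by fastforce+
next
  fix m n \<theta> x y assume \<theta>: "\<theta> \<in> ord_maps m n" and xy: "(n, x, y) \<in> attach F"
  from xy consider "(n, x, y) \<in> \<Gamma>"
    | \<phi> where "\<phi> \<in> ord_maps n (Suc N)" "x = act D n (Suc N) \<phi> \<sigma>" "y = F n \<phi>"
    unfolding attach_def by blast
  then show "(m, act D m n \<theta> x, act P m n \<theta> y) \<in> attach F"
  proof cases
    case 1
    then show ?thesis using partial_map_act[OF \<Gamma> \<theta>] by (simp add: attach_def)
  next
    case 2
    have "act D m n \<theta> x = act D m (Suc N) (compose {..m} \<phi> \<theta>) \<sigma>"
      using act_act[OF D \<theta> 2(1) \<sigma>] 2 by simp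
    moreover have "act P m n \<theta> y = F m (compose {..m} \<phi> \<theta>)"
      using shom_act[OF F \<theta>] 2 by simp
    ultimately show ?thesis using ord_maps_compose[OF 2(1) \<theta>] unfolding attach_def by blast
  qed
next
  fix n x y y' assume a: "(n, x, y) \<in> attach F" and b: "(n, x, y') \<in> attach F"
  from a show "y = y'"
  proof (cases rule: attach_cases[OF Fd, consumes 1])
    case g: 1
    from b show ?thesis
    proof (cases rule: attach_cases[OF Fd, consumes 1])
      case 1
      with g show ?thesis using partial_map_fun[OF \<Gamma>] by blast
    next
      case 2
      with g not_in_dom show ?thesis by (auto simp: dom_at_def)
    qed
  next
    case \<theta>: (2 \<theta>)
    from b show ?thesis
    proof (cases rule: attach_cases[OF Fd, consumes 1])
      case 1
      with \<theta> not_in_dom show ?thesis by (auto simp: dom_at_def)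
    next
      case (2 \<phi>)
      then have "\<theta> = \<phi>" using \<theta> by (intro operator_unique) auto
      with \<theta> 2 show ?thesis by simp
    qed
  qed
qed

lemma attach_grows: "\<Gamma> \<subset> attach F"
proof -
  have "(N, act D N (Suc N) (coface N k) \<sigma>, F N (coface N k)) \<in> attach F"
    using coface_in[OF k] unfolding attach_def by blast
  then show ?thesis using missing unfolding attach_def dom_at_def by blast
qed

end

section \<open>The cylinder of a map to the interval\<close>

text \<open>
  For \<open>\<chi> : R \<rightarrow> \<Delta>\<^sup>1\<close>, the simplices of \<open>cyl\<close> are the pairs of a simplex \<open>x\<close> of \<open>R\<close> and \<open>\<epsilon> \<ge> \<chi> x\<close>. Read
  \<open>(x, threshold N c)\<close> as the string \<open>x\<^sub>0 \<dots> x\<^sub>c\<^sub>-\<^sub>1 y\<^sub>c \<dots> y\<^sub>N\<close>, where \<open>y\<^sub>i\<close> is a pushed copy of the vertex \<open>x\<^sub>i\<close>. The condition says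
  that a vertex with \<open>\<chi> = 1\<close> occurs in pushed form only, in other words that it is identified with its
  pushed copy. Without this identification the last prism over \<open>x\<close> would have to be attached along an outer horn.
\<close>

locale cylinder =
  fixes R :: "'r sset" and \<chi> :: "('r, nat \<Rightarrow> nat) smap"
  assumes \<chi>: "\<chi> \<in> shom R (simplex 1)"
begin

definition cyl :: "('r \<times> (nat \<Rightarrow> nat)) sset" where
  "cyl = \<lparr>cells = (\<lambda>n. {(x, \<epsilon>). x \<in> cells R n \<and> \<epsilon> \<in> ord_maps n 1 \<and> (\<forall>i\<le>n. \<chi> n x i \<le> \<epsilon> i)}),
          act = act (sprod R (simplex 1))\<rparr>"

text \<open>
  The string \<open>x\<^sub>0 \<dots> x\<^sub>c y\<^sub>c \<dots> y\<^sub>N\<close>. Omitting \<open>x\<^sub>c\<close> or \<open>y\<^sub>c\<close> leaves \<open>(x, threshold N c)\<close> or \<open>(x, threshold N (Suc c))\<close>.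
\<close>

definition prism :: "nat \<Rightarrow> 'r \<Rightarrow> nat \<Rightarrow> 'r \<times> (nat \<Rightarrow> nat)" where
  "prism N x c = (act R (Suc N) N (codegeneracy N c) x, threshold (Suc N) (Suc c))"

text \<open>
  Prisms are attached along the horn that lacks the face number \<open>c + b\<close>, where \<open>b\<close> is \<open>0\<close> or \<open>1\<close>. A domain is
  \<open>paired\<close> if it never contains that face without the prism. With this invariant, a domain that contains all
  strings of smaller dimension contains the prisms over all proper faces of \<open>x\<close>.
\<close>

definition paired :: "nat \<Rightarrow> (nat \<times> ('r \<times> (nat \<Rightarrow> nat)) \<times> 'b) set \<Rightarrow> bool" where
  "paired b \<Gamma> \<longleftrightarrow> (\<forall>N x c. x \<in> cells R N \<longrightarrow> c \<le> N \<longrightarrow> \<chi> N x c = 0 \<longrightarrow>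
     (x, threshold N (c + b)) \<in> dom_at \<Gamma> N \<longrightarrow> prism N x c \<in> dom_at \<Gamma> (Suc N))"

lemma R: "simplicial_set R"
  using \<chi> by (rule shom_ss)

lemma \<chi>_in: "x \<in> cells R n \<Longrightarrow> \<chi> n x \<in> ord_maps n 1"
  using shom_in[OF \<chi>] by simp

lemma \<chi>_act: "\<theta> \<in> ord_maps m n \<Longrightarrow> x \<in> cells R n \<Longrightarrow> i \<le> m \<Longrightarrow> \<chi> m (act R m n \<theta> x) i = \<chi> n x (\<theta> i)"
  using shom_act[OF \<chi>, of \<theta> m n x] by simp

lemma \<chi>_below: "x \<in> cells R n \<Longrightarrow> \<chi> n x c = 0 \<Longrightarrow> i \<le> c \<Longrightarrow> c \<le> n \<Longrightarrow> \<chi> n x i = 0"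
  using ord_maps_mono[OF \<chi>_in, of x n i c] by simp

lemma \<chi>_le_1: "x \<in> cells R n \<Longrightarrow> i \<le> n \<Longrightarrow> \<chi> n x i \<le> 1"
  by (rule ord_maps_le[OF \<chi>_in])

lemma act_cyl [simp]: "act cyl m n \<theta> (x, \<epsilon>) = (act R m n \<theta> x, compose {..m} \<epsilon> \<theta>)"
  by (simp add: cyl_def)

lemma cells_cyl: "(x, \<epsilon>) \<in> cells cyl n \<longleftrightarrow> x \<in> cells R n \<and> \<epsilon> \<in> ord_maps n 1 \<and> (\<forall>i\<le>n. \<chi> n x i \<le> \<epsilon> i)"
  by (simp add: cyl_def)

lemma cells_cyl_threshold: "(x, threshold n c) \<in> cells cyl n \<longleftrightarrow> x \<in> cells R n \<and> (\<forall>i<c. i \<le> n \<longrightarrow> \<chi> n x i = 0)"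
proof -
  have "\<chi> n x i \<le> threshold n c i \<longleftrightarrow> (i < c \<longrightarrow> \<chi> n x i = 0)" if "x \<in> cells R n" "i \<le> n" for i
    using \<chi>_le_1[OF that] that by simp
  then show ?thesis by (auto simp: cells_cyl \<chi>_le_1)
qed

lemma cyl: "simplicial_set cyl"
  by (rule simplicial_setI)
    (auto simp: cells_cyl act_in[OF R] act_id[OF R] act_act[OF R] ord_maps_compose \<chi>_act ord_maps_le
      compose_ord_id_right compose_ord_assoc)

lemma prism_in:
  assumes "x \<in> cells R N" "c \<le> N" "\<chi> N x c = 0"
  shows "prism N x c \<in> cells cyl (Suc N)"
  using assms codegeneracy_in[OF assms(2)]
  by (auto simp: prism_def cells_cyl_threshold act_in[OF R] \<chi>_act intro: \<chi>_below)

lemma prism_face_end: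
  assumes x: "x \<in> cells R N" and c: "c \<le> N" and j: "j = c \<or> j = Suc c"
  shows "act cyl N (Suc N) (coface N j) (prism N x c) = (x, threshold N j)"
proof -
  have cj: "coface N j \<in> ord_maps N (Suc N)" using c j by (intro coface_in) auto
  have "compose {..N} (codegeneracy N c) (coface N j) = ord_id N"
    by (rule ord_maps_eqI[OF ord_maps_compose[OF codegeneracy_in[OF c] cj] ord_id_in]) (use j in auto)
  moreover have "compose {..N} (threshold (Suc N) (Suc c)) (coface N j) = threshold N j"
    by (rule ord_maps_eqI[OF ord_maps_compose[OF threshold_in cj] threshold_in]) (use j in auto)
  ultimately show ?thesis
    using act_act[OF R cj codegeneracy_in[OF c] x] act_id[OF R x] by (simp add: prism_def)
qed

lemma prism_face_inner:
  assumes x: "x \<in> cells R (Suc M)" and c: "c \<le> Suc M"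
    and j: "j \<le> Suc M" and c': "c' \<le> M"
    and choice: "j < c \<and> c = Suc c' \<and> i = j \<or> c < j \<and> c' = c \<and> i = Suc j"
  shows "act cyl (Suc M) (Suc (Suc M)) (coface (Suc M) i) (prism (Suc M) x c) =
    prism M (act R M (Suc M) (coface M j) x) c'"
proof -
  have i: "coface (Suc M) i \<in> ord_maps (Suc M) (Suc (Suc M))" using choice j by (intro coface_in) auto
  have j': "coface M j \<in> ord_maps M (Suc M)" using j by (intro coface_in) auto
  have "compose {..Suc M} (codegeneracy (Suc M) c) (coface (Suc M) i) = compose {..Suc M} (coface M j) (codegeneracy M c')"
    by (rule ord_maps_eqI[OF ord_maps_compose[OF codegeneracy_in[OF c] i] ord_maps_compose[OF j' codegeneracy_in[OF c']]])
      (use choice j c' in auto)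
  moreover have "compose {..Suc M} (threshold (Suc (Suc M)) (Suc c)) (coface (Suc M) i) = threshold (Suc M) (Suc c')"
    by (rule ord_maps_eqI[OF ord_maps_compose[OF threshold_in i] threshold_in]) (use choice in auto)
  ultimately show ?thesis
    using act_act[OF R i codegeneracy_in[OF c] x] act_act[OF R codegeneracy_in[OF c'] j' x]
    by (simp add: prism_def)
qed

lemma pairedD: "paired b \<Gamma> \<Longrightarrow> x \<in> cells R N \<Longrightarrow> c \<le> N \<Longrightarrow> \<chi> N x c = 0 \<Longrightarrow>
    (x, threshold N (c + b)) \<in> dom_at \<Gamma> N \<Longrightarrow> prism N x c \<in> dom_at \<Gamma> (Suc N)"
  unfolding paired_def by blast

lemma prism_attachment:
  assumes b: "b \<le> 1" and P: "simplicial_set P" and \<Gamma>: "partial_map cyl P \<Gamma>" and paired: "paired b \<Gamma>"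
    and lower: "\<And>m. m < N \<Longrightarrow> cells cyl m \<subseteq> dom_at \<Gamma> m"
    and x: "x \<in> cells R N" and c: "c \<le> N" "\<chi> N x c = 0"
    and new: "(x, threshold N (c + b)) \<notin> dom_at \<Gamma> N" and old: "(x, threshold N (c + 1 - b)) \<in> dom_at \<Gamma> N"
  shows "horn_attachment cyl P \<Gamma> N (c + b) (prism N x c)"
proof
  show "simplicial_set cyl" by (rule cyl)
  show "simplicial_set P" "partial_map cyl P \<Gamma>" by fact+
  show "prism N x c \<in> cells cyl (Suc N)" by (rule prism_in[OF x c])
  show "c + b \<le> Suc N" using b c by simp
  have ends: "act cyl N (Suc N) (coface N j) (prism N x c) = (x, threshold N j)" if "j = c \<or> j = Suc c" for j
    by (rule prism_face_end[OF x c(1) that])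
  show "act cyl N (Suc N) (coface N (c + b)) (prism N x c) \<notin> dom_at \<Gamma> N"
    using new b by (subst ends) auto
  fix i assume i: "i \<le> Suc N" "i \<noteq> c + b"
  show "act cyl N (Suc N) (coface N i) (prism N x c) \<in> dom_at \<Gamma> N"
  proof (cases "i = c \<or> i = Suc c")
    case True
    then have "i = c + 1 - b" using i b by auto
    then show ?thesis using ends[OF True] old by simp
  next
    case False
    obtain M where N: "N = Suc M" using False i c by (cases N) auto
    obtain j c' where j: "j \<le> Suc M" and c': "c' \<le> M"
      and choice: "j < c \<and> c = Suc c' \<and> i = j \<or> c < j \<and> c' = c \<and> i = Suc j"
    proof (cases "i < c")
      case True
      then show ?thesis using that[of i "c - 1"] c N by auto
    next
      case False
      then show ?thesis using that[of "i - 1" c] \<open>\<not> (i = c \<or> i = Suc c)\<close> i N by (cases i) auto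
    qed
    let ?y = "act R M N (coface M j) x"
    have cf: "coface M j \<in> ord_maps M N" unfolding N using j by (intro coface_in) auto
    have y: "?y \<in> cells R M" by (rule act_in[OF R cf x])
    have "\<chi> M ?y c' = \<chi> N x c" using \<chi>_act[OF cf x c'] c' choice by auto
    then have 0: "\<chi> M ?y c' = 0" using c by simp
    then have "(?y, threshold M (c' + b)) \<in> cells cyl M"
      using y c' b by (auto simp: cells_cyl_threshold intro: \<chi>_below)
    then have "(?y, threshold M (c' + b)) \<in> dom_at \<Gamma> M" using lower[of M] N by auto
    then have "prism M ?y c' \<in> dom_at \<Gamma> N" using pairedD[OF paired y c' 0] N by simp
    then show ?thesis
      using prism_face_inner[OF x[unfolded N] c(1)[unfolded N] j c' choice] N by simp
  qed
qed

text \<open>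
  A new simplex of the required form comes from an operator that hits all vertices of the prism except possibly
  the vertex number \<open>c + b\<close>. Its own prism results from inserting that vertex into the operator, at position \<open>c' + b\<close>.
\<close>

lemma paired_attach:
  assumes b: "b \<le> 1" and paired: "paired b \<Gamma>" and x: "x \<in> cells R N" and c: "c \<le> N"
    and att: "horn_attachment cyl P \<Gamma> N (c + b) (prism N x c)"
  shows "paired b (horn_attachment.attach cyl \<Gamma> N (prism N x c) F)"
  unfolding paired_def
proof (intro allI impI)
  interpret horn_attachment cyl P \<Gamma> N "c + b" "prism N x c" by (rule att)
  fix m x' c' assume x': "x' \<in> cells R m" and c': "c' \<le> m" and 0: "\<chi> m x' c' = 0"
    and dom: "(x', threshold m (c' + b)) \<in> dom_at (attach F) m"
  show "prism m x' c' \<in> dom_at (attach F) (Suc m)"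
  proof (cases "(x', threshold m (c' + b)) \<in> dom_at \<Gamma> m")
    case True
    then have "prism m x' c' \<in> dom_at \<Gamma> (Suc m)" using pairedD[OF paired x' c' 0] by blast
    then show ?thesis using attach_grows[of F] unfolding dom_at_def by blast
  next
    case False
    then obtain \<theta> where \<theta>: "\<theta> \<in> ord_maps m (Suc N)"
      and eq: "(x', threshold m (c' + b)) = act cyl m (Suc N) \<theta> (prism N x c)"
      using dom unfolding attach_def dom_at_def by blast
    have hit: "j \<in> \<theta> ` {..m}" if "j \<le> Suc N" "j \<noteq> c + b" for j
      using horn_in_dom[of \<theta> m] False eq that \<theta> by (auto simp: horn_simps)
    have cg: "codegeneracy N c \<in> ord_maps (Suc N) N" by (rule codegeneracy_in[OF c])
    have x'_eq: "x' = act R m N (compose {..m} (codegeneracy N c) \<theta>) x"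
      using eq act_act[OF R \<theta> cg x] by (simp add: prism_def)
    have "threshold m (c' + b) = compose {..m} (threshold (Suc N) (Suc c)) \<theta>"
      using eq by (simp add: prism_def)
    then have thr: "i < c' + b \<longleftrightarrow> \<theta> i \<le> c" if "i \<le> m" for i
      using that ord_maps_le[OF \<theta> that] by (auto simp: fun_eq_iff dest!: spec[of _ i] split: if_splits)
    \<comment> \<open>insert one more copy of the vertex number c + b\<close>
    define \<theta>' where "\<theta>' = (\<lambda>i\<in>{..Suc m}. if i < c' + b then \<theta> i else if i = c' + b then c + b else \<theta> (i - 1))"
    have \<theta>': "\<theta>' \<in> ord_maps (Suc m) (Suc N)"
      unfolding \<theta>'_def
    proof (rule ord_mapsI)
      fix i assume "i \<le> Suc m"
      then show "(if i < c' + b then \<theta> i else if i = c' + b then c + b else \<theta> (i - 1)) \<le> Suc N"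
        using ord_maps_le[OF \<theta>, of i] ord_maps_le[OF \<theta>, of "i - 1"] c' b c by auto
    next
      fix i j assume ij: "i \<le> j" "j \<le> Suc m"
      have *: "c + b \<le> \<theta> l" if "c' + b \<le> l" "l \<le> m" for l using thr[OF that(2)] that b by auto
      show "(if i < c' + b then \<theta> i else if i = c' + b then c + b else \<theta> (i - 1))
        \<le> (if j < c' + b then \<theta> j else if j = c' + b then c + b else \<theta> (j - 1))"
        using ij thr[of i] *[of "j - 1"] ord_maps_mono[OF \<theta>, of i j] ord_maps_mono[OF \<theta>, of i "j - 1"]
          ord_maps_mono[OF \<theta>, of "i - 1" "j - 1"] c' b by auto
    qed
    \<comment> \<open>the vertex of the prism next to the inserted one is hit, and monotonicity puts it at position c'\<close>
    have c'1: "\<theta> c' = (if b = 0 then Suc c else c)"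
    proof -
      define t where "t = (if b = 0 then Suc c else c)"
      have "t \<in> \<theta> ` {..m}" using hit[of t] c b by (auto simp: t_def split: if_splits)
      then obtain i where i: "i \<le> m" "\<theta> i = t" by auto
      have "b = 0 \<or> b = 1" using b by auto
      then have "\<theta> c' = t"
      proof
        assume "b = 0"
        then have "c' \<le> i" "Suc c \<le> \<theta> c'" using thr[OF i(1)] thr[OF c'] i(2) by (auto simp: t_def)
        then show ?thesis using ord_maps_mono[OF \<theta>, of c' i] i \<open>b = 0\<close> by (simp add: t_def)
      next
        assume "b = 1"
        then have "i \<le> c'" "\<theta> c' \<le> c" using thr[OF i(1)] thr[OF c'] i(2) by (auto simp: t_def)
        then show ?thesis using ord_maps_mono[OF \<theta>, of i c'] i c' \<open>b = 1\<close> by (simp add: t_def)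
      qed
      then show ?thesis by (simp add: t_def)
    qed
    have cg': "codegeneracy m c' \<in> ord_maps (Suc m) m" by (rule codegeneracy_in[OF c'])
    have cg\<theta>: "compose {..m} (codegeneracy N c) \<theta> \<in> ord_maps m N" by (rule ord_maps_compose[OF cg \<theta>])
    have "compose {..Suc m} (compose {..m} (codegeneracy N c) \<theta>) (codegeneracy m c') = compose {..Suc m} (codegeneracy N c) \<theta>'"
    proof (rule ord_maps_eqI[OF ord_maps_compose[OF cg\<theta> cg'] ord_maps_compose[OF cg \<theta>']])
      fix i assume i: "i \<le> Suc m"
      have "b = 0 \<or> b = 1" using b by auto
      then have "codegeneracy N c (\<theta> (codegeneracy m c' i)) = codegeneracy N c (\<theta>' i)"
      proof
        assume "b = 0"
        then show ?thesis using i c'1 c by (cases i c' rule: linorder_cases) (auto simp: \<theta>'_def)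
      next
        assume "b = 1"
        then show ?thesis using i c'1 c by (cases i "Suc c'" rule: linorder_cases) (auto simp: \<theta>'_def)
      qed
      then show "compose {..Suc m} (compose {..m} (codegeneracy N c) \<theta>) (codegeneracy m c') i =
          compose {..Suc m} (codegeneracy N c) \<theta>' i"
        using i ord_maps_le[OF cg' i] by simp
    qed
    moreover have "compose {..Suc m} (threshold (Suc N) (Suc c)) \<theta>' = threshold (Suc m) (Suc c')"
    proof (rule ord_maps_eqI[OF ord_maps_compose[OF threshold_in \<theta>'] threshold_in])
      fix i assume i: "i \<le> Suc m"
      have "\<theta>' i < Suc c \<longleftrightarrow> i < Suc c'"
        using i thr[of i] thr[of "i - 1"] b c' by (cases i) (auto simp: \<theta>'_def split: if_splits)
      then show "compose {..Suc m} (threshold (Suc N) (Suc c)) \<theta>' i = threshold (Suc m) (Suc c') i"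
        using i ord_maps_le[OF \<theta>' i] by simp
    qed
    ultimately have "prism m x' c' = act cyl (Suc m) (Suc N) \<theta>' (prism N x c)"
      using act_act[OF R cg' cg\<theta> x] act_act[OF R \<theta>' cg x] by (simp add: prism_def x'_eq)
    then show ?thesis using \<theta>' unfolding attach_def dom_at_def by blast
  qed
qed

end

section \<open>Extending maps over the cylinder\<close>

lemma maximal_partial_map:
  assumes \<Gamma>0: "partial_map D P \<Gamma>0" "Q \<Gamma>0"
    and chain: "\<And>\<C>. \<C> \<noteq> {} \<Longrightarrow> (\<And>\<Gamma>. \<Gamma> \<in> \<C> \<Longrightarrow> partial_map D P \<Gamma> \<and> Q \<Gamma>) \<Longrightarrow>
      (\<And>\<Gamma> \<Delta>. \<Gamma> \<in> \<C> \<Longrightarrow> \<Delta> \<in> \<C> \<Longrightarrow> \<Gamma> \<subseteq> \<Delta> \<or> \<Delta> \<subseteq> \<Gamma>) \<Longrightarrow> Q (\<Union>\<C>)"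
  obtains \<Gamma> where "partial_map D P \<Gamma>" "Q \<Gamma>" "\<Gamma>0 \<subseteq> \<Gamma>"
    "\<And>\<Delta>. partial_map D P \<Delta> \<Longrightarrow> Q \<Delta> \<Longrightarrow> \<not> \<Gamma> \<subset> \<Delta>"
proof -
  let ?A = "{\<Gamma>. partial_map D P \<Gamma> \<and> Q \<Gamma> \<and> \<Gamma>0 \<subseteq> \<Gamma>}"
  have "\<exists>M\<in>?A. \<forall>X\<in>?A. M \<subseteq> X \<longrightarrow> X = M"
  proof (rule subset_Zorn_nonempty)
    show "?A \<noteq> {}" using \<Gamma>0 by blast
    fix \<C> assume \<C>: "\<C> \<noteq> {}" "subset.chain ?A \<C>"
    have sub: "\<C> \<subseteq> ?A" and lin: "\<And>\<Gamma> \<Delta>. \<Gamma> \<in> \<C> \<Longrightarrow> \<Delta> \<in> \<C> \<Longrightarrow> \<Gamma> \<subseteq> \<Delta> \<or> \<Delta> \<subseteq> \<Gamma>"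
      using \<C>(2) unfolding subset_chain_def by blast+
    have "partial_map D P (\<Union>\<C>)" by (rule partial_map_Union) (use sub lin in blast)+
    moreover have "Q (\<Union>\<C>)" by (rule chain[OF \<C>(1)]) (use sub lin in blast)+
    moreover have "\<Gamma>0 \<subseteq> \<Union>\<C>" using \<C>(1) sub by blast
    ultimately show "\<Union>\<C> \<in> ?A" by blast
  qed
  then obtain M where "M \<in> ?A" "\<forall>X\<in>?A. M \<subseteq> X \<longrightarrow> X = M" by blast
  then show ?thesis using that[of M] by blast
qed

definition subcomplex :: "'a sset \<Rightarrow> (nat \<Rightarrow> 'a set) \<Rightarrow> bool" where
  "subcomplex D S \<longleftrightarrow> (\<forall>n. S n \<subseteq> cells D n) \<and>
     (\<forall>m n \<theta> x. \<theta> \<in> ord_maps m n \<longrightarrow> x \<in> S n \<longrightarrow> act D m n \<theta> x \<in> S m)"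

definition simplicial_on :: "'a sset \<Rightarrow> (nat \<Rightarrow> 'a set) \<Rightarrow> 'b sset \<Rightarrow> ('a, 'b) smap \<Rightarrow> bool" where
  "simplicial_on D S C f \<longleftrightarrow> (\<forall>n x. x \<in> S n \<longrightarrow> f n x \<in> cells C n) \<and>
     (\<forall>m n \<theta> x. \<theta> \<in> ord_maps m n \<longrightarrow> x \<in> S n \<longrightarrow> f m (act D m n \<theta> x) = act C m n \<theta> (f n x))"

lemma partial_map_graph:
  "subcomplex D S \<Longrightarrow> simplicial_on D S C f \<Longrightarrow> partial_map D C {(n, x, f n x) |n x. x \<in> S n}"
  unfolding partial_map_def subcomplex_def simplicial_on_def by fastforce

context cylinder
begin

lemma paired_Union: "\<C> \<noteq> {} \<Longrightarrow> (\<And>\<Gamma>. \<Gamma> \<in> \<C> \<Longrightarrow> paired b \<Gamma>) \<Longrightarrow> paired b (\<Union>\<C>)"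
  unfolding paired_def dom_at_def by blast

definition cyl_base :: "(nat \<Rightarrow> 'r set) \<Rightarrow> nat \<Rightarrow> ('r \<times> (nat \<Rightarrow> nat)) set" where
  "cyl_base W n = {(x, \<epsilon>) \<in> cells cyl n. x \<in> W n \<or> \<epsilon> = threshold n 0}"

lemma cyl_base_subcomplex: 
  assumes "subcomplex R W"
  shows "subcomplex cyl (cyl_base W)"
proof -
  have "compose {..m} (threshold n 0) \<theta> = threshold m 0" if "\<theta> \<in> ord_maps m n" for m n \<theta>
    by (rule ord_maps_eqI[OF ord_maps_compose[OF threshold_in that] threshold_in]) (use that in \<open>simp add: ord_maps_le\<close>)
  then show ?thesis
    using assms act_in[OF cyl]
    by (fastforce simp: subcomplex_def cyl_base_def)
qed

lemma threshold_inj: "threshold N (c + 1) \<noteq> threshold N 0"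
proof
  assume "threshold N (c + 1) = threshold N 0"
  then have "threshold N (c + 1) 0 = threshold N 0 0" by simp
  then show False by simp
qed

lemma minimal_outside:
  assumes "z \<in> cells cyl n" "z \<notin> dom_at \<Gamma> n"
  obtains N x c where "\<And>m. m < N \<Longrightarrow> cells cyl m \<subseteq> dom_at \<Gamma> m" "c \<le> Suc N" "(x, threshold N c) \<in> cells cyl N"
    "(x, threshold N c) \<notin> dom_at \<Gamma> N"
proof -
  define N where "N = (LEAST N. \<not> cells cyl N \<subseteq> dom_at \<Gamma> N)"
  have "\<not> cells cyl N \<subseteq> dom_at \<Gamma> N" unfolding N_def by (rule LeastI[of _ n]) (use assms in blast)
  then obtain x \<epsilon> where x: "(x, \<epsilon>) \<in> cells cyl N" "(x, \<epsilon>) \<notin> dom_at \<Gamma> N" by auto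
  obtain c where "c \<le> Suc N" "\<epsilon> = threshold N c"
    using ord_maps_1_threshold[of \<epsilon> N] x(1) by (auto simp: cells_cyl)
  with x show ?thesis using that[of N c x] not_less_Least[of _ "\<lambda>N. \<not> cells cyl N \<subseteq> dom_at \<Gamma> N"]
    unfolding N_def[symmetric] by blast
qed

text \<open>
  Take a maximal paired extension and a missing string \<open>x\<^sub>0 \<dots> x\<^sub>c y\<^sub>c\<^sub>+\<^sub>1 \<dots> y\<^sub>N\<close>, first with \<open>N\<close> and then with \<open>c\<close> as small as possible. The
  prism on it lacks only the face without \<open>y\<^sub>c\<close>. Its vertex \<open>y\<^sub>c\<close> is neither the first nor the last one: \<open>x\<close> is not
  in \<open>W\<close>, so some vertex of \<open>x\<close> has \<open>\<chi> = 1\<close>, which forces \<open>c < N\<close>. So the horn is inner.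
\<close>

lemma extend_to_cyl:
  fixes C :: "'a sset"
  assumes C: "quasi_category C" and W: "subcomplex R W"
    and W0: "\<And>n x. x \<in> cells R n \<Longrightarrow> (\<And>i. i \<le> n \<Longrightarrow> \<chi> n x i = 0) \<Longrightarrow> x \<in> W n"
    and f: "simplicial_on cyl (cyl_base W) C f"
  obtains g where "g \<in> shom cyl C" "\<And>n z. z \<in> cyl_base W n \<Longrightarrow> g n z = f n z"
proof -
  have CS: "simplicial_set C" using C by (simp add: quasi_category_def)
  define \<Gamma>0 where "\<Gamma>0 = {(n, z, f n z) |n z. z \<in> cyl_base W n}"
  have dom0: "dom_at \<Gamma>0 n = cyl_base W n" for n by (auto simp: \<Gamma>0_def dom_at_def)
  have \<Gamma>0: "partial_map cyl C \<Gamma>0"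
    unfolding \<Gamma>0_def by (rule partial_map_graph[OF cyl_base_subcomplex[OF W] f])
  have paired0: "paired 1 \<Gamma>0"
    unfolding paired_def dom0
  proof (intro allI impI)
    fix N x c assume a: "x \<in> cells R N" "c \<le> N" "\<chi> N x c = 0" "(x, threshold N (c + 1)) \<in> cyl_base W N"
    then have "x \<in> W N" using threshold_inj[of N c] by (auto simp: cyl_base_def)
    then have "act R (Suc N) N (codegeneracy N c) x \<in> W (Suc N)"
      using W codegeneracy_in[OF a(2)] by (auto simp: subcomplex_def)
    then show "prism N x c \<in> cyl_base W (Suc N)"
      using prism_in[OF a(1-3)] by (simp add: cyl_base_def prism_def)
  qed
  obtain \<Gamma> where \<Gamma>: "partial_map cyl C \<Gamma>" and paired: "paired 1 \<Gamma>" and sub: "\<Gamma>0 \<subseteq> \<Gamma>"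
    and max: "\<And>\<Delta>. partial_map cyl C \<Delta> \<Longrightarrow> paired 1 \<Delta> \<Longrightarrow> \<not> \<Gamma> \<subset> \<Delta>"
  proof (rule maximal_partial_map[of cyl C \<Gamma>0 "paired 1", OF \<Gamma>0 paired0])
    fix \<C> :: "(nat \<times> ('r \<times> (nat \<Rightarrow> nat)) \<times> 'a) set set"
    assume "\<C> \<noteq> {}" and \<C>: "\<And>\<Gamma>. \<Gamma> \<in> \<C> \<Longrightarrow> partial_map cyl C \<Gamma> \<and> paired 1 \<Gamma>"
    then show "paired 1 (\<Union>\<C>)" by (intro paired_Union) auto
  qed (rule that)
  have base: "cyl_base W n \<subseteq> dom_at \<Gamma> n" for n using sub dom0[of n] unfolding dom_at_def by blast
  have total: "z \<in> dom_at \<Gamma> n" if zin: "z \<in> cells cyl n" for n z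
  proof (rule ccontr)
    assume "z \<notin> dom_at \<Gamma> n"
    then obtain N x c0 where lower: "\<And>m. m < N \<Longrightarrow> cells cyl m \<subseteq> dom_at \<Gamma> m"
      and c0: "(x, threshold N c0) \<in> cells cyl N" "(x, threshold N c0) \<notin> dom_at \<Gamma> N" "c0 \<le> Suc N"
      using minimal_outside[OF zin] by metis
    define c1 where "c1 = (LEAST c. (x, threshold N c) \<notin> dom_at \<Gamma> N)"
    have c1: "(x, threshold N c1) \<notin> dom_at \<Gamma> N" unfolding c1_def by (rule LeastI[of _ c0]) (rule c0)
    have c1_le: "c1 \<le> c0" unfolding c1_def by (rule Least_le) (rule c0)
    have x: "x \<in> cells R N" using c0 by (simp add: cells_cyl)
    have c1_cell: "(x, threshold N c1) \<in> cells cyl N" using c0 c1_le by (auto simp: cells_cyl_threshold)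
    have outside: "(x, threshold N c1) \<notin> cyl_base W N" using base c1 by blast
    then have "c1 \<noteq> 0" using c1_cell by (auto simp: cyl_base_def)
    then obtain c where c: "c1 = c + 1" by (cases c1) auto
    have \<chi>c: "\<chi> N x i = 0" if "i \<le> c" "i \<le> N" for i using c1_cell that by (auto simp: c cells_cyl_threshold)
    have xW: "x \<notin> W N" using outside c1_cell by (simp add: cyl_base_def)
    then have "Suc c \<le> N" using W0[OF x] \<chi>c by (meson not_less_eq_eq order_trans)
    then have cN: "c \<le> N" by simp
    have old: "(x, threshold N (c + 1 - 1)) \<in> dom_at \<Gamma> N"
      using not_less_Least[of c "\<lambda>c. (x, threshold N c) \<notin> dom_at \<Gamma> N"] c unfolding c1_def[symmetric] by simp
    have att: "horn_attachment cyl C \<Gamma> N (c + 1) (prism N x c)"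
      by (rule prism_attachment[OF _ CS \<Gamma> paired lower x cN _ _ old])
        (use \<chi>c[of c] cN c1 c in auto)
    then interpret horn_attachment cyl C \<Gamma> N "c + 1" "prism N x c" .
    obtain F where F: "F \<in> shom (simplex (Suc N)) C"
        "\<And>m \<theta>. \<theta> \<in> cells (horn (Suc N) (c + 1)) m \<Longrightarrow> F m \<theta> = data m \<theta>"
      using quasi_category_filler[OF C _ _ data_in] \<open>Suc c \<le> N\<close> by auto
    have "partial_map cyl C (attach F)" by (rule attach_partial_map) (use F in blast)+
    moreover have "paired 1 (attach F)" by (rule paired_attach[OF _ paired x cN att]) simp
    ultimately show False using max[of "attach F"] attach_grows[of F] by simp
  qed
  show ?thesis
  proof
    show "(\<lambda>n. \<lambda>z\<in>cells cyl n. value_at \<Gamma> n z) \<in> shom cyl C"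
      by (rule total_partial_map[OF \<Gamma> cyl CS total])
    fix n z assume z: "z \<in> cyl_base W n"
    then have "(n, z, f n z) \<in> \<Gamma>" using sub unfolding \<Gamma>0_def by blast
    moreover have "z \<in> cells cyl n" using z by (auto simp: cyl_base_def)
    ultimately show "(\<lambda>z\<in>cells cyl n. value_at \<Gamma> n z) z = f n z"
      by (simp add: value_at_eq[OF \<Gamma>])
  qed
qed

end

section \<open>CoCartesian transport over a simplex\<close>

lemma inner_fibration_filler:
  assumes p: "inner_fibration X S p" and k: "0 < k" "k < n" and u: "u \<in> shom (horn n k) X"
    and v: "v \<in> shom (simplex n) S" and sq: "\<And>m \<theta>. \<theta> \<in> cells (horn n k) m \<Longrightarrow> p m (u m \<theta>) = v m \<theta>"
  obtains h where "h \<in> shom (simplex n) X" "\<And>m \<theta>. \<theta> \<in> cells (horn n k) m \<Longrightarrow> h m \<theta> = u m \<theta>"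
    "\<And>m \<theta>. \<theta> \<in> ord_maps m n \<Longrightarrow> p m (h m \<theta>) = v m \<theta>"
proof -
  have pS: "p \<in> shom X S" using p by (simp add: inner_fibration_def)
  have "horn_filler n k X p u v"
    using p k u v sq horn_square_iff[OF pS u v] unfolding inner_fibration_def by blast
  then show ?thesis using that unfolding horn_filler_iff[OF pS u v] by blast
qed

lemma cocartesian_edge_filler:
  assumes p: "p \<in> shom X S" and e: "cocartesian_edge X S p e" and n: "2 \<le> n" and u: "u \<in> shom (horn n 0) X"
    and v: "v \<in> shom (simplex n) S" and sq: "\<And>m \<theta>. \<theta> \<in> cells (horn n 0) m \<Longrightarrow> p m (u m \<theta>) = v m \<theta>"
    and ue: "u 1 (ord_id 1) = e"
  obtains h where "h \<in> shom (simplex n) X" "\<And>m \<theta>. \<theta> \<in> cells (horn n 0) m \<Longrightarrow> h m \<theta> = u m \<theta>"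
    "\<And>m \<theta>. \<theta> \<in> ord_maps m n \<Longrightarrow> p m (h m \<theta>) = v m \<theta>"
proof -
  have "horn_filler n 0 X p u v"
    using e n u v sq ue horn_square_iff[OF p u v] unfolding cocartesian_edge_def by blast
  then show ?thesis using that unfolding horn_filler_iff[OF p u v] by blast
qed

text \<open>
  The vertices over \<open>{k..n}\<close> are the ones to be left in place, so \<open>late\<close> serves as the map to the
  interval. On a string, \<open>push\<close> is the simplex of \<open>\<Delta>\<^sup>n\<close> over which its transport has to lie.
\<close>

locale cocartesian_over_simplex =
  fixes Y :: "'y sset" and n k :: nat and q :: "('y, nat \<Rightarrow> nat) smap"
  assumes q: "cocartesian_fibration Y (simplex n) q" and kn: "k \<le> n"
begin

definition late :: "('y, nat \<Rightarrow> nat) smap" where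
  "late = (\<lambda>m. \<lambda>y\<in>cells Y m. \<lambda>i\<in>{..m}. if q m y i < k then 0 else 1)"

definition push :: "('y \<times> (nat \<Rightarrow> nat), nat \<Rightarrow> nat) smap" where
  "push = (\<lambda>m (y, \<epsilon>). \<lambda>i\<in>{..m}. if \<epsilon> i = 0 then q m y i else max k (q m y i))"

lemma q_hom: "q \<in> shom Y (simplex n)"
  using q by (simp add: cocartesian_fibration_def inner_fibration_def)

lemma q_in: "y \<in> cells Y m \<Longrightarrow> q m y \<in> ord_maps m n"
  using shom_in[OF q_hom] by simp

lemma q_act: "\<theta> \<in> ord_maps l m \<Longrightarrow> y \<in> cells Y m \<Longrightarrow> q l (act Y l m \<theta> y) = compose {..l} (q m y) \<theta>"
  using shom_act[OF q_hom, of \<theta> l m y] by simp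

lemma Y: "simplicial_set Y"
  using q_hom by (rule shom_ss)

lemma late_in: "late \<in> shom Y (simplex 1)"
  unfolding late_def
proof (rule shomI[OF Y])
  fix m y assume y: "y \<in> cells Y m"
  have *: "(\<lambda>i\<in>{..m}. if q m y i < k then 0 else 1) \<in> ord_maps m 1" (is "?f \<in> _")
    using ord_maps_mono[OF q_in[OF y]] by (intro ord_mapsI) (auto simp: not_less dest: order_trans)
  then show "?f \<in> cells (simplex 1) m" by simp
  fix l \<theta> assume \<theta>: "\<theta> \<in> ord_maps l m"
  show "(\<lambda>i\<in>{..l}. if q l (act Y l m \<theta> y) i < k then 0 else 1) = act (simplex 1) l m \<theta> ?f"
    by (rule extensionalityI[of _ "{..l}"])
      (use \<theta> y in \<open>auto simp: q_act ord_maps_le compose_def\<close>)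
qed simp

lemma late_apply: "y \<in> cells Y m \<Longrightarrow> i \<le> m \<Longrightarrow> late m y i = (if q m y i < k then 0 else 1)"
  by (simp add: late_def)

sublocale cylinder Y late
  by unfold_locales (rule late_in)

lemma push_apply: "i \<le> m \<Longrightarrow> push m (y, \<epsilon>) i = (if \<epsilon> i = 0 then q m y i else max k (q m y i))"
  by (simp add: push_def)

lemma push_in:
  assumes "z \<in> cells cyl m"
  shows "push m z \<in> ord_maps m n"
proof (cases z)
  case (Pair y \<epsilon>)
  have y: "y \<in> cells Y m" and \<epsilon>: "\<epsilon> \<in> ord_maps m 1" using assms by (simp_all add: Pair cells_cyl)
  show ?thesis
    unfolding Pair push_def prod.case
  proof (rule ord_mapsI)
    fix i assume "i \<le> m"
    then show "(if \<epsilon> i = 0 then q m y i else max k (q m y i)) \<le> n"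
      using ord_maps_le[OF q_in[OF y]] kn by auto
  next
    fix i j assume ij: "i \<le> j" "j \<le> m"
    then show "(if \<epsilon> i = 0 then q m y i else max k (q m y i)) \<le> (if \<epsilon> j = 0 then q m y j else max k (q m y j))"
      using ord_maps_mono[OF q_in[OF y] ij] ord_maps_mono[OF \<epsilon> ij] by auto
  qed
qed

lemma push_act:
  assumes "z \<in> cells cyl m" "\<theta> \<in> ord_maps l m"
  shows "push l (act cyl l m \<theta> z) = compose {..l} (push m z) \<theta>"
proof (rule ord_maps_eqI)
  show "push l (act cyl l m \<theta> z) \<in> ord_maps l n" using push_in act_in[OF cyl assms(2,1)] by blast
  show "compose {..l} (push m z) \<theta> \<in> ord_maps l n" using ord_maps_compose[OF push_in[OF assms(1)] assms(2)] .
  fix i assume "i \<le> l"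
  then show "push l (act cyl l m \<theta> z) i = compose {..l} (push m z) \<theta> i"
    using assms by (cases z) (simp add: push_apply q_act cells_cyl ord_maps_le)
qed

lemma push_late: "y \<in> cells Y m \<Longrightarrow> push m (y, late m y) = q m y"
  using late_in
  by (intro ord_maps_eqI[OF push_in q_in]) (auto simp: cells_cyl \<chi>_in push_apply late_apply max_def)

definition edge :: "'y \<Rightarrow> 'y \<times> (nat \<Rightarrow> nat)" where
  "edge y = prism 0 y 0"

text \<open>
  The prism on a vertex \<open>x\<^sub>0\<close> is the edge from \<open>x\<^sub>0\<close> to its transport. Demanding that it goes to a coCartesian edge
  is what permits to fill the outer horns that occur in higher dimensions.
\<close>

definition good :: "(nat \<times> ('y \<times> (nat \<Rightarrow> nat)) \<times> 'y) set \<Rightarrow> bool" where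
  "good \<Gamma> \<longleftrightarrow> paired 0 \<Gamma> \<and> (\<forall>m z y. (m, z, y) \<in> \<Gamma> \<longrightarrow> q m y = push m z) \<and>
     (\<forall>y e. y \<in> cells Y 0 \<longrightarrow> late 0 y 0 = 0 \<longrightarrow> (1, edge y, e) \<in> \<Gamma> \<longrightarrow> cocartesian_edge Y (simplex n) q e)"

text \<open>
  The prism lacks only the face without \<open>x\<^sub>c\<close>. For \<open>c > 0\<close> its horn is inner. For \<open>c = 0\<close> and \<open>N > 0\<close> it is a left
  outer horn whose initial edge is the transport of the vertex \<open>x\<^sub>0\<close>. For \<open>N = 0\<close> the horn is a single
  vertex, and a coCartesian lift of the base edge is chosen.
\<close>

lemma good_extend:
  assumes \<Gamma>: "partial_map cyl Y \<Gamma>" and good: "good \<Gamma>"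
    and lower: "\<And>m. m < N \<Longrightarrow> cells cyl m \<subseteq> dom_at \<Gamma> m"
    and x: "x \<in> cells Y N" and c: "c \<le> N" "late N x c = 0"
    and new: "(x, threshold N c) \<notin> dom_at \<Gamma> N" and old: "(x, threshold N (c + 1)) \<in> dom_at \<Gamma> N"
  shows "\<exists>\<Delta>. partial_map cyl Y \<Delta> \<and> good \<Delta> \<and> \<Gamma> \<subset> \<Delta>"
proof -
  have paired: "paired 0 \<Gamma>" and over: "\<And>m z y. (m, z, y) \<in> \<Gamma> \<Longrightarrow> q m y = push m z"
    and cocart: "\<And>y e. y \<in> cells Y 0 \<Longrightarrow> late 0 y 0 = 0 \<Longrightarrow> (1, edge y, e) \<in> \<Gamma> \<Longrightarrow> cocartesian_edge Y (simplex n) q e"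
    using good by (auto simp: good_def)
  let ?\<sigma> = "prism N x c"
  have \<sigma>_in: "?\<sigma> \<in> cells cyl (Suc N)" by (rule prism_in[OF x c])
  have att: "horn_attachment cyl Y \<Gamma> N (c + 0) ?\<sigma>"
    by (rule prism_attachment[OF _ Y \<Gamma> paired lower x c]) (use new old in auto)
  then interpret horn_attachment cyl Y \<Gamma> N c ?\<sigma> by simp
  define v where "v = yoneda (simplex n) (Suc N) (push (Suc N) ?\<sigma>)"
  have v: "v \<in> shom (simplex (Suc N)) (simplex n)"
    unfolding v_def by (rule yoneda_in) (simp_all add: push_in[OF \<sigma>_in])
  have v_apply: "v m \<theta> = push m (act cyl m (Suc N) \<theta> ?\<sigma>)" if "\<theta> \<in> ord_maps m (Suc N)" for m \<theta>
    using that by (simp add: v_def push_act[OF \<sigma>_in])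
  have sq: "q m (data m \<theta>) = v m \<theta>" if "\<theta> \<in> cells (horn (Suc N) c) m" for m \<theta>
    using over[OF data_graph[OF that]] v_apply horn_subset[OF that] by simp
  have edge_face: "act cyl 1 (Suc N) \<theta> ?\<sigma> = edge (act Y 0 N (vertex 0) x)"
    if "c = 0" "\<theta> = (\<lambda>i\<in>{..1}. i)" for \<theta>
  proof -
    have \<theta>: "\<theta> \<in> ord_maps 1 (Suc N)" unfolding that by (rule ord_mapsI) auto
    have v0: "vertex 0 \<in> ord_maps 0 N" and cg0: "codegeneracy 0 0 \<in> ord_maps 1 0" and cg: "codegeneracy N c \<in> ord_maps (Suc N) N"
      using codegeneracy_in[of 0 0] codegeneracy_in[OF c(1)] by (simp_all add: vertex_in One_nat_def)
    have "compose {..1} (codegeneracy N c) \<theta> = compose {..1} (vertex 0) (codegeneracy 0 0)"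
      by (rule ord_maps_eqI[OF ord_maps_compose[OF cg \<theta>] ord_maps_compose[OF v0 cg0]])
        (use that in \<open>auto simp: One_nat_def dest!: le_SucE\<close>)
    moreover have "compose {..1} (threshold (Suc N) (Suc c)) \<theta> = threshold 1 1"
      by (rule ord_maps_eqI[OF ord_maps_compose[OF threshold_in \<theta>] threshold_in]) (use that in auto)
    ultimately show ?thesis
      using act_act[OF Y \<theta> cg x] act_act[OF Y cg0 v0 x] by (simp add: prism_def edge_def One_nat_def)
  qed
  have "\<exists>F. F \<in> shom (simplex (Suc N)) Y \<and> (\<forall>m. \<forall>\<theta>\<in>cells (horn (Suc N) c) m. F m \<theta> = data m \<theta>) \<and>
      (\<forall>m \<theta>. \<theta> \<in> ord_maps m (Suc N) \<longrightarrow> q m (F m \<theta>) = v m \<theta>) \<and>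
      (N = 0 \<longrightarrow> cocartesian_edge Y (simplex n) q (F 1 (ord_id 1)))"
  proof -
    consider "0 < c" | "c = 0" "0 < N" | "c = 0" "N = 0" by auto
    then show ?thesis
    proof cases
      case 1
      have "inner_fibration Y (simplex n) q" using q by (simp add: cocartesian_fibration_def)
      then obtain F where "F \<in> shom (simplex (Suc N)) Y" "\<And>m \<theta>. \<theta> \<in> cells (horn (Suc N) c) m \<Longrightarrow> F m \<theta> = data m \<theta>"
        "\<And>m \<theta>. \<theta> \<in> ord_maps m (Suc N) \<Longrightarrow> q m (F m \<theta>) = v m \<theta>"
        using inner_fibration_filler[of Y "simplex n" q c "Suc N" data v] 1 c data_in v sq by auto
      then show ?thesis using 1 c by (intro exI[of _ F]) auto
    next
      case 2
      let ?x0 = "act Y 0 N (vertex 0) x"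
      let ?\<iota> = "(\<lambda>i\<in>{..1}. i)"
      have \<iota>: "?\<iota> \<in> cells (horn (Suc N) c) 1"
        using 2 by (auto simp: horn_simps ord_mapsI intro!: exI[of _ 2] ord_mapsI)
      have x0: "?x0 \<in> cells Y 0" "late 0 ?x0 0 = 0"
        using act_in[OF Y vertex_in x] \<chi>_act[OF vertex_in x] c 2 by auto
      have "(1, edge ?x0, data 1 ?\<iota>) \<in> \<Gamma>" using data_graph[OF \<iota>] edge_face[OF 2(1)] by simp
      then have e: "cocartesian_edge Y (simplex n) q (data 1 ?\<iota>)" using cocart[OF x0] by blast
      obtain F where "F \<in> shom (simplex (Suc N)) Y" "\<And>m \<theta>. \<theta> \<in> cells (horn (Suc N) 0) m \<Longrightarrow> F m \<theta> = data m \<theta>"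
        "\<And>m \<theta>. \<theta> \<in> ord_maps m (Suc N) \<Longrightarrow> q m (F m \<theta>) = v m \<theta>"
        by (rule cocartesian_edge_filler[OF q_hom e, of "Suc N" data v])
          (use data_in v sq 2 in \<open>auto simp: ord_id_def\<close>)
      then show ?thesis using 2 by (intro exI[of _ F]) auto
    next
      case 3
      have h: "horn (Suc N) c = horn 1 0" using 3 by (simp add: One_nat_def)
      let ?v0 = "vertex 0"
      have v0: "?v0 \<in> cells (horn 1 0) 0" by (auto simp: horn_simps vertex_in)
      have v0': "?v0 \<in> ord_maps 0 1" by (simp add: vertex_in)
      have vid: "v 1 (ord_id 1) \<in> cells (simplex n) 1" using shom_in[OF v] 3 by (simp add: One_nat_def)
      have "data 0 ?v0 \<in> cells Y 0" using shom_in[OF data_in] v0 h by simp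
      moreover have "q 0 (data 0 ?v0) = source (simplex n) (v 1 (ord_id 1))"
        using sq[of ?v0 0] v0 v0' h 3 shom_act[OF v, of ?v0 0 1 "ord_id 1"] compose_ord_id_left[OF v0']
        by (simp add: source_def One_nat_def)
      ultimately obtain e where e: "e \<in> cells Y 1" "cocartesian_edge Y (simplex n) q e"
        "source Y e = data 0 ?v0" "q 1 e = v 1 (ord_id 1)"
        using q vid unfolding cocartesian_fibration_def by blast
      let ?F = "yoneda Y 1 e"
      have "?F m \<theta> = data m \<theta>" if "\<theta> \<in> cells (horn 1 0) m" for m \<theta>
      proof -
        have \<theta>: "\<theta> \<in> ord_maps m 1" using horn_subset[OF that] .
        have t: "(\<lambda>_\<in>{..m}. 0) \<in> ord_maps m 0" by (rule ord_mapsI) auto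
        have no1: "1 \<notin> \<theta> ` {..m}" using that by (auto simp: horn_simps le_Suc_eq One_nat_def)
        have "\<theta> i = 0" if "i \<le> m" for i
        proof -
          have "\<theta> i \<noteq> 1" using no1 that by (metis atMost_iff imageI)
          then show ?thesis using ord_maps_le[OF \<theta> that] by linarith
        qed
        then have \<theta>_eq: "\<theta> = compose {..m} ?v0 (\<lambda>_\<in>{..m}. 0)"
          by (intro ord_maps_eqI[OF \<theta> ord_maps_compose[OF v0' t]]) auto
        have "act Y m 1 \<theta> e = act Y m 0 (\<lambda>_\<in>{..m}. 0) (data 0 ?v0)"
          using act_act[OF Y t v0' e(1)] e(3) \<theta>_eq by (simp add: source_def)
        also have "\<dots> = data m \<theta>"
          using shom_act[OF data_in t, of ?v0] v0 h \<theta>_eq by simp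
        finally show ?thesis using \<theta> by simp
      qed
      moreover have "q m (?F m \<theta>) = v m \<theta>" if "\<theta> \<in> ord_maps m 1" for m \<theta>
        using that q_act[OF that e(1)] e(4) shom_act[OF v, of \<theta> m 1 "ord_id 1"] 3 compose_ord_id_left[OF that]
        by (simp add: One_nat_def)
      moreover have "?F \<in> shom (simplex 1) Y" by (rule yoneda_in[OF Y e(1)])
      moreover have "?F 1 (ord_id 1) = e" using act_id[OF Y e(1)] by simp
      ultimately show ?thesis using h 3 e(2) by (intro exI[of _ ?F]) (auto simp: One_nat_def)
    qed
  qed
  then obtain F where F: "F \<in> shom (simplex (Suc N)) Y" "\<forall>m. \<forall>\<theta>\<in>cells (horn (Suc N) c) m. F m \<theta> = data m \<theta>"
      "\<And>m \<theta>. \<theta> \<in> ord_maps m (Suc N) \<Longrightarrow> q m (F m \<theta>) = v m \<theta>"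
      and F0: "N = 0 \<Longrightarrow> cocartesian_edge Y (simplex n) q (F 1 (ord_id 1))"
    by blast
  have pm: "partial_map cyl Y (attach F)" by (rule attach_partial_map[OF F(1,2)])
  have "good (attach F)"
    unfolding good_def
  proof (intro conjI allI impI)
    show "paired 0 (attach F)" by (rule paired_attach[OF _ paired x c(1) att]) simp
  next
    fix m z y assume "(m, z, y) \<in> attach F"
    then consider "(m, z, y) \<in> \<Gamma>" | \<theta> where "\<theta> \<in> ord_maps m (Suc N)" "z = act cyl m (Suc N) \<theta> ?\<sigma>" "y = F m \<theta>"
      unfolding attach_def by blast
    then show "q m y = push m z" by cases (simp_all add: over F(3) v_apply)
  next
    fix y e assume y: "y \<in> cells Y 0" "late 0 y 0 = 0" and e: "(1, edge y, e) \<in> attach F"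
    show "cocartesian_edge Y (simplex n) q e"
    proof (cases "edge y \<in> dom_at \<Gamma> 1")
      case True
      then obtain e' where e': "(1, edge y, e') \<in> \<Gamma>" by (auto simp: dom_at_def)
      then have "(1, edge y, e') \<in> attach F" using attach_grows[of F] by blast
      with partial_map_fun[OF pm e] e' cocart[OF y] show ?thesis by blast
    next
      case False
      have "(y, threshold 0 0) \<in> cells cyl 0" using y by (simp add: cells_cyl_threshold)
      then have "N = 0"
        using lower[of 0] pairedD[OF paired y(1) _ y(2)] False by (auto simp: edge_def One_nat_def)
      moreover from False e obtain \<theta> where \<theta>: "\<theta> \<in> ord_maps 1 (Suc N)" "\<theta> \<notin> cells (horn (Suc N) c) 1"
        "edge y = act cyl 1 (Suc N) \<theta> ?\<sigma>" "e = F 1 \<theta>"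
        using attach_cases[OF F(2) e] by (auto simp: dom_at_def)
      moreover have "\<theta> = ord_id 1"
      proof -
        have c0: "c = 0" using c \<open>N = 0\<close> by simp
        have \<theta>1: "\<theta> \<in> ord_maps 1 1" using \<theta>(1) \<open>N = 0\<close> by (simp add: One_nat_def)
        have eq: "threshold 1 1 = compose {..1} (threshold 1 1) \<theta>"
          using \<theta>(3) c0 \<open>N = 0\<close> by (simp add: edge_def prism_def One_nat_def)
        have "\<theta> 0 = 0" "\<theta> 1 = 1"
          using fun_cong[OF eq, of 0] fun_cong[OF eq, of 1] ord_maps_le[OF \<theta>1, of 0] ord_maps_le[OF \<theta>1, of 1]
          by (auto split: if_splits)
        then show ?thesis by (intro ord_maps_eqI[OF \<theta>1 ord_id_in]) (auto simp: le_Suc_eq One_nat_def)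
      qed
      ultimately show ?thesis using F0 by simp
    qed
  qed
  with pm attach_grows[of F] show ?thesis by (intro exI[of _ "attach F"]) simp
qed

text \<open>
  Start from the strings in which nothing is pushed, on which \<open>H\<close> has to be the projection, and reach the strings
  over a simplex in the order of decreasing number of unpushed vertices.
\<close>

lemma transport:
  obtains H where "H \<in> shom cyl Y" "\<And>m y. y \<in> cells Y m \<Longrightarrow> H m (y, late m y) = y"
    "\<And>m z. z \<in> cells cyl m \<Longrightarrow> q m (H m z) = push m z"
proof -
  define \<Gamma>0 where "\<Gamma>0 = {(m, (y, late m y), y) |m y. y \<in> cells Y m}"
  have "partial_map cyl Y \<Gamma>0"
    unfolding \<Gamma>0_def partial_map_def
    using act_in[OF Y] shom_act[OF late_in] by (fastforce simp: cells_cyl \<chi>_in)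
  moreover have "paired 0 \<Gamma>0"
    unfolding paired_def
  proof (intro allI impI)
    fix N x c assume "x \<in> cells Y N" "c \<le> N" "late N x c = 0" "(x, threshold N (c + 0)) \<in> dom_at \<Gamma>0 N"
    then have "late N x c = threshold N c c" "late N x c = 0" "c \<le> N" by (auto simp: dom_at_def \<Gamma>0_def)
    then show "prism N x c \<in> dom_at \<Gamma>0 (Suc N)" by simp
  qed
  moreover have "(1, edge y, e) \<notin> \<Gamma>0" if "y \<in> cells Y 0" "late 0 y 0 = 0" for y e
  proof
    have cg: "codegeneracy 0 0 \<in> ord_maps 1 0" using codegeneracy_in[of 0 0] by (simp add: One_nat_def)
    assume "(1, edge y, e) \<in> \<Gamma>0"
    then have "late 1 (act Y 1 0 (codegeneracy 0 0) y) = threshold 1 1"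
      by (auto simp: \<Gamma>0_def edge_def prism_def One_nat_def)
    then show False using \<chi>_act[OF cg that(1), of 1] that(2) codegeneracy_le[of 1 0 0] by (simp add: One_nat_def)
  qed
  ultimately have \<Gamma>0: "partial_map cyl Y \<Gamma>0" "good \<Gamma>0"
    by (auto simp: good_def) (auto simp: \<Gamma>0_def push_late)
  obtain \<Gamma> where \<Gamma>: "partial_map cyl Y \<Gamma>" and good: "good \<Gamma>" and sub: "\<Gamma>0 \<subseteq> \<Gamma>"
    and max: "\<And>\<Delta>. partial_map cyl Y \<Delta> \<Longrightarrow> good \<Delta> \<Longrightarrow> \<not> \<Gamma> \<subset> \<Delta>"
  proof (rule maximal_partial_map[of cyl Y \<Gamma>0 good, OF \<Gamma>0])
    fix \<C> assume \<C>: "\<C> \<noteq> {}" "\<And>\<Gamma>. \<Gamma> \<in> \<C> \<Longrightarrow> partial_map cyl Y \<Gamma> \<and> good \<Gamma>"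
    then have "paired 0 (\<Union>\<C>)" by (intro paired_Union) (auto simp: good_def)
    then show "good (\<Union>\<C>)" using \<C> unfolding good_def by blast
  qed (rule that)
  have total: "z \<in> dom_at \<Gamma> m" if zin: "z \<in> cells cyl m" for m z
  proof (rule ccontr)
    assume "z \<notin> dom_at \<Gamma> m"
    then obtain N x c0 where lower: "\<And>m. m < N \<Longrightarrow> cells cyl m \<subseteq> dom_at \<Gamma> m"
      and c0: "c0 \<le> Suc N" "(x, threshold N c0) \<in> cells cyl N" "(x, threshold N c0) \<notin> dom_at \<Gamma> N"
      using minimal_outside[OF zin] by metis
    have x: "x \<in> cells Y N" using c0 by (simp add: cells_cyl)
    obtain a where a: "a \<le> Suc N" "late N x = threshold N a" using ord_maps_1_threshold[OF \<chi>_in[OF x]] .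
    have a_dom: "(x, threshold N a) \<in> dom_at \<Gamma> N"
      using sub x a(2)[symmetric] by (auto simp: \<Gamma>0_def dom_at_def)
    define c where "c = (GREATEST c. c \<le> a \<and> (x, threshold N c) \<notin> dom_at \<Gamma> N)"
    have late0: "late N x i = 0 \<longleftrightarrow> i < a" if "i \<le> N" for i using a(2) that by simp
    have "c0 \<le> a"
    proof (rule ccontr)
      assume "\<not> c0 \<le> a"
      then have "a < c0" "a \<le> N" using c0(1) by auto
      then have "late N x a = 0" using c0(2) by (simp add: cells_cyl_threshold)
      then show False using late0[OF \<open>a \<le> N\<close>] by simp
    qed
    then have "c0 \<le> a \<and> (x, threshold N c0) \<notin> dom_at \<Gamma> N" using c0(3) by simp
    then have "c \<le> a \<and> (x, threshold N c) \<notin> dom_at \<Gamma> N"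
      unfolding c_def by (rule GreatestI_nat[of "\<lambda>c. c \<le> a \<and> (x, threshold N c) \<notin> dom_at \<Gamma> N" c0 a]) simp
    moreover from this have "c \<noteq> a" using a_dom by auto
    ultimately have ca: "c < a" and new: "(x, threshold N c) \<notin> dom_at \<Gamma> N" by auto
    have old: "(x, threshold N (c + 1)) \<in> dom_at \<Gamma> N"
      using Greatest_le_nat[of "\<lambda>c. c \<le> a \<and> (x, threshold N c) \<notin> dom_at \<Gamma> N" "c + 1" a] ca
      unfolding c_def[symmetric] by auto
    have "c \<le> N" using ca a by simp
    then show False
      using good_extend[OF \<Gamma> good lower x _ _ new old] late0[of c] ca max by auto
  qed
  let ?H = "\<lambda>m. \<lambda>z\<in>cells cyl m. value_at \<Gamma> m z"
  show ?thesis
  proof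
    show "?H \<in> shom cyl Y" by (rule total_partial_map[OF \<Gamma> cyl Y total])
    fix m y assume y: "y \<in> cells Y m"
    then have "(m, (y, late m y), y) \<in> \<Gamma>" using sub by (auto simp: \<Gamma>0_def)
    then show "?H m (y, late m y) = y"
      using value_at_eq[OF \<Gamma>] y by (simp add: cells_cyl \<chi>_in)
  next
    fix m z assume z: "z \<in> cells cyl m"
    have "q m (value_at \<Gamma> m z) = push m z"
      using value_at_in[OF \<Gamma> total[OF z]] good unfolding good_def by blast
    then show "q m (?H m z) = push m z" using z by simp
  qed
qed

end

lemma simplicial_on_in: "simplicial_on D S C f \<Longrightarrow> x \<in> S n \<Longrightarrow> f n x \<in> cells C n"
  and simplicial_on_act: "simplicial_on D S C f \<Longrightarrow> \<theta> \<in> ord_maps m n \<Longrightarrow> x \<in> S n \<Longrightarrow>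
    f m (act D m n \<theta> x) = act C m n \<theta> (f n x)"
  by (simp_all add: simplicial_on_def)

lemma subcomplex_cells: "subcomplex D S \<Longrightarrow> x \<in> S n \<Longrightarrow> x \<in> cells D n"
  and subcomplex_act: "subcomplex D S \<Longrightarrow> \<theta> \<in> ord_maps m n \<Longrightarrow> x \<in> S n \<Longrightarrow> act D m n \<theta> x \<in> S m"
  by (auto simp: subcomplex_def)

section \<open>Extension from the part over an inner horn\<close>

definition horn_part :: "('y, nat \<Rightarrow> nat) smap \<Rightarrow> 'y sset \<Rightarrow> 'k sset \<Rightarrow> (nat \<Rightarrow> 'k set) \<Rightarrow> nat \<Rightarrow> nat \<Rightarrow>
    nat \<Rightarrow> ('y \<times> 'k) set" where
  "horn_part q Y K L n k m = {(y, \<kappa>). y \<in> cells Y m \<and> \<kappa> \<in> cells K m \<and> (q m y \<in> cells (horn n k) m \<or> \<kappa> \<in> L m)}"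

text \<open>
  The inclusion of the part over the horn is a retract of an inclusion of the kind treated by \<open>extend_to_cyl\<close>: the map
  \<open>(y, \<kappa>) \<mapsto> ((y, \<kappa>), late y)\<close> is a section of transport in the first component, and transport
  preserves the part over the horn. The factor \<open>K\<close> is carried along.
\<close>

lemma extend_from_horn:
  fixes C :: "'c sset"
  assumes q: "cocartesian_fibration Y (simplex n) q" and k: "0 < k" "k < n"
    and K: "simplicial_set K" and L: "subcomplex K L" and C: "quasi_category C"
    and f: "simplicial_on (sprod Y K) (horn_part q Y K L n k) C f"
  obtains g where "g \<in> shom (sprod Y K) C" "\<And>m z. z \<in> horn_part q Y K L n k m \<Longrightarrow> g m z = f m z"
proof -
  interpret cocartesian_over_simplex Y n k q using q k by unfold_locales auto
  obtain H where H: "H \<in> shom cyl Y" and H_late: "\<And>m y. y \<in> cells Y m \<Longrightarrow> H m (y, late m y) = y"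
    and qH: "\<And>m z. z \<in> cells cyl m \<Longrightarrow> q m (H m z) = push m z"
    using transport by blast
  let ?R = "sprod Y K" and ?W = "horn_part q Y K L n k"
  have R: "simplicial_set ?R" by (rule simplicial_sprod[OF Y K])
  define \<chi> where "\<chi> = (\<lambda>m. \<lambda>z\<in>cells ?R m. late m (fst z))"
  have \<chi>_hom: "\<chi> \<in> shom ?R (simplex 1)"
    unfolding \<chi>_def
    using late_in by (intro shomI[OF R]) (auto simp: shom_act[OF late_in] \<chi>_in)
  interpret RC: cylinder ?R \<chi> by unfold_locales (rule \<chi>_hom)
  have \<chi>_apply: "\<chi> m (y, \<kappa>) = late m y" if "y \<in> cells Y m" "\<kappa> \<in> cells K m" for m y \<kappa>
    using that by (simp add: \<chi>_def)
  have W: "subcomplex ?R ?W"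
    unfolding subcomplex_def
    by (auto simp: horn_part_def act_in[OF Y] act_in[OF K] q_act horn_compose subcomplex_act[OF L])
  have W0: "z \<in> ?W m" if z: "z \<in> cells ?R m" and 0: "\<And>i. i \<le> m \<Longrightarrow> \<chi> m z i = 0" for m z
  proof -
    obtain y \<kappa> where y: "z = (y, \<kappa>)" "y \<in> cells Y m" "\<kappa> \<in> cells K m" using z by auto
    have "q m y i < k" if "i \<le> m" for i
      using 0[OF that] that y by (auto simp: \<chi>_apply late_apply split: if_splits)
    then have "n \<notin> q m y ` {..m}" using k by fastforce
    then show ?thesis using y q_in k by (auto simp: horn_part_def horn_simps)
  qed
  define f' where "f' = (\<lambda>m ((y, \<kappa>), \<epsilon>). f m (H m (y, \<epsilon>), \<kappa>))"
  have base_push: "(H m (y, \<epsilon>), \<kappa>) \<in> ?W m" if "((y, \<kappa>), \<epsilon>) \<in> RC.cyl_base ?W m" for m y \<kappa> \<epsilon>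
  proof -
    have y: "y \<in> cells Y m" "\<kappa> \<in> cells K m" and c: "(y, \<epsilon>) \<in> cells cyl m"
      and or: "q m y \<in> cells (horn n k) m \<or> \<kappa> \<in> L m \<or> \<epsilon> = threshold m 0"
      using that by (auto simp: RC.cyl_base_def RC.cells_cyl cells_cyl \<chi>_apply horn_part_def)
    have Hy: "H m (y, \<epsilon>) \<in> cells Y m" by (rule shom_in[OF H c])
    \<comment> \<open>transport adds no vertex except k, and a horn simplex misses a vertex other than k\<close>
    have im: "push m (y, \<epsilon>) ` {..m} \<subseteq> insert k (q m y ` {..m})"
      by (auto simp: push_apply max_def)
    have "push m (y, \<epsilon>) \<in> cells (horn n k) m" if "q m y \<in> cells (horn n k) m"
      using that im push_in[OF c] by (fastforce simp: horn_simps)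
    moreover have "push m (y, \<epsilon>) \<in> cells (horn n k) m" if "\<epsilon> = threshold m 0"
    proof -
      have "0 \<notin> push m (y, \<epsilon>) ` {..m}" using k that by (auto simp: push_apply)
      then show ?thesis using push_in[OF c] k by (auto simp: horn_simps)
    qed
    ultimately show ?thesis using or Hy y qH[OF c] by (auto simp: horn_part_def)
  qed
  have f': "simplicial_on RC.cyl (RC.cyl_base ?W) C f'"
    unfolding simplicial_on_def
  proof (intro conjI allI impI)
    fix m w assume "w \<in> RC.cyl_base ?W m"
    then show "f' m w \<in> cells C m"
      using base_push simplicial_on_in[OF f] by (cases w) (auto simp: f'_def)
  next
    fix l m \<theta> w assume \<theta>: "\<theta> \<in> ord_maps l m" and w: "w \<in> RC.cyl_base ?W m"
    obtain y \<kappa> \<epsilon> where w_eq: "w = ((y, \<kappa>), \<epsilon>)" by (metis surj_pair)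
    have c: "(y, \<epsilon>) \<in> cells cyl m"
      using w by (auto simp: w_eq RC.cyl_base_def RC.cells_cyl cells_cyl \<chi>_apply)
    show "f' l (act RC.cyl l m \<theta> w) = act C l m \<theta> (f' m w)"
      using simplicial_on_act[OF f \<theta> base_push[OF w[unfolded w_eq]]] shom_act[OF H \<theta> c]
      by (simp add: w_eq f'_def)
  qed
  obtain G where G: "G \<in> shom RC.cyl C" and Gf: "\<And>m w. w \<in> RC.cyl_base ?W m \<Longrightarrow> G m w = f' m w"
    using RC.extend_to_cyl[OF C W _ f'] W0 by blast
  have end_cell: "(z, \<chi> m z) \<in> cells RC.cyl m" if "z \<in> cells ?R m" for m z
    using that RC.\<chi>_in by (auto simp: RC.cells_cyl)
  show ?thesis
  proof
    show "(\<lambda>m. \<lambda>z\<in>cells ?R m. G m (z, \<chi> m z)) \<in> shom ?R C"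
    proof (rule shomI[OF R])
      show "simplicial_set C" using C by (simp add: quasi_category_def)
    next
      fix m z assume z: "z \<in> cells ?R m"
      show "G m (z, \<chi> m z) \<in> cells C m" by (rule shom_in[OF G end_cell[OF z]])
      fix l \<theta> assume \<theta>: "\<theta> \<in> ord_maps l m"
      show "G l (act ?R l m \<theta> z, \<chi> l (act ?R l m \<theta> z)) = act C l m \<theta> (G m (z, \<chi> m z))"
        using shom_act[OF G \<theta> end_cell[OF z]] shom_act[OF \<chi>_hom \<theta> z] by simp
    qed
  next
    fix m z assume z: "z \<in> ?W m"
    obtain y \<kappa> where y: "z = (y, \<kappa>)" "y \<in> cells Y m" "\<kappa> \<in> cells K m" using z by (auto simp: horn_part_def)
    have "(z, \<chi> m z) \<in> RC.cyl_base ?W m" using z end_cell[of z m] y by (simp add: RC.cyl_base_def)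
    from Gf[OF this] show "(\<lambda>z\<in>cells ?R m. G m (z, \<chi> m z)) z = f m z"
      using y by (simp add: f'_def \<chi>_apply H_late)
  qed
qed

section \<open>Pulling back to a simplex\<close>

text \<open>The pullback \<open>b\<^sup>*Y\<close> along the map \<open>\<Delta>\<^sup>n \<rightarrow> B\<close> classifying \<open>b\<close>.\<close>

definition pull :: "'y sset \<Rightarrow> 'b sset \<Rightarrow> ('y, 'b) smap \<Rightarrow> nat \<Rightarrow> 'b \<Rightarrow> ((nat \<Rightarrow> nat) \<times> 'y) sset" where
  "pull Y B q n b = \<lparr>cells = (\<lambda>m. {(\<theta>, y). \<theta> \<in> ord_maps m n \<and> y \<in> cells Y m \<and> q m y = act B m n \<theta> b}),
     act = act (sprod (simplex n) Y)\<rparr>"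

definition pull_proj :: "'y sset \<Rightarrow> 'b sset \<Rightarrow> ('y, 'b) smap \<Rightarrow> nat \<Rightarrow> 'b \<Rightarrow>
    ((nat \<Rightarrow> nat) \<times> 'y, nat \<Rightarrow> nat) smap" where
  "pull_proj Y B q n b = (\<lambda>m. \<lambda>z\<in>cells (pull Y B q n b) m. fst z)"

lemma cells_pull: "(\<theta>, y) \<in> cells (pull Y B q n b) m \<longleftrightarrow>
    \<theta> \<in> ord_maps m n \<and> y \<in> cells Y m \<and> q m y = act B m n \<theta> b"
  by (simp add: pull_def)

lemma act_pull [simp]: "act (pull Y B q n b) l m \<phi> (\<theta>, y) = (compose {..l} \<theta> \<phi>, act Y l m \<phi> y)"
  by (simp add: pull_def)

lemma pull_proj_apply: "z \<in> cells (pull Y B q n b) m \<Longrightarrow> pull_proj Y B q n b m z = fst z"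
  by (simp add: pull_proj_def)

locale over_base =
  fixes Y :: "'y sset" and B :: "'b sset" and q :: "('y, 'b) smap"
  assumes q: "q \<in> shom Y B"
begin

lemma Y: "simplicial_set Y" and B: "simplicial_set B"
  using q by (auto dest: shom_ss)

lemma pull: "b \<in> cells B n \<Longrightarrow> simplicial_set (pull Y B q n b)"
  by (rule simplicial_setI)
    (auto simp: cells_pull act_in[OF Y] act_id[OF Y] act_act[OF Y] act_act[OF B] ord_maps_compose
      shom_act[OF q] compose_ord_id_right compose_ord_assoc)

lemma pull_proj_in: "b \<in> cells B n \<Longrightarrow> pull_proj Y B q n b \<in> shom (pull Y B q n b) (simplex n)"
  unfolding pull_proj_def by (rule shomI[OF pull]) (auto simp: cells_pull)

text \<open>
  A lifting problem in \<open>b\<^sup>*Y\<close> is a lifting problem in \<open>Y\<close>, whatever the horn. Inner fibrations and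
  coCartesian edges are both handled by it.
\<close>

lemma pull_filler:
  assumes b: "b \<in> cells B n"
    and u: "u \<in> shom (horn N k) (pull Y B q n b)" and v: "v \<in> shom (simplex N) (simplex n)"
    and sq: "\<And>m \<theta>. \<theta> \<in> cells (horn N k) m \<Longrightarrow> pull_proj Y B q n b m (u m \<theta>) = v m \<theta>"
    and fill: "\<And>u' v'. u' \<in> shom (horn N k) Y \<Longrightarrow> v' \<in> shom (simplex N) B \<Longrightarrow>
       (\<And>m \<theta>. \<theta> \<in> cells (horn N k) m \<Longrightarrow> u' m \<theta> = snd (u m \<theta>)) \<Longrightarrow>
       scomp (horn N k) q u' = scomp (horn N k) v' (horn_incl N k) \<Longrightarrow> horn_filler N k Y q u' v'"
  shows "horn_filler N k (pull Y B q n b) (pull_proj Y B q n b) u v"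
proof -
  let ?P = "pull Y B q n b"
  have u_cell: "u m \<theta> \<in> cells ?P m" if "\<theta> \<in> cells (horn N k) m" for m \<theta> by (rule shom_in[OF u that])
  have fst_u: "fst (u m \<theta>) = v m \<theta>" if "\<theta> \<in> cells (horn N k) m" for m \<theta>
    using sq[OF that] pull_proj_apply[OF u_cell[OF that]] by simp
  have v_in: "v m \<theta> \<in> ord_maps m n" if "\<theta> \<in> ord_maps m N" for m \<theta> using shom_in[OF v] that by simp
  define u' where "u' = (\<lambda>m. \<lambda>\<theta>\<in>cells (horn N k) m. snd (u m \<theta>))"
  define v' where "v' = (\<lambda>m. \<lambda>\<theta>\<in>cells (simplex N) m. act B m n (v m \<theta>) b)"
  have u': "u' \<in> shom (horn N k) Y"
    unfolding u'_def
  proof (rule shomI[OF simplicial_horn Y])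
    fix m \<theta> assume \<theta>: "\<theta> \<in> cells (horn N k) m"
    show "snd (u m \<theta>) \<in> cells Y m" using u_cell[OF \<theta>] by (cases "u m \<theta>") (simp add: cells_pull)
    fix l \<phi> assume \<phi>: "\<phi> \<in> ord_maps l m"
    show "snd (u l (act (horn N k) l m \<phi> \<theta>)) = act Y l m \<phi> (snd (u m \<theta>))"
      using shom_act[OF u \<phi> \<theta>] by (cases "u m \<theta>") simp
  qed
  have v': "v' \<in> shom (simplex N) B"
    unfolding v'_def
  proof (rule shomI[OF simplicial_simplex B])
    fix m \<theta> assume \<theta>: "\<theta> \<in> cells (simplex N) m"
    then show "act B m n (v m \<theta>) b \<in> cells B m" using v_in act_in[OF B _ b] by simp
    fix l \<phi> assume \<phi>: "\<phi> \<in> ord_maps l m"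
    show "act B l n (v l (act (simplex N) l m \<phi> \<theta>)) b = act B l m \<phi> (act B m n (v m \<theta>) b)"
      using shom_act[OF v \<phi> \<theta>] act_act[OF B \<phi> _ b] v_in \<theta> by simp
  qed
  have "q m (u' m \<theta>) = v' m \<theta>" if \<theta>: "\<theta> \<in> cells (horn N k) m" for m \<theta>
    using u_cell[OF \<theta>] fst_u[OF \<theta>] \<theta> horn_subset[OF \<theta>] by (cases "u m \<theta>") (simp add: u'_def v'_def cells_pull)
  then have "horn_filler N k Y q u' v'"
    using fill[OF u' v'] horn_square_iff[OF q u' v'] by (simp add: u'_def)
  then obtain h where h: "h \<in> shom (simplex N) Y" and hu: "\<And>m \<theta>. \<theta> \<in> cells (horn N k) m \<Longrightarrow> h m \<theta> = u' m \<theta>"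
    and hv: "\<And>m \<theta>. \<theta> \<in> ord_maps m N \<Longrightarrow> q m (h m \<theta>) = v' m \<theta>"
    unfolding horn_filler_iff[OF q u' v'] by blast
  let ?h = "\<lambda>m. \<lambda>\<theta>\<in>cells (simplex N) m. (v m \<theta>, h m \<theta>)"
  have h_cell: "(v m \<theta>, h m \<theta>) \<in> cells ?P m" if "\<theta> \<in> ord_maps m N" for m \<theta>
    using that v_in hv shom_in[OF h] by (simp add: cells_pull v'_def)
  have h': "?h \<in> shom (simplex N) ?P"
    using shom_act[OF v] shom_act[OF h]
    by (intro shomI[OF simplicial_simplex pull[OF b]]) (auto simp: h_cell)
  show ?thesis
    unfolding horn_filler_iff[OF pull_proj_in[OF b] u v]
  proof (intro bexI[OF _ h'] conjI allI ballI)
    fix m \<theta> assume \<theta>: "\<theta> \<in> cells (horn N k) m"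
    show "?h m \<theta> = u m \<theta>"
      using \<theta> horn_subset[OF \<theta>] fst_u[OF \<theta>] hu[OF \<theta>] by (simp add: u'_def prod_eq_iff)
  next
    fix m \<theta> assume "\<theta> \<in> ord_maps m N"
    then show "pull_proj Y B q n b m (?h m \<theta>) = v m \<theta>"
      by (simp add: pull_proj_apply[OF h_cell])
  qed
qed

end

lemma cocartesian_fibration_pull:
  assumes cocart: "cocartesian_fibration Y B q" and b: "b \<in> cells B n"
  shows "cocartesian_fibration (pull Y B q n b) (simplex n) (pull_proj Y B q n b)" (is "cocartesian_fibration ?P _ ?p")
proof -
  have qi: "inner_fibration Y B q" and q_hom: "q \<in> shom Y B"
    using cocart by (auto simp: cocartesian_fibration_def inner_fibration_def)
  interpret over_base Y B q by unfold_locales (rule q_hom)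
  have proj: "?p \<in> shom ?P (simplex n)" by (rule pull_proj_in[OF b])
  have inner: "inner_fibration ?P (simplex n) ?p"
    unfolding inner_fibration_def
  proof (intro conjI allI impI ballI)
    fix N k u v assume k: "0 < k" "k < N" and u: "u \<in> shom (horn N k) ?P" and v: "v \<in> shom (simplex N) (simplex n)"
      and sq: "scomp (horn N k) ?p u = scomp (horn N k) v (horn_incl N k)"
    show "horn_filler N k ?P ?p u v"
    proof (rule pull_filler[OF b u v])
      fix m \<theta> assume "\<theta> \<in> cells (horn N k) m"
      then show "?p m (u m \<theta>) = v m \<theta>" using sq unfolding horn_square_iff[OF proj u v] by blast
    next
      fix u' v' assume "u' \<in> shom (horn N k) Y" "v' \<in> shom (simplex N) B"
        "scomp (horn N k) q u' = scomp (horn N k) v' (horn_incl N k)"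
      then show "horn_filler N k Y q u' v'" using qi k unfolding inner_fibration_def by blast
    qed
  qed (rule proj)
  have edge: "cocartesian_edge ?P (simplex n) ?p (\<epsilon>, e)"
    if e: "cocartesian_edge Y B q e" and in_P: "(\<epsilon>, e) \<in> cells ?P 1" for \<epsilon> e
    unfolding cocartesian_edge_def
  proof (intro conjI allI impI ballI)
    fix N u v assume N: "2 \<le> N" and u: "u \<in> shom (horn N 0) ?P" and v: "v \<in> shom (simplex N) (simplex n)"
      and ue: "u 1 (ord_id 1) = (\<epsilon>, e)" and sq: "scomp (horn N 0) ?p u = scomp (horn N 0) v (horn_incl N 0)"
    show "horn_filler N 0 ?P ?p u v"
    proof (rule pull_filler[OF b u v])
      fix m \<theta> assume "\<theta> \<in> cells (horn N 0) m"
      then show "?p m (u m \<theta>) = v m \<theta>" using sq unfolding horn_square_iff[OF proj u v] by blast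
    next
      fix u' v' assume u': "u' \<in> shom (horn N 0) Y" and v': "v' \<in> shom (simplex N) B"
        and snd_u: "\<And>m \<theta>. \<theta> \<in> cells (horn N 0) m \<Longrightarrow> u' m \<theta> = snd (u m \<theta>)"
        and sq': "scomp (horn N 0) q u' = scomp (horn N 0) v' (horn_incl N 0)"
      have "ord_id 1 \<in> cells (horn N 0) 1"
        using N unfolding ord_id_def by (auto simp: horn_simps intro!: exI[of _ 2] ord_mapsI)
      then have "u' 1 (ord_id 1) = e" using snd_u ue by simp
      then show "horn_filler N 0 Y q u' v'" using e N u' v' sq' unfolding cocartesian_edge_def by blast
    qed
  qed (rule in_P)
  show ?thesis
    unfolding cocartesian_fibration_def
  proof (intro conjI ballI impI)
    fix \<epsilon> z assume \<epsilon>: "\<epsilon> \<in> cells (simplex n) 1" and z: "z \<in> cells ?P 0" and src: "?p 0 z = source (simplex n) \<epsilon>"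
    obtain \<theta> y where zy: "z = (\<theta>, y)" by (cases z)
    have y: "\<theta> \<in> ord_maps 0 n" "y \<in> cells Y 0" "q 0 y = act B 0 n \<theta> b" using z by (auto simp: zy cells_pull)
    have v0: "vertex 0 \<in> ord_maps 0 1" by (simp add: vertex_in)
    have \<theta>: "\<theta> = compose {..0} \<epsilon> (vertex 0)"
      using src pull_proj_apply[OF z] by (simp add: zy source_def)
    have \<epsilon>1: "\<epsilon> \<in> ord_maps 1 n" using \<epsilon> by simp
    have be: "act B 1 n \<epsilon> b \<in> cells B 1" by (rule act_in[OF B \<epsilon>1 b])
    have "q 0 y = source B (act B 1 n \<epsilon> b)"
      using y(3) act_act[OF B v0 \<epsilon>1 b] by (simp add: source_def \<theta>)
    then obtain e where e: "e \<in> cells Y 1" "cocartesian_edge Y B q e" "source Y e = y" "q 1 e = act B 1 n \<epsilon> b"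
      using cocart be y(2) unfolding cocartesian_fibration_def by blast
    have in_P: "(\<epsilon>, e) \<in> cells ?P 1" using \<epsilon>1 e by (simp add: cells_pull)
    show "\<exists>e'\<in>cells ?P 1. cocartesian_edge ?P (simplex n) ?p e' \<and> source ?P e' = z \<and> ?p 1 e' = \<epsilon>"
      using edge[OF e(2) in_P] in_P e(3) \<theta> pull_proj_apply[OF in_P]
      by (intro bexI[OF _ in_P]) (simp add: source_def zy)
  qed (rule inner)
qed

lemma cocartesian_fibration_sid: "cocartesian_fibration (simplex n) (simplex n) (sid (simplex n))"
proof -
  let ?S = "simplex n" and ?p = "sid (simplex n)"
  have p: "?p \<in> shom ?S ?S" by (simp add: sid_in)
  have fill: "horn_filler N k ?S ?p u v"
    if u: "u \<in> shom (horn N k) ?S" and v: "v \<in> shom (simplex N) ?S"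
      and sq: "scomp (horn N k) ?p u = scomp (horn N k) v (horn_incl N k)" for N k u v
  proof -
    have eq: "v m \<theta> = u m \<theta>" if "\<theta> \<in> cells (horn N k) m" for m \<theta>
    proof -
      have "?p m (u m \<theta>) = v m \<theta>" using sq that unfolding horn_square_iff[OF p u v] by blast
      then show ?thesis using sid_apply[OF shom_in[OF u that]] by simp
    qed
    show ?thesis
      unfolding horn_filler_iff[OF p u v]
      using shom_in[OF v] by (intro bexI[OF _ v] conjI allI ballI eq sid_apply) auto
  qed
  show ?thesis
    unfolding cocartesian_fibration_def inner_fibration_def cocartesian_edge_def
    using p fill by (auto simp del: simplex_simps)
qed

section \<open>Exponentials along a coCartesian fibration\<close>

text \<open>
  The right adjoint of pulling back along \<open>q\<close>, applied to \<open>C\<^sup>K\<close> relative to a fixed map on \<open>L\<close>. Sections of \<open>sec \<rightarrow> B\<close> over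
  a simplicial set \<open>A \<rightarrow> B\<close> are the maps from \<open>(A \<times>\<^sub>B Y) \<times> K\<close> to \<open>C\<close> that agree with \<open>f\<close> over \<open>L\<close>.
\<close>

locale sections = over_base Y B q
  for Y :: "'y sset" and B :: "'b sset" and q :: "('y, 'b) smap" +
  fixes K :: "'k sset" and L :: "nat \<Rightarrow> 'k set" and C :: "'c sset" and f :: "('y \<times> 'k, 'c) smap"
  assumes K: "simplicial_set K" and L: "subcomplex K L" and C: "simplicial_set C"
    and f: "simplicial_on (sprod Y K) (\<lambda>m. cells Y m \<times> L m) C f"
begin

abbreviation "PK n b \<equiv> sprod (pull Y B q n b) K"

definition restrict_to :: "nat \<Rightarrow> 'b \<Rightarrow> (nat \<Rightarrow> nat) \<Rightarrow> (((nat \<Rightarrow> nat) \<times> 'y) \<times> 'k, 'c) smap \<Rightarrow>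
    (((nat \<Rightarrow> nat) \<times> 'y) \<times> 'k, 'c) smap" where
  "restrict_to m b \<theta> \<phi> = (\<lambda>l. \<lambda>z\<in>cells (PK m b) l.
      \<phi> l ((compose {..l} \<theta> (fst (fst z)), snd (fst z)), snd z))"

definition sec :: "('b \<times> (((nat \<Rightarrow> nat) \<times> 'y) \<times> 'k, 'c) smap) sset" where
  "sec = \<lparr>cells = (\<lambda>n. {(b, \<phi>). b \<in> cells B n \<and> \<phi> \<in> shom (PK n b) C \<and>
       (\<forall>m \<theta> y \<kappa>. (\<theta>, y) \<in> cells (pull Y B q n b) m \<longrightarrow> \<kappa> \<in> L m \<longrightarrow> \<phi> m ((\<theta>, y), \<kappa>) = f m (y, \<kappa>))}),
     act = (\<lambda>m n \<theta> (b, \<phi>). (act B m n \<theta> b, restrict_to m (act B m n \<theta> b) \<theta> \<phi>))\<rparr>"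

definition sec_proj :: "('b \<times> (((nat \<Rightarrow> nat) \<times> 'y) \<times> 'k, 'c) smap, 'b) smap" where
  "sec_proj = (\<lambda>n. \<lambda>s\<in>cells sec n. fst s)"

lemma cells_sec: "(b, \<phi>) \<in> cells sec n \<longleftrightarrow> b \<in> cells B n \<and> \<phi> \<in> shom (PK n b) C \<and>
    (\<forall>m \<theta> y \<kappa>. (\<theta>, y) \<in> cells (pull Y B q n b) m \<longrightarrow> \<kappa> \<in> L m \<longrightarrow> \<phi> m ((\<theta>, y), \<kappa>) = f m (y, \<kappa>))"
  by (simp add: sec_def)

lemma act_sec [simp]: "act sec m n \<theta> (b, \<phi>) = (act B m n \<theta> b, restrict_to m (act B m n \<theta> b) \<theta> \<phi>)"
  by (simp add: sec_def)

lemma restrict_to_apply: "(\<eta>, y) \<in> cells (pull Y B q m b) l \<Longrightarrow> \<kappa> \<in> cells K l \<Longrightarrow>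
    restrict_to m b \<theta> \<phi> l ((\<eta>, y), \<kappa>) = \<phi> l ((compose {..l} \<theta> \<eta>, y), \<kappa>)"
  by (simp add: restrict_to_def)

lemma pull_compose:
  assumes "\<theta> \<in> ord_maps m n" "b \<in> cells B n" "(\<eta>, y) \<in> cells (pull Y B q m (act B m n \<theta> b)) l"
  shows "(compose {..l} \<theta> \<eta>, y) \<in> cells (pull Y B q n b) l"
  using assms by (simp add: cells_pull ord_maps_compose act_act[OF B])

lemma restrict_to_in:
  assumes b: "b \<in> cells B n" and \<phi>: "\<phi> \<in> shom (PK n b) C" and \<theta>: "\<theta> \<in> ord_maps m n"
  shows "restrict_to m (act B m n \<theta> b) \<theta> \<phi> \<in> shom (PK m (act B m n \<theta> b)) C"
  unfolding restrict_to_def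
proof (rule shomI[OF simplicial_sprod[OF pull K] C])
  show "act B m n \<theta> b \<in> cells B m" by (rule act_in[OF B \<theta> b])
  fix l z assume z: "z \<in> cells (PK m (act B m n \<theta> b)) l"
  obtain \<eta> y \<kappa> where z_eq: "z = ((\<eta>, y), \<kappa>)" by (metis surj_pair)
  have \<eta>: "(\<eta>, y) \<in> cells (pull Y B q m (act B m n \<theta> b)) l" "\<kappa> \<in> cells K l" using z by (auto simp: z_eq)
  have cell: "((compose {..l} \<theta> \<eta>, y), \<kappa>) \<in> cells (PK n b) l" using pull_compose[OF \<theta> b \<eta>(1)] \<eta>(2) by simp
  show "\<phi> l ((compose {..l} \<theta> (fst (fst z)), snd (fst z)), snd z) \<in> cells C l"
    using shom_in[OF \<phi> cell] by (simp add: z_eq)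
  fix l' \<psi> assume \<psi>: "\<psi> \<in> ord_maps l' l"
  show "\<phi> l' ((compose {..l'} \<theta> (fst (fst (act (PK m (act B m n \<theta> b)) l' l \<psi> z))),
        snd (fst (act (PK m (act B m n \<theta> b)) l' l \<psi> z))), snd (act (PK m (act B m n \<theta> b)) l' l \<psi> z)) =
      act C l' l \<psi> (\<phi> l ((compose {..l} \<theta> (fst (fst z)), snd (fst z)), snd z))"
    using shom_act[OF \<phi> \<psi> cell] by (simp add: z_eq compose_ord_assoc[OF \<psi>])
qed

lemma sec_act_in: "\<theta> \<in> ord_maps m n \<Longrightarrow> s \<in> cells sec n \<Longrightarrow> act sec m n \<theta> s \<in> cells sec m"
proof (cases s)
  case (Pair b \<phi>)
  assume \<theta>: "\<theta> \<in> ord_maps m n" and "s \<in> cells sec n"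
  then have b: "b \<in> cells B n" and \<phi>: "\<phi> \<in> shom (PK n b) C"
    and \<phi>L: "\<And>m \<theta> y \<kappa>. (\<theta>, y) \<in> cells (pull Y B q n b) m \<Longrightarrow> \<kappa> \<in> L m \<Longrightarrow> \<phi> m ((\<theta>, y), \<kappa>) = f m (y, \<kappa>)"
    by (auto simp: Pair cells_sec)
  show ?thesis
    using act_in[OF B \<theta> b] restrict_to_in[OF b \<phi> \<theta>] \<phi>L pull_compose[OF \<theta> b]
    by (auto simp: Pair cells_sec restrict_to_apply subcomplex_cells[OF L])
qed

lemma sec: "simplicial_set sec"
proof (rule simplicial_setI)
  fix n s assume s: "s \<in> cells sec n"
  obtain b \<phi> where s_eq: "s = (b, \<phi>)" by (cases s)
  have b: "b \<in> cells B n" and \<phi>: "\<phi> \<in> shom (PK n b) C" using s by (auto simp: s_eq cells_sec)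
  have "restrict_to n b (ord_id n) \<phi> = \<phi>"
  proof (rule shom_eqI[OF _ \<phi>])
    show "restrict_to n b (ord_id n) \<phi> \<in> shom (PK n b) C"
      using restrict_to_in[OF b \<phi> ord_id_in] act_id[OF B b] by simp
    fix l z assume "z \<in> cells (PK n b) l"
    then show "restrict_to n b (ord_id n) \<phi> l z = \<phi> l z"
      by (auto simp: restrict_to_apply compose_ord_id_left cells_pull)
  qed
  then show "act sec n n (ord_id n) s = s" by (simp add: s_eq act_id[OF B b])
next
  fix l m n \<phi>' \<theta> s assume \<phi>': "\<phi>' \<in> ord_maps l m" and \<theta>: "\<theta> \<in> ord_maps m n" and s: "s \<in> cells sec n"
  obtain b \<phi> where s_eq: "s = (b, \<phi>)" by (cases s)
  have b: "b \<in> cells B n" and \<phi>: "\<phi> \<in> shom (PK n b) C" using s by (auto simp: s_eq cells_sec)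
  note c = ord_maps_compose[OF \<theta> \<phi>']
  have b': "act B m n \<theta> b \<in> cells B m" by (rule act_in[OF B \<theta> b])
  have bb: "act B l m \<phi>' (act B m n \<theta> b) = act B l n (compose {..l} \<theta> \<phi>') b"
    by (rule act_act[OF B \<phi>' \<theta> b])
  have "restrict_to l (act B l m \<phi>' (act B m n \<theta> b)) \<phi>' (restrict_to m (act B m n \<theta> b) \<theta> \<phi>) =
      restrict_to l (act B l n (compose {..l} \<theta> \<phi>') b) (compose {..l} \<theta> \<phi>') \<phi>"
  proof (rule shom_eqI)
    show "restrict_to l (act B l m \<phi>' (act B m n \<theta> b)) \<phi>' (restrict_to m (act B m n \<theta> b) \<theta> \<phi>)
        \<in> shom (PK l (act B l m \<phi>' (act B m n \<theta> b))) C"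
      by (rule restrict_to_in[OF b' restrict_to_in[OF b \<phi> \<theta>] \<phi>'])
    show "restrict_to l (act B l n (compose {..l} \<theta> \<phi>') b) (compose {..l} \<theta> \<phi>') \<phi>
        \<in> shom (PK l (act B l m \<phi>' (act B m n \<theta> b))) C"
      using restrict_to_in[OF b \<phi> c] bb by simp
    fix r z assume z: "z \<in> cells (PK l (act B l m \<phi>' (act B m n \<theta> b))) r"
    obtain \<eta> y \<kappa> where z_eq: "z = ((\<eta>, y), \<kappa>)" by (metis surj_pair)
    have \<eta>: "(\<eta>, y) \<in> cells (pull Y B q l (act B l m \<phi>' (act B m n \<theta> b))) r" "\<kappa> \<in> cells K r"
      using z by (auto simp: z_eq)
    have "\<eta> \<in> ord_maps r l" using \<eta> by (simp add: cells_pull)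
    then show "restrict_to l (act B l m \<phi>' (act B m n \<theta> b)) \<phi>' (restrict_to m (act B m n \<theta> b) \<theta> \<phi>) r z =
        restrict_to l (act B l n (compose {..l} \<theta> \<phi>') b) (compose {..l} \<theta> \<phi>') \<phi> r z"
      using \<eta> pull_compose[OF \<phi>' b' \<eta>(1)] bb
      by (simp add: z_eq restrict_to_apply compose_ord_assoc)
  qed
  then show "act sec l m \<phi>' (act sec m n \<theta> s) = act sec l n (compose {..l} \<theta> \<phi>') s"
    by (simp add: s_eq bb)
qed (rule sec_act_in)

lemma sec_proj_in: "sec_proj \<in> shom sec B"
  unfolding sec_proj_def by (rule shomI[OF sec B]) (auto simp: cells_sec)

text \<open>
  A horn in \<open>sec\<close> over an \<open>n\<close>-simplex \<open>b\<close> glues to a map on the part of \<open>b\<^sup>*Y \<times> K\<close> over the horn, together with \<open>b\<^sup>*Y \<times> L\<close>;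
  \<open>extend_from_horn\<close> extends it, and by Yoneda the extension is a filler.
\<close>

lemma sec_inner_fibration:
  assumes cocart: "cocartesian_fibration Y B q" and qC: "quasi_category C"
  shows "inner_fibration sec B sec_proj"
  unfolding inner_fibration_def
proof (intro conjI allI impI ballI sec_proj_in)
  fix n k u v assume k: "0 < k" "k < n" and u: "u \<in> shom (horn n k) sec" and v: "v \<in> shom (simplex n) B"
    and sq: "scomp (horn n k) sec_proj u = scomp (horn n k) v (horn_incl n k)"
  define b where "b = v n (ord_id n)"
  have b: "b \<in> cells B n" unfolding b_def using shom_in[OF v] by simp
  have v_act: "v m \<theta> = act B m n \<theta> b" if "\<theta> \<in> ord_maps m n" for m \<theta>
    using shom_act[OF v that, of "ord_id n"] compose_ord_id_left[OF that] by (simp add: b_def)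
  let ?P = "pull Y B q n b" and ?p = "pull_proj Y B q n b"
  let ?W = "horn_part ?p ?P K L n k"
  have P: "simplicial_set ?P" by (rule pull[OF b])
  have u_cell: "u m \<theta> \<in> cells sec m" if "\<theta> \<in> cells (horn n k) m" for m \<theta> by (rule shom_in[OF u that])
  have fst_u: "fst (u m \<theta>) = act B m n \<theta> b" if "\<theta> \<in> cells (horn n k) m" for m \<theta>
  proof -
    have "sec_proj m (u m \<theta>) = v m \<theta>" using sq that unfolding horn_square_iff[OF sec_proj_in u v] by blast
    then show ?thesis using u_cell[OF that] v_act[OF horn_subset[OF that]] by (simp add: sec_proj_def)
  qed
  define U where "U m \<theta> = snd (u m \<theta>)" for m \<theta>
  have u_eq: "u m \<theta> = (act B m n \<theta> b, U m \<theta>)" if "\<theta> \<in> cells (horn n k) m" for m \<theta>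
    using fst_u[OF that] by (simp add: U_def prod_eq_iff)
  have U: "U m \<theta> \<in> shom (PK m (act B m n \<theta> b)) C"
    and U_L: "\<And>l \<eta> y \<kappa>. (\<eta>, y) \<in> cells (pull Y B q m (act B m n \<theta> b)) l \<Longrightarrow> \<kappa> \<in> L l \<Longrightarrow>
      U m \<theta> l ((\<eta>, y), \<kappa>) = f l (y, \<kappa>)"
    if "\<theta> \<in> cells (horn n k) m" for m \<theta>
    using u_cell[OF that] by (auto simp: u_eq[OF that] cells_sec)
  \<comment> \<open>the maps on the faces of the horn fit together, as u is simplicial\<close>
  have U_compose: "U l (compose {..l} \<theta> \<phi>) l ((ord_id l, y), \<kappa>) = U m \<theta> l ((\<phi>, y), \<kappa>)"
    if \<theta>: "\<theta> \<in> cells (horn n k) m" and \<phi>: "\<phi> \<in> ord_maps l m" and y: "y \<in> cells Y l"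
      "q l y = act B l n (compose {..l} \<theta> \<phi>) b" and \<kappa>: "\<kappa> \<in> cells K l" for m l \<theta> \<phi> y \<kappa>
  proof -
    note \<theta>' = horn_subset[OF \<theta>]
    have "(act B l n (compose {..l} \<theta> \<phi>) b, U l (compose {..l} \<theta> \<phi>)) = act sec l m \<phi> (act B m n \<theta> b, U m \<theta>)"
      using shom_act[OF u \<phi> \<theta>] u_eq[OF \<theta>] u_eq[OF horn_compose[OF \<phi> \<theta>]] by simp
    then have *: "U l (compose {..l} \<theta> \<phi>) = restrict_to l (act B l n (compose {..l} \<theta> \<phi>) b) \<phi> (U m \<theta>)"
      using act_act[OF B \<phi> \<theta>' b] by simp
    have "(ord_id l, y) \<in> cells (pull Y B q l (act B l n (compose {..l} \<theta> \<phi>) b)) l"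
      using y act_id[OF B act_in[OF B ord_maps_compose[OF \<theta>' \<phi>] b]] by (simp add: cells_pull)
    then show ?thesis unfolding * using \<kappa> by (simp add: restrict_to_apply compose_ord_id_right[OF \<phi>])
  qed
  define g where "g = (\<lambda>m ((\<theta>, y), \<kappa>). if \<theta> \<in> cells (horn n k) m then U m \<theta> m ((ord_id m, y), \<kappa>) else f m (y, \<kappa>))"
  have W_iff: "((\<theta>, y), \<kappa>) \<in> ?W m \<longleftrightarrow> (\<theta>, y) \<in> cells ?P m \<and> \<kappa> \<in> cells K m \<and> (\<theta> \<in> cells (horn n k) m \<or> \<kappa> \<in> L m)"
    for m \<theta> y \<kappa>
    by (auto simp: horn_part_def pull_proj_apply)
  have id_cell: "(ord_id m, y) \<in> cells (pull Y B q m (act B m n \<theta> b)) m" if "(\<theta>, y) \<in> cells ?P m" for m \<theta> y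
    using that act_id[OF B act_in[OF B _ b]] by (simp add: cells_pull)
  have g_L: "g m ((\<theta>, y), \<kappa>) = f m (y, \<kappa>)" if "(\<theta>, y) \<in> cells ?P m" "\<kappa> \<in> L m" for m \<theta> y \<kappa>
    using U_L[OF _ id_cell[OF that(1)] that(2)] by (simp add: g_def)
  have g: "simplicial_on (sprod ?P K) ?W C g"
    unfolding simplicial_on_def
  proof (intro conjI allI impI)
    fix m z assume z: "z \<in> ?W m"
    obtain \<theta> y \<kappa> where z_eq: "z = ((\<theta>, y), \<kappa>)" by (metis surj_pair)
    have cell: "(\<theta>, y) \<in> cells ?P m" "\<kappa> \<in> cells K m" using z by (auto simp: z_eq W_iff)
    then have y: "y \<in> cells Y m" "q m y = act B m n \<theta> b" "\<theta> \<in> ord_maps m n" by (auto simp: cells_pull)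
    have inC: "g m z \<in> cells C m \<and> (\<forall>l \<phi>. \<phi> \<in> ord_maps l m \<longrightarrow> g l (act (sprod ?P K) l m \<phi> z) = act C l m \<phi> (g m z))"
    proof (cases "\<kappa> \<in> L m")
      case True
      have gz: "g m z = f m (y, \<kappa>)" using g_L[OF cell(1) True] by (simp add: z_eq)
      have "g l (act (sprod ?P K) l m \<phi> z) = act C l m \<phi> (g m z)" if \<phi>: "\<phi> \<in> ord_maps l m" for l \<phi>
        using g_L[OF _ subcomplex_act[OF L \<phi> True], of "compose {..l} \<theta> \<phi>" "act Y l m \<phi> y"]
          act_in[OF P \<phi> cell(1)] simplicial_on_act[OF f \<phi>, of "(y, \<kappa>)"] True y
        by (simp add: gz) (simp add: z_eq)
      then show ?thesis using simplicial_on_in[OF f, of "(y, \<kappa>)" m] True y by (simp add: gz)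
    next
      case False
      then have \<theta>: "\<theta> \<in> cells (horn n k) m" using z by (simp add: z_eq W_iff)
      have idz: "((ord_id m, y), \<kappa>) \<in> cells (PK m (act B m n \<theta> b)) m" using id_cell[OF cell(1)] cell(2) by simp
      have gz: "g m z = U m \<theta> m ((ord_id m, y), \<kappa>)" using \<theta> by (simp add: g_def z_eq)
      have "g l (act (sprod ?P K) l m \<phi> z) = act C l m \<phi> (g m z)" if \<phi>: "\<phi> \<in> ord_maps l m" for l \<phi>
      proof -
        have "(compose {..l} \<theta> \<phi>, act Y l m \<phi> y) \<in> cells ?P l" using act_in[OF P \<phi> cell(1)] by simp
        then have "U l (compose {..l} \<theta> \<phi>) l ((ord_id l, act Y l m \<phi> y), act K l m \<phi> \<kappa>) =
            U m \<theta> l ((\<phi>, act Y l m \<phi> y), act K l m \<phi> \<kappa>)"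
          using act_in[OF K \<phi> cell(2)] by (intro U_compose[OF \<theta> \<phi>]) (simp_all add: cells_pull)
        also have "\<dots> = act C l m \<phi> (U m \<theta> m ((ord_id m, y), \<kappa>))"
          using shom_act[OF U[OF \<theta>] \<phi> idz] compose_ord_id_left[OF \<phi>] by simp
        finally show ?thesis unfolding gz using horn_compose[OF \<phi> \<theta>] by (simp add: z_eq g_def)
      qed
      then show ?thesis using shom_in[OF U[OF \<theta>] idz] by (simp add: gz)
    qed
    then show "g m z \<in> cells C m" by blast
    fix l \<phi> assume "\<phi> \<in> ord_maps l m"
    with inC show "g l (act (sprod ?P K) l m \<phi> z) = act C l m \<phi> (g m z)" by blast
  qed
  obtain G where G: "G \<in> shom (sprod ?P K) C" and Gg: "\<And>m z. z \<in> ?W m \<Longrightarrow> G m z = g m z"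
    using extend_from_horn[OF cocartesian_fibration_pull[OF cocart b] k K L qC g] by blast
  have bG: "(b, G) \<in> cells sec n"
    using b G Gg g_L by (auto simp: cells_sec W_iff subcomplex_cells[OF L])
  show "horn_filler n k sec sec_proj u v"
    unfolding horn_filler_iff[OF sec_proj_in u v]
  proof (intro bexI[OF _ yoneda_in[OF sec bG]] conjI allI ballI)
    fix m \<theta> assume \<theta>: "\<theta> \<in> cells (horn n k) m"
    note \<theta>' = horn_subset[OF \<theta>]
    have "restrict_to m (act B m n \<theta> b) \<theta> G = U m \<theta>"
    proof (rule shom_eqI[OF restrict_to_in[OF b G \<theta>'] U[OF \<theta>]])
      fix l z assume z: "z \<in> cells (PK m (act B m n \<theta> b)) l"
      obtain \<eta> y \<kappa> where z_eq: "z = ((\<eta>, y), \<kappa>)" by (metis surj_pair)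
      have \<eta>: "(\<eta>, y) \<in> cells (pull Y B q m (act B m n \<theta> b)) l" "\<kappa> \<in> cells K l" using z by (auto simp: z_eq)
      have cell: "(compose {..l} \<theta> \<eta>, y) \<in> cells ?P l" by (rule pull_compose[OF \<theta>' b \<eta>(1)])
      have \<eta>': "\<eta> \<in> ord_maps l m" using \<eta> by (simp add: cells_pull)
      have "G l ((compose {..l} \<theta> \<eta>, y), \<kappa>) = U l (compose {..l} \<theta> \<eta>) l ((ord_id l, y), \<kappa>)"
        using Gg[of "((compose {..l} \<theta> \<eta>, y), \<kappa>)" l] horn_compose[OF \<eta>' \<theta>] cell \<eta>(2) by (simp add: W_iff g_def)
      also have "\<dots> = U m \<theta> l ((\<eta>, y), \<kappa>)"
        using cell \<eta>(2) by (intro U_compose[OF \<theta> \<eta>']) (simp_all add: cells_pull)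
      finally show "restrict_to m (act B m n \<theta> b) \<theta> G l z = U m \<theta> l z"
        using \<eta> by (simp add: z_eq restrict_to_apply)
    qed
    then show "yoneda sec n (b, G) m \<theta> = u m \<theta>" using \<theta>' by (simp add: u_eq[OF \<theta>])
  next
    fix m \<theta> assume \<theta>: "\<theta> \<in> ord_maps m n"
    then show "sec_proj m (yoneda sec n (b, G) m \<theta>) = v m \<theta>"
      using act_in[OF sec \<theta> bG] v_act[OF \<theta>] by (simp add: sec_proj_def)
  qed
qed

end

section \<open>Inner anodyne maps lift against inner fibrations\<close>

definition lifts :: "'a sset \<Rightarrow> 'b sset \<Rightarrow> ('a, 'b) smap \<Rightarrow> 'e sset \<Rightarrow> 's sset \<Rightarrow> ('e, 's) smap \<Rightarrow> bool" where
  "lifts A B f E S p \<longleftrightarrow> (\<forall>u\<in>shom A E. \<forall>v\<in>shom B S.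
     (\<forall>n. \<forall>x\<in>cells A n. p n (u n x) = v n (f n x)) \<longrightarrow>
     (\<exists>w\<in>shom B E. (\<forall>n. \<forall>x\<in>cells A n. w n (f n x) = u n x) \<and> (\<forall>n. \<forall>y\<in>cells B n. p n (w n y) = v n y)))"

lemma liftsD:
  assumes "lifts A B f E S p" "u \<in> shom A E" "v \<in> shom B S" "\<And>n x. x \<in> cells A n \<Longrightarrow> p n (u n x) = v n (f n x)"
  obtains w where "w \<in> shom B E" "\<And>n x. x \<in> cells A n \<Longrightarrow> w n (f n x) = u n x"
    "\<And>n y. y \<in> cells B n \<Longrightarrow> p n (w n y) = v n y"
  using assms unfolding lifts_def by blast

lemma lifts_inner_horn:
  assumes p: "inner_fibration E S p" and k: "0 < k" "k < n"
    and a: "siso (horn n k) A a" and b: "siso (simplex n) B b" and f: "f \<in> shom A B"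
    and sq: "scomp (horn n k) f a = scomp (horn n k) b (horn_incl n k)"
  shows "lifts A B f E S p"
  unfolding lifts_def
proof (intro ballI impI)
  fix u v assume u: "u \<in> shom A E" and v: "v \<in> shom B S"
    and uv: "\<forall>n. \<forall>x\<in>cells A n. p n (u n x) = v n (f n x)"
  obtain a' where a_in: "a \<in> shom (horn n k) A" and a': "a' \<in> shom A (horn n k)" "scomp A a a' = sid A"
    using a unfolding siso_def by blast
  obtain b' where b_in: "b \<in> shom (simplex n) B" and b': "b' \<in> shom B (simplex n)" "scomp (simplex n) b' b = sid (simplex n)"
      "scomp B b b' = sid B"
    using b unfolding siso_def by blast
  have aa': "a m (a' m x) = x" if "x \<in> cells A m" for m x using scomp_apply[OF that, of a a'] that by (simp add: a')
  have bb': "b m (b' m x) = x" if "x \<in> cells B m" for m x using scomp_apply[OF that, of b b'] that by (simp add: b')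
  have b'b: "b' m (b m x) = x" if "x \<in> ord_maps m n" for m x
    using scomp_apply[of x "simplex n" m b' b] that by (simp add: b')
  have fa: "f m (a m x) = b m x" if "x \<in> cells (horn n k) m" for m x
    using scomp_eqD[OF sq that] that by (simp add: horn_incl_def)
  have ua: "scomp (horn n k) u a \<in> shom (horn n k) E" by (rule scomp_in[OF a_in u])
  have vb: "scomp (simplex n) v b \<in> shom (simplex n) S" by (rule scomp_in[OF b_in v])
  obtain h where h: "h \<in> shom (simplex n) E"
    "\<And>m \<theta>. \<theta> \<in> cells (horn n k) m \<Longrightarrow> h m \<theta> = scomp (horn n k) u a m \<theta>"
    "\<And>m \<theta>. \<theta> \<in> ord_maps m n \<Longrightarrow> p m (h m \<theta>) = scomp (simplex n) v b m \<theta>"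
    by (rule inner_fibration_filler[OF p k ua vb])
      (use uv shom_in[OF a_in] fa in \<open>auto simp: horn_subset\<close>)
  have a'x: "a' m x \<in> cells (horn n k) m" if "x \<in> cells A m" for m x using shom_in[OF a'(1) that] .
  have b'f: "b' m (f m x) = a' m x" if "x \<in> cells A m" for m x
    using fa[OF a'x[OF that]] aa'[OF that] b'b[OF horn_subset[OF a'x[OF that]]] by simp
  show "\<exists>w\<in>shom B E. (\<forall>n. \<forall>x\<in>cells A n. w n (f n x) = u n x) \<and> (\<forall>n. \<forall>y\<in>cells B n. p n (w n y) = v n y)"
  proof (intro bexI[OF _ scomp_in[OF b'(1) h(1)]] conjI allI ballI)
    fix m x assume x: "x \<in> cells A m"
    show "scomp B h b' m (f m x) = u m x"
      using shom_in[OF f x] b'f[OF x] h(2)[OF a'x[OF x]] a'x[OF x] aa'[OF x] by simp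
  next
    fix m y assume y: "y \<in> cells B m"
    show "p m (scomp B h b' m y) = v m y"
      using y shom_in[OF b'(1) y] h(3) bb'[OF y] by simp
  qed
qed

lemma glue_rel_const:
  fixes f :: "'s \<Rightarrow> 'b" and g :: "'s \<Rightarrow> 'c"
  assumes "(x, y) \<in> glue_rel S f g" "\<And>a. a \<in> S \<Longrightarrow> \<phi> (Inl (f a)) = \<phi> (Inr (g a))"
  shows "\<phi> x = \<phi> y"
proof -
  define E :: "('b + 'c) rel" where "E = (\<lambda>a. (Inl (f a), Inr (g a))) ` S"
  have "(x, y) \<in> (E \<union> E\<inverse>)\<^sup>*" using assms(1) by (simp add: glue_rel_def Let_def E_def)
  then show ?thesis by (induction rule: rtrancl_induct) (use assms(2) in \<open>auto simp: E_def\<close>)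
qed

lemma lifts_pushout:
  assumes lift: "lifts A B f E S p" and po: "is_pushout A B C D f g h k" and p: "p \<in> shom E S"
  shows "lifts C D k E S p"
  unfolding lifts_def
proof (intro ballI impI)
  fix u v assume u: "u \<in> shom C E" and v: "v \<in> shom D S"
    and uv: "\<forall>n. \<forall>x\<in>cells C n. p n (u n x) = v n (k n x)"
  have f: "f \<in> shom A B" and g: "g \<in> shom A C" and h: "h \<in> shom B D" and k: "k \<in> shom C D"
    and sq: "scomp A h f = scomp A k g" and cov: "\<And>n. cells D n = h n ` cells B n \<union> k n ` cells C n"
    and glue: "\<And>n x y. x \<in> cells B n <+> cells C n \<Longrightarrow> y \<in> cells B n <+> cells C n \<Longrightarrow>
       case_sum (h n) (k n) x = case_sum (h n) (k n) y \<Longrightarrow> (x, y) \<in> glue_rel (cells A n) (f n) (g n)"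
    using po unfolding is_pushout_def by blast+
  have hf: "h n (f n x) = k n (g n x)" if "x \<in> cells A n" for n x by (rule scomp_eqD[OF sq that])
  obtain w where w: "w \<in> shom B E" and wf: "\<And>n x. x \<in> cells A n \<Longrightarrow> w n (f n x) = scomp A u g n x"
    and pw: "\<And>n y. y \<in> cells B n \<Longrightarrow> p n (w n y) = scomp B v h n y"
    by (rule liftsD[OF lift scomp_in[OF g u] scomp_in[OF h v]])
      (use shom_in[OF f] shom_in[OF g] uv hf in auto)
  define val where "val n = case_sum (w n) (u n)" for n
  define W where "W n d = val n (SOME z. z \<in> cells B n <+> cells C n \<and> case_sum (h n) (k n) z = d)" for n d
  have val: "val n x = val n y" if "x \<in> cells B n <+> cells C n" "y \<in> cells B n <+> cells C n"
       "case_sum (h n) (k n) x = case_sum (h n) (k n) y" for n x y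
    by (rule glue_rel_const[OF glue[OF that]]) (simp add: val_def wf)
  have W: "W n (case_sum (h n) (k n) z) = val n z" if "z \<in> cells B n <+> cells C n" for n z
  proof -
    have "\<exists>y. y \<in> cells B n <+> cells C n \<and> case_sum (h n) (k n) y = case_sum (h n) (k n) z" using that by blast
    note some = someI_ex[OF this]
    show ?thesis unfolding W_def by (rule val[OF conjunct1[OF some] that conjunct2[OF some]])
  qed
  have Wh: "W n (h n x) = w n x" if "x \<in> cells B n" for n x using W[OF InlI[OF that]] by (simp add: val_def)
  have Wk: "W n (k n x) = u n x" if "x \<in> cells C n" for n x using W[OF InrI[OF that]] by (simp add: val_def)
  have WE: "(\<lambda>n. \<lambda>d\<in>cells D n. W n d) \<in> shom D E"
  proof (rule shomI)
    show "simplicial_set D" "simplicial_set E" using h u by (auto dest: shom_ss)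
    fix n d assume d: "d \<in> cells D n"
    then show "W n d \<in> cells E n"
      unfolding cov by (auto simp: Wh Wk shom_in[OF w] shom_in[OF u])
    fix m \<theta> assume \<theta>: "\<theta> \<in> ord_maps m n"
    from d consider x where "x \<in> cells B n" "d = h n x" | x where "x \<in> cells C n" "d = k n x"
      unfolding cov by blast
    then show "W m (act D m n \<theta> d) = act E m n \<theta> (W n d)"
    proof cases
      case 1
      then show ?thesis
        using shom_act[OF h \<theta> 1(1)] shom_act[OF w \<theta> 1(1)] act_in[OF shom_ss(1)[OF h] \<theta> 1(1)] Wh by metis
    next
      case 2
      then show ?thesis
        using shom_act[OF k \<theta> 2(1)] shom_act[OF u \<theta> 2(1)] act_in[OF shom_ss(1)[OF k] \<theta> 2(1)] Wk by metis
    qed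
  qed
  show "\<exists>w\<in>shom D E. (\<forall>n. \<forall>x\<in>cells C n. w n (k n x) = u n x) \<and> (\<forall>n. \<forall>y\<in>cells D n. p n (w n y) = v n y)"
  proof (intro bexI[OF _ WE] conjI allI ballI)
    fix n x assume "x \<in> cells C n"
    then show "(\<lambda>d\<in>cells D n. W n d) (k n x) = u n x" using shom_in[OF k] by (simp add: Wk)
  next
    fix n d assume d: "d \<in> cells D n"
    then have "p n (W n d) = v n d" unfolding cov using pw uv by (auto simp: Wh Wk)
    then show "p n ((\<lambda>d\<in>cells D n. W n d) d) = v n d" using d by simp
  qed
qed

lemma lifts_retract:
  assumes lift: "lifts C D g E S p" and r: "is_retract A B f C D g"
  shows "lifts A B f E S p"
  unfolding lifts_def
proof (intro ballI impI)
  fix u v assume u: "u \<in> shom A E" and v: "v \<in> shom B S"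
    and uv: "\<forall>n. \<forall>x\<in>cells A n. p n (u n x) = v n (f n x)"
  obtain s r s' r' where f: "f \<in> shom A B" and g: "g \<in> shom C D" and s: "s \<in> shom A C" and r: "r \<in> shom C A"
    and s': "s' \<in> shom B D" and r': "r' \<in> shom D B" and eqs: "scomp A r s = sid A" "scomp B r' s' = sid B"
      "scomp A g s = scomp A s' f" "scomp C f r = scomp C r' g"
    using r unfolding is_retract_def by blast
  have rs: "r n (s n x) = x" if "x \<in> cells A n" for n x using scomp_apply[OF that, of r s] that by (simp add: eqs)
  have rs': "r' n (s' n x) = x" if "x \<in> cells B n" for n x using scomp_apply[OF that, of r' s'] that by (simp add: eqs)
  have gs: "g n (s n x) = s' n (f n x)" if "x \<in> cells A n" for n x by (rule scomp_eqD[OF eqs(3) that])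
  have fr: "f n (r n x) = r' n (g n x)" if "x \<in> cells C n" for n x by (rule scomp_eqD[OF eqs(4) that])
  obtain w where w: "w \<in> shom D E" "\<And>n x. x \<in> cells C n \<Longrightarrow> w n (g n x) = scomp C u r n x"
    "\<And>n y. y \<in> cells D n \<Longrightarrow> p n (w n y) = scomp D v r' n y"
    by (rule liftsD[OF lift scomp_in[OF r u] scomp_in[OF r' v]])
      (use shom_in[OF g] shom_in[OF r] uv fr in auto)
  show "\<exists>w\<in>shom B E. (\<forall>n. \<forall>x\<in>cells A n. w n (f n x) = u n x) \<and> (\<forall>n. \<forall>y\<in>cells B n. p n (w n y) = v n y)"
  proof (intro bexI[OF _ scomp_in[OF s' w(1)]] conjI allI ballI)
    fix n x assume x: "x \<in> cells A n"
    show "scomp B w s' n (f n x) = u n x"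
      using shom_in[OF f x] gs[OF x, symmetric] w(2)[OF shom_in[OF s x]] shom_in[OF s x] rs[OF x] by simp
  next
    fix n y assume y: "y \<in> cells B n"
    show "p n (scomp B w s' n y) = v n y"
      using y w(3)[OF shom_in[OF s' y]] shom_in[OF s' y] rs'[OF y] by simp
  qed
qed

lemma chain_colimit_map:
  assumes col: "is_chain_colimit I r F t T c" and I: "I \<noteq> {}"
    and w: "\<And>\<beta>. \<beta> \<in> I \<Longrightarrow> w \<beta> \<in> shom (F \<beta>) E"
    and compat: "\<And>\<beta> \<gamma> n x. \<beta> \<in> I \<Longrightarrow> \<gamma> \<in> I \<Longrightarrow> (\<beta>, \<gamma>) \<in> r \<Longrightarrow> x \<in> cells (F \<beta>) n \<Longrightarrow> w \<gamma> n (t \<beta> \<gamma> n x) = w \<beta> n x"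
  obtains W where "W \<in> shom T E" "\<And>\<beta> n x. \<beta> \<in> I \<Longrightarrow> x \<in> cells (F \<beta>) n \<Longrightarrow> W n (c \<beta> n x) = w \<beta> n x"
proof -
  have c: "\<And>\<beta>. \<beta> \<in> I \<Longrightarrow> c \<beta> \<in> shom (F \<beta>) T" and cov: "\<And>n. cells T n = (\<Union>\<beta>\<in>I. c \<beta> n ` cells (F \<beta>) n)"
    using col by (simp_all add: is_chain_colimit_def)
  have eq: "\<forall>n. \<forall>\<beta>\<in>I. \<forall>\<gamma>\<in>I. \<forall>x\<in>cells (F \<beta>) n. \<forall>y\<in>cells (F \<gamma>) n. c \<beta> n x = c \<gamma> n y \<longrightarrow>
      (\<exists>\<delta>\<in>I. (\<beta>, \<delta>) \<in> r \<and> (\<gamma>, \<delta>) \<in> r \<and> t \<beta> \<delta> n x = t \<gamma> \<delta> n y)"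
    using col by (simp add: is_chain_colimit_def)
  define rep where "rep n d = (SOME z. fst z \<in> I \<and> snd z \<in> cells (F (fst z)) n \<and> c (fst z) n (snd z) = d)" for n d
  define W where "W n d = w (fst (rep n d)) n (snd (rep n d))" for n d
  have W: "W n (c \<beta> n x) = w \<beta> n x" if \<beta>: "\<beta> \<in> I" and x: "x \<in> cells (F \<beta>) n" for \<beta> n x
  proof -
    let ?P = "\<lambda>z. fst z \<in> I \<and> snd z \<in> cells (F (fst z)) n \<and> c (fst z) n (snd z) = c \<beta> n x"
    have "?P (\<beta>, x)" using \<beta> x by simp
    then have "?P (rep n (c \<beta> n x))" unfolding rep_def by (rule someI[of ?P])
    then obtain \<gamma> y where rep: "rep n (c \<beta> n x) = (\<gamma>, y)" and \<gamma>: "\<gamma> \<in> I" "y \<in> cells (F \<gamma>) n" "c \<gamma> n y = c \<beta> n x"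
      by (metis prod.collapse)
    obtain \<delta> where \<delta>: "\<delta> \<in> I" "(\<gamma>, \<delta>) \<in> r" "(\<beta>, \<delta>) \<in> r" "t \<gamma> \<delta> n y = t \<beta> \<delta> n x"
      using eq[rule_format, OF \<gamma>(1) \<beta> \<gamma>(2) x \<gamma>(3)] by blast
    have "w \<gamma> n y = w \<beta> n x"
      using compat[OF \<gamma>(1) \<delta>(1,2) \<gamma>(2)] compat[OF \<beta> \<delta>(1,3) x] \<delta>(4) by simp
    then show ?thesis by (simp add: W_def rep)
  qed
  obtain \<beta>0 where \<beta>0: "\<beta>0 \<in> I" using I by blast
  show ?thesis
  proof
    show "(\<lambda>n. \<lambda>d\<in>cells T n. W n d) \<in> shom T E"
    proof (rule shomI)
      show "simplicial_set T" "simplicial_set E" using c[OF \<beta>0] w[OF \<beta>0] by (auto dest: shom_ss)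
      fix n d assume "d \<in> cells T n"
      then obtain \<beta> x where \<beta>: "\<beta> \<in> I" "x \<in> cells (F \<beta>) n" "d = c \<beta> n x" unfolding cov by blast
      show "W n d \<in> cells E n" using \<beta> W shom_in[OF w] by simp
      fix m \<theta> assume \<theta>: "\<theta> \<in> ord_maps m n"
      have x': "act (F \<beta>) m n \<theta> x \<in> cells (F \<beta>) m" by (rule act_in[OF shom_ss(1)[OF c[OF \<beta>(1)]] \<theta> \<beta>(2)])
      show "W m (act T m n \<theta> d) = act E m n \<theta> (W n d)"
        using shom_act[OF c[OF \<beta>(1)] \<theta> \<beta>(2), symmetric] W[OF \<beta>(1) x'] W[OF \<beta>(1,2)] shom_act[OF w[OF \<beta>(1)] \<theta> \<beta>(2)]
        by (simp add: \<beta>(3))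
    qed
    fix \<beta> n x assume "\<beta> \<in> I" "x \<in> cells (F \<beta>) n"
    then show "(\<lambda>d\<in>cells T n. W n d) (c \<beta> n x) = w \<beta> n x" using W shom_in[OF c] by simp
  qed
qed

text \<open>
  Lifts on the stages \<open>F \<gamma>\<close> are chosen by well-founded recursion, each compatible with the earlier ones: at a
  successor by the lifting property of the step, at a limit by the universal property of the colimit.
\<close>

lemma lifts_transfinite:
  fixes r :: "'i rel"
  assumes r: "Well_order r" and \<beta>0: "\<beta>0 \<in> Field r" and least: "\<forall>\<beta>\<in>Field r. (\<beta>0, \<beta>) \<in> r"
    and chain: "continuous_chain r F t"
    and step: "\<And>\<beta> \<gamma>. imm_succ r \<beta> \<gamma> \<Longrightarrow> lifts (F \<beta>) (F \<gamma>) (t \<beta> \<gamma>) E S p"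
    and col: "is_chain_colimit (Field r) r F t T c"
  shows "lifts (F \<beta>0) T (c \<beta>0) E S p"
  unfolding lifts_def
proof (intro ballI impI)
  fix u v assume u: "u \<in> shom (F \<beta>0) E" and v: "v \<in> shom T S"
    and uv: "\<forall>n. \<forall>x\<in>cells (F \<beta>0) n. p n (u n x) = v n (c \<beta>0 n x)"
  have Fld: "\<beta> \<in> Field r \<and> \<gamma> \<in> Field r" if "(\<beta>, \<gamma>) \<in> r" for \<beta> \<gamma> using that by (auto simp: Field_def)
  have antisym: "\<beta> = \<gamma>" if "(\<beta>, \<gamma>) \<in> r" "(\<gamma>, \<beta>) \<in> r" for \<beta> \<gamma>
    using r that by (auto simp: order_on_defs antisym_def)
  have t: "t \<beta> \<gamma> \<in> shom (F \<beta>) (F \<gamma>)" if "(\<beta>, \<gamma>) \<in> r" for \<beta> \<gamma>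
    using chain that by (auto simp: continuous_chain_def chain_diagram_def)
  have t_id: "t \<beta> \<beta> n x = x" if "\<beta> \<in> Field r" "x \<in> cells (F \<beta>) n" for \<beta> n x
    using chain that by (auto simp: continuous_chain_def chain_diagram_def)
  have tt: "t \<gamma> \<delta> n (t \<beta> \<gamma> n x) = t \<beta> \<delta> n x" if "(\<beta>, \<gamma>) \<in> r" "(\<gamma>, \<delta>) \<in> r" "x \<in> cells (F \<beta>) n" for \<beta> \<gamma> \<delta> n x
  proof -
    have "scomp (F \<beta>) (t \<gamma> \<delta>) (t \<beta> \<gamma>) = t \<beta> \<delta>"
      using chain that by (auto simp: continuous_chain_def chain_diagram_def)
    then show ?thesis using scomp_apply[OF that(3)] by metis
  qed
  have c: "c \<beta> \<in> shom (F \<beta>) T" if "\<beta> \<in> Field r" for \<beta> using col that by (simp add: is_chain_colimit_def)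
  have ct: "c \<gamma> n (t \<beta> \<gamma> n x) = c \<beta> n x" if "(\<beta>, \<gamma>) \<in> r" "x \<in> cells (F \<beta>) n" for \<beta> \<gamma> n x
  proof -
    have "scomp (F \<beta>) (c \<gamma>) (t \<beta> \<gamma>) = c \<beta>" using col that Fld by (simp add: is_chain_colimit_def)
    then show ?thesis using scomp_apply[OF that(2)] by metis
  qed
  define P where "P w \<gamma> w' \<longleftrightarrow> (\<gamma> \<in> Field r \<longrightarrow> w' \<in> shom (F \<gamma>) E \<and> (\<gamma> = \<beta>0 \<longrightarrow> w' = u) \<and>
      (\<forall>n. \<forall>x\<in>cells (F \<gamma>) n. p n (w' n x) = v n (c \<gamma> n x)) \<and>
      (\<forall>\<delta>\<in>underS r \<gamma>. \<forall>n. \<forall>x\<in>cells (F \<delta>) n. w' n (t \<delta> \<gamma> n x) = w \<delta> n x))" for w \<gamma> w'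
  have under: "\<delta> \<in> underS r \<gamma> \<longleftrightarrow> (\<delta>, \<gamma>) \<in> r - Id" for \<delta> \<gamma> by (auto simp: underS_def)
  have "\<exists>w. \<forall>\<gamma>. P w \<gamma> (w \<gamma>)"
  proof (rule dependent_wf_choice[of "r - Id"])
    show "wf (r - Id)" using r by (simp add: well_order_on_def)
    show "P w \<gamma> z = P w' \<gamma> z" if "\<And>\<delta>. (\<delta>, \<gamma>) \<in> r - Id \<Longrightarrow> w \<delta> = w' \<delta>" for w w' \<gamma> z
      using that by (auto simp: P_def under)
  next
    fix \<gamma> w assume IH: "\<And>\<delta>. (\<delta>, \<gamma>) \<in> r - Id \<Longrightarrow> P w \<delta> (w \<delta>)"
    have \<gamma>r: "(\<delta>, \<gamma>) \<in> r" if "\<delta> \<in> underS r \<gamma>" for \<delta> using that by (simp add: underS_def)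
    have IH': "P w \<delta> (w \<delta>)" "\<delta> \<in> Field r" if "\<delta> \<in> underS r \<gamma>" for \<delta>
      using IH that Fld[OF \<gamma>r[OF that]] by (auto simp: under)
    have w: "w \<delta> \<in> shom (F \<delta>) E" and wp: "\<And>n x. x \<in> cells (F \<delta>) n \<Longrightarrow> p n (w \<delta> n x) = v n (c \<delta> n x)"
      if "\<delta> \<in> underS r \<gamma>" for \<delta> using IH'[OF that] unfolding P_def by blast+
    have wt: "w \<beta> n (t \<delta> \<beta> n x) = w \<delta> n x"
      if "\<beta> \<in> underS r \<gamma>" "(\<delta>, \<beta>) \<in> r" "x \<in> cells (F \<delta>) n" for \<beta> \<delta> n x
    proof (cases "\<delta> = \<beta>")
      case True
      then show ?thesis using t_id[of \<beta> x n] IH'(2)[OF that(1)] that(3) by simp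
    next
      case False
      then have "\<delta> \<in> underS r \<beta>" using that(2) by (simp add: underS_def)
      then show ?thesis using IH'[OF that(1)] that(3) unfolding P_def by blast
    qed
    show "\<exists>w'. P w \<gamma> w'"
    proof (cases "\<gamma> \<in> Field r")
      case \<gamma>: True
      consider "\<gamma> = \<beta>0" | \<beta> where "imm_succ r \<beta> \<gamma>" "\<gamma> \<noteq> \<beta>0" | "limit_elem r \<gamma>" "\<gamma> \<noteq> \<beta>0" "underS r \<gamma> \<noteq> {}"
      proof -
        have "\<beta>0 \<in> underS r \<gamma>" if "\<gamma> \<noteq> \<beta>0" using \<gamma> least that by (simp add: underS_def)
        then have "\<gamma> = \<beta>0 \<or> (\<gamma> \<noteq> \<beta>0 \<and> (\<exists>\<beta>. imm_succ r \<beta> \<gamma>)) \<or> (limit_elem r \<gamma> \<and> \<gamma> \<noteq> \<beta>0 \<and> underS r \<gamma> \<noteq> {})"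
          using \<gamma> by (auto simp: limit_elem_def)
        then show ?thesis using that by (elim disjE conjE exE) simp_all
      qed
      then show ?thesis
      proof cases
        case 1
        have "underS r \<beta>0 = {}" using least antisym Fld by (auto simp: underS_def)
        then show ?thesis using u uv 1 by (intro exI[of _ u]) (simp add: P_def)
      next
        case (2 \<beta>)
        then have \<beta>u: "\<beta> \<in> underS r \<gamma>" and \<beta>max: "\<And>\<delta>. \<delta> \<in> underS r \<gamma> \<Longrightarrow> (\<delta>, \<beta>) \<in> r" by (auto simp: imm_succ_def)
        obtain w' where w': "w' \<in> shom (F \<gamma>) E" "\<And>n x. x \<in> cells (F \<beta>) n \<Longrightarrow> w' n (t \<beta> \<gamma> n x) = w \<beta> n x"
          "\<And>n y. y \<in> cells (F \<gamma>) n \<Longrightarrow> p n (w' n y) = scomp (F \<gamma>) v (c \<gamma>) n y"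
          by (rule liftsD[OF step[OF 2(1)] w[OF \<beta>u] scomp_in[OF c[OF \<gamma>] v]])
            (use shom_in[OF t[OF \<gamma>r[OF \<beta>u]]] ct[OF \<gamma>r[OF \<beta>u]] wp[OF \<beta>u] in auto)
        have "w' n (t \<delta> \<gamma> n x) = w \<delta> n x" if \<delta>: "\<delta> \<in> underS r \<gamma>" and x: "x \<in> cells (F \<delta>) n" for \<delta> n x
          using tt[OF \<beta>max[OF \<delta>] \<gamma>r[OF \<beta>u] x] w'(2)[OF shom_in[OF t[OF \<beta>max[OF \<delta>]] x]]
            wt[OF \<beta>u \<beta>max[OF \<delta>] x] by simp
        then show ?thesis using w'(1,3) 2(2) by (intro exI[of _ w']) (simp add: P_def)
      next
        case 3
        then have lim: "is_chain_colimit (underS r \<gamma>) r F t (F \<gamma>) (\<lambda>\<beta>. t \<beta> \<gamma>)"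
          using chain by (simp add: continuous_chain_def)
        obtain w' where w': "w' \<in> shom (F \<gamma>) E"
          "\<And>\<beta> n x. \<beta> \<in> underS r \<gamma> \<Longrightarrow> x \<in> cells (F \<beta>) n \<Longrightarrow> w' n (t \<beta> \<gamma> n x) = w \<beta> n x"
          by (rule chain_colimit_map[OF lim 3(3), of w E]) (use w wt in blast)+
        have "p n (w' n y) = v n (c \<gamma> n y)" if "y \<in> cells (F \<gamma>) n" for n y
        proof -
          obtain \<beta> x where \<beta>: "\<beta> \<in> underS r \<gamma>" "x \<in> cells (F \<beta>) n" "y = t \<beta> \<gamma> n x"
            using lim \<open>y \<in> cells (F \<gamma>) n\<close> unfolding is_chain_colimit_def by blast
          then show ?thesis using w'(2)[OF \<beta>(1,2)] wp[OF \<beta>(1,2)] ct[OF \<gamma>r[OF \<beta>(1)] \<beta>(2)] by simp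
        qed
        then show ?thesis using w' 3(2) by (intro exI[of _ w']) (simp add: P_def)
      qed
    qed (simp add: P_def)
  qed
  then obtain w where P: "\<And>\<gamma>. P w \<gamma> (w \<gamma>)" by blast
  have w: "w \<gamma> \<in> shom (F \<gamma>) E" and wp: "\<And>n x. x \<in> cells (F \<gamma>) n \<Longrightarrow> p n (w \<gamma> n x) = v n (c \<gamma> n x)"
    if "\<gamma> \<in> Field r" for \<gamma> using P[of \<gamma>] that unfolding P_def by blast+
  have wt: "w \<gamma> n (t \<beta> \<gamma> n x) = w \<beta> n x" if "(\<beta>, \<gamma>) \<in> r" "x \<in> cells (F \<beta>) n" for \<beta> \<gamma> n x
  proof (cases "\<beta> = \<gamma>")
    case False
    then have "\<beta> \<in> underS r \<gamma>" using that by (simp add: underS_def)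
    then show ?thesis using P[of \<gamma>] that Fld unfolding P_def by blast
  qed (use t_id that Fld in simp)
  have w0: "w \<beta>0 = u" using P[of \<beta>0] \<beta>0 by (simp add: P_def)
  have "Field r \<noteq> {}" using \<beta>0 by blast
  then obtain W where W: "W \<in> shom T E" "\<And>\<beta> n x. \<beta> \<in> Field r \<Longrightarrow> x \<in> cells (F \<beta>) n \<Longrightarrow> W n (c \<beta> n x) = w \<beta> n x"
    by (rule chain_colimit_map[OF col, of w E]) (simp_all add: w wt)
  have "p n (W n y) = v n y" if y: "y \<in> cells T n" for n y
  proof -
    obtain \<beta> x where \<beta>: "\<beta> \<in> Field r" "x \<in> cells (F \<beta>) n" "y = c \<beta> n x"
      using col y unfolding is_chain_colimit_def by blast
    then show ?thesis using W(2)[OF \<beta>(1,2)] wp[OF \<beta>(1,2)] by simp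
  qed
  then show "\<exists>w\<in>shom T E. (\<forall>n. \<forall>x\<in>cells (F \<beta>0) n. w n (c \<beta>0 n x) = u n x) \<and> (\<forall>n. \<forall>y\<in>cells T n. p n (w n y) = v n y)"
    using W \<beta>0 w0 by (intro bexI[of _ W]) simp_all
qed

lemma inner_anodyne_lifts:
  assumes "inner_anodyne A B f" and p: "inner_fibration E S p"
  shows "lifts A B f E S p"
  using assms(1)
proof (induction rule: inner_anodyne.induct)
  case (inner_horn k n A a B b f)
  then show ?case by (intro lifts_inner_horn[OF p])
next
  case (pushout A B f C D g h k)
  have "p \<in> shom E S" using p by (simp add: inner_fibration_def)
  then show ?case by (rule lifts_pushout[OF pushout.IH pushout.hyps(2)])
next
  case (transfinite_composition r \<beta>0 F t T c)
  then show ?case by (intro lifts_transfinite[of r \<beta>0 F t E S p T c]) simp_all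
next
  case (retract C D g A B f)
  then show ?case by (intro lifts_retract[of C D g E S p A B f])
qed

section \<open>Extension along the pulled back map\<close>

text \<open>
  The pullback square says that a simplex of \<open>X\<close> is a pair of simplices of \<open>A\<close> and \<open>Y\<close> (\<open>pair\<close>). Hence \<open>f1\<close> is a
  section of \<open>sec\<close> over \<open>A\<close>. It extends to a section \<open>s\<close> over \<open>B\<close>, and the value of \<open>s (q y)\<close> at the
  tautological simplex \<open>y\<close> of \<open>(q y)\<^sup>*Y\<close> is the desired value at \<open>y\<close>.
\<close>

lemma extend_along_pullback:
  fixes C :: "'c sset"
  assumes cocart: "cocartesian_fibration Y B q" and pb: "is_pullback X Y A B j p i q" and i: "inner_anodyne A B i"
    and K: "simplicial_set K" and L: "subcomplex K L" and qC: "quasi_category C"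
    and f1: "f1 \<in> shom (sprod X K) C" and f2: "simplicial_on (sprod Y K) (\<lambda>m. cells Y m \<times> L m) C f2"
    and agree: "\<And>m x \<kappa>. x \<in> cells X m \<Longrightarrow> \<kappa> \<in> L m \<Longrightarrow> f1 m (x, \<kappa>) = f2 m (j m x, \<kappa>)"
  obtains g where "g \<in> shom (sprod Y K) C"
    "\<And>m x \<kappa>. x \<in> cells X m \<Longrightarrow> \<kappa> \<in> cells K m \<Longrightarrow> g m (j m x, \<kappa>) = f1 m (x, \<kappa>)"
    "\<And>m y \<kappa>. y \<in> cells Y m \<Longrightarrow> \<kappa> \<in> L m \<Longrightarrow> g m (y, \<kappa>) = f2 m (y, \<kappa>)"
proof -
  have j: "j \<in> shom X Y" and p: "p \<in> shom X A" and i_in: "i \<in> shom A B" and q: "q \<in> shom Y B"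
    and sq: "scomp X q j = scomp X i p"
    and bij: "\<And>n. bij_betw (\<lambda>x. (p n x, j n x)) (cells X n) {(a, y). a \<in> cells A n \<and> y \<in> cells Y n \<and> i n a = q n y}"
    using pb unfolding is_pullback_def by blast+
  have qj: "q n (j n x) = i n (p n x)" if "x \<in> cells X n" for n x by (rule scomp_eqD[OF sq that])
  have X: "simplicial_set X" and A: "simplicial_set A" and CS: "simplicial_set C"
    using j p f1 by (auto dest: shom_ss)
  interpret sections Y B q K L C f2 by unfold_locales (fact q K L CS f2)+
  define pair where "pair n a y = (THE x. x \<in> cells X n \<and> p n x = a \<and> j n x = y)" for n a y
  have pair_eq: "pair n (p n x) (j n x) = x" if x: "x \<in> cells X n" for n x
    unfolding pair_def
    by (rule the_equality) (use x inj_onD[OF bij_betw_imp_inj_on[OF bij[of n]]] in auto)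
  have pair: "pair n a y \<in> cells X n \<and> p n (pair n a y) = a \<and> j n (pair n a y) = y"
    if "a \<in> cells A n" "y \<in> cells Y n" "i n a = q n y" for n a y
  proof -
    have "(a, y) \<in> (\<lambda>x. (p n x, j n x)) ` cells X n" using that bij_betw_imp_surj_on[OF bij[of n]] by blast
    then obtain x where "x \<in> cells X n" "a = p n x" "y = j n x" by blast
    then show ?thesis using pair_eq by simp
  qed
  have pair_act: "pair m (act A m n \<theta> a) (act Y m n \<theta> y) = act X m n \<theta> (pair n a y)"
    if \<theta>: "\<theta> \<in> ord_maps m n" and "a \<in> cells A n" "y \<in> cells Y n" "i n a = q n y" for m n \<theta> a y
  proof -
    note P = pair[OF that(2-4)]
    have "act X m n \<theta> (pair n a y) \<in> cells X m" using act_in[OF X \<theta>] P by blast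
    from pair_eq[OF this] show ?thesis using shom_act[OF p \<theta>, of "pair n a y"] shom_act[OF j \<theta>, of "pair n a y"] P by simp
  qed
  define \<phi> where "\<phi> n a = (\<lambda>l. \<lambda>z\<in>cells (PK n (i n a)) l.
      f1 l (pair l (act A l n (fst (fst z)) a) (snd (fst z)), snd z))" for n a
  have \<phi>_apply: "\<phi> n a l ((\<theta>, y), \<kappa>) = f1 l (pair l (act A l n \<theta> a) y, \<kappa>)"
    if "(\<theta>, y) \<in> cells (pull Y B q n (i n a)) l" "\<kappa> \<in> cells K l" for n a l \<theta> y \<kappa>
    using that by (simp add: \<phi>_def)
  have over: "act A l n \<theta> a \<in> cells A l \<and> y \<in> cells Y l \<and> i l (act A l n \<theta> a) = q l y"
    if "a \<in> cells A n" "(\<theta>, y) \<in> cells (pull Y B q n (i n a)) l" for n a l \<theta> y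
    using that by (simp add: cells_pull act_in[OF A] shom_act[OF i_in])
  have \<phi>_in: "\<phi> n a \<in> shom (PK n (i n a)) C" if a: "a \<in> cells A n" for n a
    unfolding \<phi>_def
  proof (rule shomI[OF simplicial_sprod[OF pull[OF shom_in[OF i_in a]] K] CS])
    fix l z assume "z \<in> cells (PK n (i n a)) l"
    then obtain \<theta> y \<kappa> where z: "z = ((\<theta>, y), \<kappa>)" "(\<theta>, y) \<in> cells (pull Y B q n (i n a)) l" "\<kappa> \<in> cells K l" by auto
    note o = over[OF a z(2)]
    have cell: "(pair l (act A l n \<theta> a) y, \<kappa>) \<in> cells (sprod X K) l" using pair o z(3) by simp
    show "f1 l (pair l (act A l n (fst (fst z)) a) (snd (fst z)), snd z) \<in> cells C l"
      using shom_in[OF f1 cell] by (simp add: z)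
    fix m \<psi> assume \<psi>: "\<psi> \<in> ord_maps m l"
    have \<theta>: "\<theta> \<in> ord_maps l n" using z by (simp add: cells_pull)
    show "f1 m (pair m (act A m n (fst (fst (act (PK n (i n a)) m l \<psi> z))) a) (snd (fst (act (PK n (i n a)) m l \<psi> z))),
        snd (act (PK n (i n a)) m l \<psi> z)) =
      act C m l \<psi> (f1 l (pair l (act A l n (fst (fst z)) a) (snd (fst z)), snd z))"
      using shom_act[OF f1 \<psi> cell] pair_act[OF \<psi>, of "act A l n \<theta> a" y] o act_act[OF A \<psi> \<theta> a] by (simp add: z)
  qed
  define u where "u = (\<lambda>n. \<lambda>a\<in>cells A n. (i n a, \<phi> n a))"
  have u_cell: "(i n a, \<phi> n a) \<in> cells sec n" if a: "a \<in> cells A n" for n a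
    unfolding cells_sec
  proof (intro conjI allI impI \<phi>_in[OF a] shom_in[OF i_in a])
    fix m \<theta> y \<kappa> assume z: "(\<theta>, y) \<in> cells (pull Y B q n (i n a)) m" "\<kappa> \<in> L m"
    note P = pair[of "act A m n \<theta> a" m y] over[OF a z(1)]
    show "\<phi> n a m ((\<theta>, y), \<kappa>) = f2 m (y, \<kappa>)"
      using \<phi>_apply[OF z(1) subcomplex_cells[OF L z(2)]] agree[OF _ z(2), of "pair m (act A m n \<theta> a) y"] P by simp
  qed
  have u: "u \<in> shom A sec"
    unfolding u_def
  proof (rule shomI[OF A sec u_cell])
    fix m n \<theta> a assume \<theta>: "\<theta> \<in> ord_maps m n" and a: "a \<in> cells A n"
    have i\<theta>: "i m (act A m n \<theta> a) = act B m n \<theta> (i n a)" by (rule shom_act[OF i_in \<theta> a])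
    have a': "act A m n \<theta> a \<in> cells A m" by (rule act_in[OF A \<theta> a])
    have "\<phi> m (act A m n \<theta> a) = restrict_to m (act B m n \<theta> (i n a)) \<theta> (\<phi> n a)"
    proof (rule shom_eqI[OF \<phi>_in[OF a', unfolded i\<theta>] restrict_to_in[OF shom_in[OF i_in a] \<phi>_in[OF a] \<theta>]])
      fix l z assume "z \<in> cells (PK m (act B m n \<theta> (i n a))) l"
      then obtain \<eta> y \<kappa> where z: "z = ((\<eta>, y), \<kappa>)" "(\<eta>, y) \<in> cells (pull Y B q m (act B m n \<theta> (i n a))) l" "\<kappa> \<in> cells K l"
        by auto
      have \<eta>: "\<eta> \<in> ord_maps l m" using z by (simp add: cells_pull)
      show "\<phi> m (act A m n \<theta> a) l z = restrict_to m (act B m n \<theta> (i n a)) \<theta> (\<phi> n a) l z"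
        using z pull_compose[OF \<theta> shom_in[OF i_in a] z(2)]
        by (simp add: \<phi>_apply restrict_to_apply i\<theta> act_act[OF A \<eta> \<theta> a])
    qed
    then show "(i m (act A m n \<theta> a), \<phi> m (act A m n \<theta> a)) = act sec m n \<theta> (i n a, \<phi> n a)" by (simp add: i\<theta>)
  qed auto
  obtain s where s: "s \<in> shom B sec" and si: "\<And>n a. a \<in> cells A n \<Longrightarrow> s n (i n a) = u n a"
    and ps: "\<And>n b. b \<in> cells B n \<Longrightarrow> sec_proj n (s n b) = sid B n b"
    by (rule liftsD[OF inner_anodyne_lifts[OF i sec_inner_fibration[OF cocart qC]] u sid_in[OF B]])
      (use u_cell shom_in[OF i_in] in \<open>auto simp: u_def sec_proj_def\<close>)
  define \<sigma> where "\<sigma> n b = snd (s n b)" for n b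
  have s_eq: "s n b = (b, \<sigma> n b)" if "b \<in> cells B n" for n b
    using ps[OF that] shom_in[OF s that] that by (simp add: sec_proj_def \<sigma>_def prod_eq_iff)
  have \<sigma>: "\<sigma> n b \<in> shom (PK n b) C"
    and \<sigma>L: "\<And>m \<theta> y \<kappa>. (\<theta>, y) \<in> cells (pull Y B q n b) m \<Longrightarrow> \<kappa> \<in> L m \<Longrightarrow> \<sigma> n b m ((\<theta>, y), \<kappa>) = f2 m (y, \<kappa>)"
    if "b \<in> cells B n" for n b
    using shom_in[OF s that] by (auto simp: s_eq[OF that] cells_sec)
  have \<sigma>_act: "\<sigma> m (act B m n \<theta> b) = restrict_to m (act B m n \<theta> b) \<theta> (\<sigma> n b)"
    if \<theta>: "\<theta> \<in> ord_maps m n" and b: "b \<in> cells B n" for m n \<theta> b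
    using shom_act[OF s \<theta> b] unfolding s_eq[OF b] s_eq[OF act_in[OF B \<theta> b]] by simp
  have id_cell: "(ord_id m, y) \<in> cells (pull Y B q m (q m y)) m" if "y \<in> cells Y m" for m y
    using that act_id[OF B shom_in[OF q that]] by (simp add: cells_pull)
  let ?g = "\<lambda>m. \<lambda>z\<in>cells (sprod Y K) m. \<sigma> m (q m (fst z)) m ((ord_id m, fst z), snd z)"
  show ?thesis
  proof
    show "?g \<in> shom (sprod Y K) C"
    proof (rule shomI[OF simplicial_sprod[OF Y K] CS])
      fix n z assume "z \<in> cells (sprod Y K) n"
      then obtain y \<kappa> where z: "z = (y, \<kappa>)" "y \<in> cells Y n" "\<kappa> \<in> cells K n" by auto
      note qy = shom_in[OF q z(2)]
      have cell: "((ord_id n, y), \<kappa>) \<in> cells (PK n (q n y)) n" using id_cell z by simp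
      show "\<sigma> n (q n (fst z)) n ((ord_id n, fst z), snd z) \<in> cells C n"
        using shom_in[OF \<sigma>[OF qy] cell] by (simp add: z)
      fix m \<theta> assume \<theta>: "\<theta> \<in> ord_maps m n"
      have y': "act Y m n \<theta> y \<in> cells Y m" by (rule act_in[OF Y \<theta> z(2)])
      have q\<theta>: "q m (act Y m n \<theta> y) = act B m n \<theta> (q n y)" by (rule shom_act[OF q \<theta> z(2)])
      have "(ord_id m, act Y m n \<theta> y) \<in> cells (pull Y B q m (act B m n \<theta> (q n y))) m"
        using id_cell[OF y'] by (simp add: q\<theta>)
      then have "\<sigma> m (act B m n \<theta> (q n y)) m ((ord_id m, act Y m n \<theta> y), act K m n \<theta> \<kappa>)
          = \<sigma> n (q n y) m ((\<theta>, act Y m n \<theta> y), act K m n \<theta> \<kappa>)"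
        using act_in[OF K \<theta> z(3)] by (simp add: \<sigma>_act[OF \<theta> qy] restrict_to_apply compose_ord_id_right[OF \<theta>])
      also have "\<dots> = act C m n \<theta> (\<sigma> n (q n y) n ((ord_id n, y), \<kappa>))"
        using shom_act[OF \<sigma>[OF qy] \<theta> cell] by (simp add: compose_ord_id_left[OF \<theta>])
      finally show "\<sigma> m (q m (fst (act (sprod Y K) m n \<theta> z))) m
          ((ord_id m, fst (act (sprod Y K) m n \<theta> z)), snd (act (sprod Y K) m n \<theta> z)) =
        act C m n \<theta> (\<sigma> n (q n (fst z)) n ((ord_id n, fst z), snd z))"
        by (simp add: z q\<theta>)
    qed
    fix m x \<kappa> assume x: "x \<in> cells X m" and \<kappa>: "\<kappa> \<in> cells K m"
    have a: "p m x \<in> cells A m" and y: "j m x \<in> cells Y m" using shom_in[OF p x] shom_in[OF j x] by auto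
    have "\<sigma> m (q m (j m x)) = \<phi> m (p m x)" using si[OF a] a by (simp add: \<sigma>_def qj[OF x] u_def)
    moreover have "(ord_id m, j m x) \<in> cells (pull Y B q m (i m (p m x))) m" using id_cell[OF y] qj[OF x] by simp
    ultimately show "?g m (j m x, \<kappa>) = f1 m (x, \<kappa>)"
      using y \<kappa> pair_eq[OF x] act_id[OF A a] by (simp add: \<phi>_apply)
  next
    fix m y \<kappa> assume y: "y \<in> cells Y m" and \<kappa>: "\<kappa> \<in> L m"
    then show "?g m (y, \<kappa>) = f2 m (y, \<kappa>)"
      using \<sigma>L[OF shom_in[OF q y] id_cell[OF y] \<kappa>] subcomplex_cells[OF L \<kappa>] by simp
  qed
qed

section \<open>Simplices with prescribed faces\<close>

text \<open>
  For \<open>J = {..n}\<close> this is the boundary of the simplex, and for \<open>J = {..n} - {k}\<close> a horn.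
\<close>

definition missing_some :: "nat \<Rightarrow> nat set \<Rightarrow> nat \<Rightarrow> (nat \<Rightarrow> nat) set" where
  "missing_some n J r = {\<theta> \<in> ord_maps r n. \<exists>j\<in>J. j \<notin> \<theta> ` {..r}}"

lemma missing_some_subcomplex: "subcomplex (simplex n) (missing_some n J)"
  by (fastforce simp: subcomplex_def missing_some_def ord_maps_compose ord_maps_le image_iff)

lemma horn_missing: "cells (horn n k) = missing_some n ({..n} - {k})"
  by (auto simp: fun_eq_iff horn_simps missing_some_def)

lemma coface_coface:
  assumes "i < j" "j \<le> Suc (Suc n)"
  shows "compose {..n} (coface (Suc n) j) (coface n i) = compose {..n} (coface (Suc n) i) (coface n (j - 1))"
proof (rule ord_maps_eqI)
  show "compose {..n} (coface (Suc n) j) (coface n i) \<in> ord_maps n (Suc (Suc n))"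
    using assms by (intro ord_maps_compose[OF coface_in coface_in]) auto
  show "compose {..n} (coface (Suc n) i) (coface n (j - 1)) \<in> ord_maps n (Suc (Suc n))"
    using assms by (intro ord_maps_compose[OF coface_in coface_in]) auto
qed (use assms in auto)

lemma face_in: "simplicial_set Q \<Longrightarrow> x \<in> cells Q (Suc n) \<Longrightarrow> i \<le> Suc n \<Longrightarrow> face Q n i x \<in> cells Q n"
  unfolding face_def by (rule act_in[OF _ coface_in])

lemma face_face:
  assumes "simplicial_set Q" "x \<in> cells Q (Suc (Suc n))" "i < j" "j \<le> Suc (Suc n)"
  shows "face Q n i (face Q (Suc n) j x) = face Q n (j - 1) (face Q (Suc n) i x)"
  using assms coface_coface[OF assms(3,4)]
    act_act[OF assms(1) coface_in[of i n] coface_in[of j "Suc n"] assms(2)]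
    act_act[OF assms(1) coface_in[of "j - 1" n] coface_in[of i "Suc n"] assms(2)]
  by (simp add: face_def)

text \<open>
  A simplex of the union of faces lies in some face \<open>j\<close>, and the value is read off \<open>z j\<close> there. The compatibility
  is on the common face of two faces, through which a simplex lying in both of them factors.
\<close>

lemma glue_faces:
  assumes Q: "simplicial_set Q" and J: "J \<subseteq> {..Suc N}" and z: "\<And>j. j \<in> J \<Longrightarrow> z j \<in> cells Q N"
    and compat: "\<And>M i j. N = Suc M \<Longrightarrow> i \<in> J \<Longrightarrow> j \<in> J \<Longrightarrow> i < j \<Longrightarrow> face Q M i (z j) = face Q M (j - 1) (z i)"
  obtains l where "simplicial_on (simplex (Suc N)) (missing_some (Suc N) J) Q l"
    "\<And>j. j \<in> J \<Longrightarrow> l N (coface N j) = z j"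
proof -
  define fac where "fac r j \<theta> = (\<lambda>i\<in>{..r}. if \<theta> i < j then \<theta> i else \<theta> i - 1)" for r j and \<theta> :: "nat \<Rightarrow> nat"
  have fac: "fac r j \<theta> \<in> ord_maps r N" "compose {..r} (coface N j) (fac r j \<theta>) = \<theta>"
    if \<theta>: "\<theta> \<in> ord_maps r (Suc N)" and j: "j \<le> Suc N" "j \<notin> \<theta> ` {..r}" for r j \<theta>
  proof -
    obtain \<theta>' where \<theta>': "\<theta>' \<in> ord_maps r N" "\<theta> = compose {..r} (coface N j) \<theta>'"
      using factor_coface[OF \<theta> j] .
    have "fac r j \<theta> = \<theta>'"
      by (rule extensionalityI[of _ "{..r}"])
        (use \<theta>' ord_maps_le[OF \<theta>'(1)] in \<open>auto simp: fac_def ord_maps_def PiE_def\<close>)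
    then show "fac r j \<theta> \<in> ord_maps r N" "compose {..r} (coface N j) (fac r j \<theta>) = \<theta>" using \<theta>' by simp_all
  qed
  have indep: "act Q r N (fac r j \<theta>) (z j) = act Q r N (fac r i \<theta>) (z i)"
    if \<theta>: "\<theta> \<in> ord_maps r (Suc N)" and i: "i \<in> J" "i \<notin> \<theta> ` {..r}" and j: "j \<in> J" "j \<notin> \<theta> ` {..r}" and ij: "i < j"
    for r i j \<theta>
  proof -
    have le: "i \<le> Suc N" "j \<le> Suc N" using i j J by auto
    have "N \<noteq> 0"
    proof
      assume "N = 0"
      then have "{\<theta> 0, i, j} \<subseteq> {0, 1}" using le ord_maps_le[OF \<theta>, of 0] by (auto simp: le_Suc_eq One_nat_def)
      moreover have "\<theta> 0 \<noteq> i" "\<theta> 0 \<noteq> j" using i(2) j(2) by auto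
      ultimately show False using ij by auto
    qed
    then obtain M where N: "N = Suc M" by (cases N) auto
    have ne: "\<theta> a \<noteq> i" "\<theta> a \<noteq> j" if "a \<le> r" for a using i j that by auto
    note fj = fac[OF \<theta> le(2) j(2)] and fi = fac[OF \<theta> le(1) i(2)]
    have "i \<notin> fac r j \<theta> ` {..r}" using ij by (auto simp: fac_def ne dest: ne split: if_splits)
    then obtain \<psi> where \<psi>: "\<psi> \<in> ord_maps r M" "fac r j \<theta> = compose {..r} (coface M i) \<psi>"
      using factor_coface[OF fj(1)[unfolded N], of i] ij le N by auto
    have cf: "coface M i \<in> ord_maps M N" "coface M (j - 1) \<in> ord_maps M N"
      unfolding N using ij le N by (auto intro!: coface_in)
    have "fac r i \<theta> = compose {..r} (coface M (j - 1)) \<psi>"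
    proof (rule ord_maps_eqI[OF fi(1) ord_maps_compose[OF cf(2) \<psi>(1)]])
      fix a assume a: "a \<le> r"
      have \<psi>a: "\<psi> a \<le> M" using ord_maps_le[OF \<psi>(1) a] .
      have "\<theta> a = compose {..r} (coface N j) (fac r j \<theta>) a" by (simp add: fj(2))
      then have "\<theta> a = coface N j (coface M i (\<psi> a))" using a \<psi>(2) by simp
      also have "\<dots> = coface N i (coface M (j - 1) (\<psi> a))"
        using fun_cong[OF coface_coface[OF ij, of M], of "\<psi> a"] \<psi>a le N by simp
      finally have \<theta>a: "\<theta> a = coface N i (coface M (j - 1) (\<psi> a))" .
      have "coface M (j - 1) (\<psi> a) \<le> N" using ord_maps_le[OF cf(2) \<psi>a] .
      then have "fac r i \<theta> a = coface M (j - 1) (\<psi> a)"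
        using a unfolding fac_def by (simp add: \<theta>a del: coface_le) (simp add: coface_def[of N])
      then show "fac r i \<theta> a = compose {..r} (coface M (j - 1)) \<psi> a" using a by simp
    qed
    then show ?thesis
      using act_act[OF Q \<psi>(1) cf(1) z[OF j(1)]] act_act[OF Q \<psi>(1) cf(2) z[OF i(1)]] compat[OF N i(1) j(1) ij] \<psi>(2) N
      by (simp add: face_def)
  qed
  define l where "l r \<theta> = (let j = SOME j. j \<in> J \<and> j \<notin> \<theta> ` {..r} in act Q r N (fac r j \<theta>) (z j))" for r \<theta>
  have l: "l r \<theta> = act Q r N (fac r j \<theta>) (z j)"
    if \<theta>: "\<theta> \<in> ord_maps r (Suc N)" and j: "j \<in> J" "j \<notin> \<theta> ` {..r}" for r \<theta> j
  proof -
    define i where "i = (SOME j. j \<in> J \<and> j \<notin> \<theta> ` {..r})"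
    have i: "i \<in> J" "i \<notin> \<theta> ` {..r}"
      unfolding i_def using someI[of "\<lambda>j. j \<in> J \<and> j \<notin> \<theta> ` {..r}" j] j by auto
    have "act Q r N (fac r i \<theta>) (z i) = act Q r N (fac r j \<theta>) (z j)"
      using indep[OF \<theta> i j] indep[OF \<theta> j i] by (cases i j rule: linorder_cases) auto
    then show ?thesis by (simp add: l_def i_def Let_def)
  qed
  show ?thesis
  proof
    show "simplicial_on (simplex (Suc N)) (missing_some (Suc N) J) Q l"
      unfolding simplicial_on_def
    proof (intro conjI allI impI)
      fix n \<theta> assume "\<theta> \<in> missing_some (Suc N) J n"
      then obtain j where j: "\<theta> \<in> ord_maps n (Suc N)" "j \<in> J" "j \<notin> \<theta> ` {..n}" "j \<le> Suc N"
        using J by (auto simp: missing_some_def)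
      show "l n \<theta> \<in> cells Q n" using act_in[OF Q fac(1)[OF j(1,4,3)] z[OF j(2)]] l[OF j(1-3)] by simp
    next
      fix m n \<phi> \<theta> assume \<phi>: "\<phi> \<in> ord_maps m n" and "\<theta> \<in> missing_some (Suc N) J n"
      then obtain j where j: "\<theta> \<in> ord_maps n (Suc N)" "j \<in> J" "j \<notin> \<theta> ` {..n}" "j \<le> Suc N"
        using J by (auto simp: missing_some_def)
      have c: "compose {..m} \<theta> \<phi> \<in> ord_maps m (Suc N)" by (rule ord_maps_compose[OF j(1) \<phi>])
      have jc: "j \<notin> compose {..m} \<theta> \<phi> ` {..m}" using j(3) ord_maps_le[OF \<phi>] by auto
      have "fac m j (compose {..m} \<theta> \<phi>) = compose {..m} (fac n j \<theta>) \<phi>"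
        by (rule ord_maps_eqI[OF fac(1)[OF c j(4) jc] ord_maps_compose[OF fac(1)[OF j(1,4,3)] \<phi>]])
          (simp add: fac_def ord_maps_le[OF \<phi>])
      then show "l m (act (simplex (Suc N)) m n \<phi> \<theta>) = act Q m n \<phi> (l n \<theta>)"
        using l[OF j(1-3)] l[OF c j(2) jc] act_act[OF Q \<phi> fac(1)[OF j(1,4,3)] z[OF j(2)]] by simp
    qed
  next
    fix j assume j: "j \<in> J"
    then have le: "j \<le> Suc N" using J by auto
    have nj: "j \<notin> coface N j ` {..N}" by (auto split: if_splits)
    have "fac N j (coface N j) = ord_id N"
      by (rule ord_maps_eqI[OF fac(1)[OF coface_in[OF le] le nj] ord_id_in]) (auto simp: fac_def)
    then show "l N (coface N j) = z j" using l[OF coface_in[OF le] j nj] act_id[OF Q z[OF j]] by simp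
  qed
qed

lemma fill_inner_faces:
  assumes Q: "quasi_category Q" and k: "0 < k" "k \<le> N" and z: "\<And>j. j \<le> Suc N \<Longrightarrow> j \<noteq> k \<Longrightarrow> z j \<in> cells Q N"
    and compat: "\<And>M i j. N = Suc M \<Longrightarrow> i < j \<Longrightarrow> j \<le> Suc N \<Longrightarrow> i \<noteq> k \<Longrightarrow> j \<noteq> k \<Longrightarrow>
      face Q M i (z j) = face Q M (j - 1) (z i)"
  obtains x where "x \<in> cells Q (Suc N)" "\<And>j. j \<le> Suc N \<Longrightarrow> j \<noteq> k \<Longrightarrow> face Q N j x = z j"
proof -
  have QS: "simplicial_set Q" using Q by (simp add: quasi_category_def)
  obtain l where l: "simplicial_on (simplex (Suc N)) (missing_some (Suc N) ({..Suc N} - {k})) Q l"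
    and lz: "\<And>j. j \<in> {..Suc N} - {k} \<Longrightarrow> l N (coface N j) = z j"
    by (rule glue_faces[OF QS, of "{..Suc N} - {k}" N z]) (use z compat in auto)
  define u where "u = (\<lambda>m. \<lambda>\<theta>\<in>cells (horn (Suc N) k) m. l m \<theta>)"
  have u: "u \<in> shom (horn (Suc N) k) Q"
    unfolding u_def
    using simplicial_on_in[OF l] simplicial_on_act[OF l]
    by (intro shomI[OF simplicial_horn QS]) (auto simp: horn_missing)
  obtain h where h: "h \<in> shom (simplex (Suc N)) Q" "\<And>m \<theta>. \<theta> \<in> cells (horn (Suc N) k) m \<Longrightarrow> h m \<theta> = u m \<theta>"
    using quasi_category_filler[OF Q k(1) _ u] k(2) by auto
  show ?thesis
  proof
    show x: "h (Suc N) (ord_id (Suc N)) \<in> cells Q (Suc N)" using shom_in[OF h(1)] by simp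
    fix j assume j: "j \<le> Suc N" "j \<noteq> k"
    have cf: "coface N j \<in> cells (horn (Suc N) k) N"
      using j coface_in[OF j(1)] by (auto simp: horn_simps intro!: exI[of _ j] split: if_splits)
    show "face Q N j (h (Suc N) (ord_id (Suc N))) = z j"
      using shom_act[OF h(1) coface_in[OF j(1)], of "ord_id (Suc N)"] compose_ord_id_left[OF coface_in[OF j(1)]]
        h(2)[OF cf] cf lz[of j] j
      by (simp add: face_def u_def)
  qed
qed

section \<open>Equivalences in a quasi-category\<close>

lemma source_face: "source Q e = face Q 0 1 e" and target_face: "target Q e = face Q 0 0 e"
proof -
  have "coface 0 1 = vertex 0" "coface 0 0 = vertex 1" by (auto simp: coface_def vertex_def fun_eq_iff One_nat_def)
  then show "source Q e = face Q 0 1 e" "target Q e = face Q 0 0 e"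
    by (simp_all add: source_def target_def face_def One_nat_def)
qed

lemma composite_ends:
  assumes Q: "simplicial_set Q" and c: "composite Q e f g"
  shows "e \<in> cells Q 1" "f \<in> cells Q 1" "g \<in> cells Q 1"
    "target Q e = source Q f" "source Q g = source Q e" "target Q g = target Q f"
proof -
  obtain s where s: "s \<in> cells Q (Suc 1)" "face Q 1 2 s = e" "face Q 1 0 s = f" "face Q 1 1 s = g"
    using c unfolding composite_def by auto
  show "e \<in> cells Q 1" "f \<in> cells Q 1" "g \<in> cells Q 1" using s face_in[OF Q s(1)] by auto
  have s2: "s \<in> cells Q (Suc (Suc 0))" using s(1) by (simp add: One_nat_def)
  have "face Q 0 0 (face Q 1 2 s) = face Q 0 1 (face Q 1 0 s)"
    "face Q 0 1 (face Q 1 2 s) = face Q 0 1 (face Q 1 1 s)"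
    "face Q 0 0 (face Q 1 1 s) = face Q 0 0 (face Q 1 0 s)"
    using face_face[OF Q s2, of 0 2] face_face[OF Q s2, of 1 2] face_face[OF Q s2, of 0 1]
    by (simp_all add: One_nat_def)
  then show "target Q e = source Q f" "source Q g = source Q e" "target Q g = target Q f"
    by (simp_all add: source_face target_face s)
qed

lemma composite_exists:
  assumes Q: "quasi_category Q" and e: "e \<in> cells Q 1" and f: "f \<in> cells Q 1" and ef: "target Q e = source Q f"
  obtains g where "composite Q e f g"
proof -
  have QS: "simplicial_set Q" using Q by (simp add: quasi_category_def)
  define z where "z j = (if j = (0::nat) then f else e)" for j
  have zc: "z j \<in> cells Q 1" for j by (simp add: z_def e f)
  have compat: "face Q M i (z j) = face Q M (j - 1) (z i)"
    if "1 = Suc M" "i < j" "j \<le> Suc 1" "i \<noteq> 1" "j \<noteq> 1" for M i j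
  proof -
    have "M = 0" "i = 0" "j = 2" using that by auto
    then show ?thesis using ef by (simp add: z_def source_face target_face One_nat_def)
  qed
  obtain x where x: "x \<in> cells Q (Suc 1)" "\<And>j. j \<le> Suc 1 \<Longrightarrow> j \<noteq> 1 \<Longrightarrow> face Q 1 j x = z j"
    by (rule fill_inner_faces[OF Q _ _ zc compat, of 1]) auto
  have "composite Q e f (face Q 1 1 x)"
    unfolding composite_def using x(1) x(2)[of 2] x(2)[of 0] by (intro bexI[of _ x]) (auto simp: z_def)
  then show ?thesis by (rule that)
qed

text \<open>
  In a tetrahedron with spine \<open>a\<close>, \<open>b\<close>, \<open>c\<close>, the faces other than the one opposite to a middle vertex form an inner
  horn, so three given triangles can be completed to it.
\<close>

lemma composite_assoc:
  assumes Q: "quasi_category Q" and ab: "composite Q a b ab" and bc: "composite Q b c bc"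
  shows composite_assoc_right: "composite Q ab c d \<Longrightarrow> composite Q a bc d"
    and composite_assoc_left: "composite Q a bc d \<Longrightarrow> composite Q ab c d"
proof -
  have QS: "simplicial_set Q" using Q by (simp add: quasi_category_def)
  have Suc2: "Suc (Suc 1) = 3" "Suc 2 = 3" by auto
  \<comment> \<open>the faces 0 and 3 are the given triangles on b, c and on a, b; k is the number of the missing face\<close>
  have tetra: "\<exists>x\<in>cells Q (Suc 2). \<forall>j\<le>3. j \<noteq> k \<longrightarrow> face Q 2 j x = z j"
    if k: "0 < k" "k \<le> 2" and z: "\<And>j. j \<le> 3 \<Longrightarrow> j \<noteq> k \<Longrightarrow> z j \<in> cells Q 2"
      and compat: "\<And>i j. i < j \<Longrightarrow> j \<le> 3 \<Longrightarrow> i \<noteq> k \<Longrightarrow> j \<noteq> k \<Longrightarrow> face Q 1 i (z j) = face Q 1 (j - 1) (z i)" for k z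
  proof -
    have c: "face Q M i (z j) = face Q M (j - 1) (z i)"
      if "2 = Suc M" "i < j" "j \<le> Suc 2" "i \<noteq> k" "j \<noteq> k" for M i j
    proof -
      have "M = 1" using that by auto
      then show ?thesis using compat that by auto
    qed
    obtain x where "x \<in> cells Q (Suc 2)" "\<And>j. j \<le> Suc 2 \<Longrightarrow> j \<noteq> k \<Longrightarrow> face Q 2 j x = z j"
      by (rule fill_inner_faces[OF Q k, of z]) (use z c Suc2 in auto)
    then show ?thesis by auto
  qed
  have ff: "face Q 1 i (face Q 2 j x) = face Q 1 (j - 1) (face Q 2 i x)"
    if "x \<in> cells Q (Suc 2)" "i < j" "j \<le> 3" for x i j
    using face_face[OF QS, of x 1 i j] that Suc2 by simp
  obtain s3 where s3: "s3 \<in> cells Q 2" "face Q 1 2 s3 = a" "face Q 1 0 s3 = b" "face Q 1 1 s3 = ab"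
    using ab unfolding composite_def by blast
  obtain s0 where s0: "s0 \<in> cells Q 2" "face Q 1 2 s0 = b" "face Q 1 0 s0 = c" "face Q 1 1 s0 = bc"
    using bc unfolding composite_def by blast
  have le3: "j = 0 \<or> j = 1 \<or> j = 2 \<or> j = 3" if "j \<le> 3" for j :: nat using that by arith
  have x_in: "face Q 2 j x \<in> cells Q 2" if "x \<in> cells Q (Suc 2)" "j \<le> 3" for x j
    using face_in[OF QS that(1), of j] that by simp
  show "composite Q a bc d" if cd: "composite Q ab c d"
  proof -
    obtain s1 where s1: "s1 \<in> cells Q 2" "face Q 1 2 s1 = ab" "face Q 1 0 s1 = c" "face Q 1 1 s1 = d"
      using cd unfolding composite_def by blast
    define z where "z j = (if j = 0 then s0 else if j = 1 then s1 else s3)" for j :: nat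
    have "\<exists>x\<in>cells Q (Suc 2). \<forall>j\<le>3. j \<noteq> 2 \<longrightarrow> face Q 2 j x = z j"
    proof (rule tetra)
      fix i j :: nat assume "i < j" "j \<le> 3" "i \<noteq> 2" "j \<noteq> 2"
      then have "i = 0 \<and> j = 1 \<or> i = 0 \<and> j = 3 \<or> i = 1 \<and> j = 3" using le3[of j] by auto
      then show "face Q 1 i (z j) = face Q 1 (j - 1) (z i)"
        by (elim disjE conjE) (use s0 s1 s3 in \<open>simp_all add: z_def One_nat_def\<close>)
    qed (use s0 s1 s3 in \<open>auto simp: z_def\<close>)
    then obtain x where x: "x \<in> cells Q (Suc 2)" "face Q 2 0 x = s0" "face Q 2 1 x = s1" "face Q 2 3 x = s3"
      by (auto simp: z_def)
    have "face Q 1 2 (face Q 2 2 x) = a" "face Q 1 0 (face Q 2 2 x) = bc" "face Q 1 1 (face Q 2 2 x) = d"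
      using ff[OF x(1), of 2 3] ff[OF x(1), of 0 2] ff[OF x(1), of 1 2] x s0 s1 s3 by (simp_all add: One_nat_def)
    then show ?thesis unfolding composite_def using x_in[OF x(1), of 2] by auto
  qed
  show "composite Q ab c d" if cd: "composite Q a bc d"
  proof -
    obtain s2 where s2: "s2 \<in> cells Q 2" "face Q 1 2 s2 = a" "face Q 1 0 s2 = bc" "face Q 1 1 s2 = d"
      using cd unfolding composite_def by blast
    define z where "z j = (if j = 0 then s0 else if j = 2 then s2 else s3)" for j :: nat
    have "\<exists>x\<in>cells Q (Suc 2). \<forall>j\<le>3. j \<noteq> 1 \<longrightarrow> face Q 2 j x = z j"
    proof (rule tetra)
      fix i j :: nat assume "i < j" "j \<le> 3" "i \<noteq> 1" "j \<noteq> 1"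
      then have "i = 0 \<and> j = 2 \<or> i = 0 \<and> j = 3 \<or> i = 2 \<and> j = 3" using le3[of j] le3[of i] by auto
      then show "face Q 1 i (z j) = face Q 1 (j - 1) (z i)"
        by (elim disjE conjE) (use s0 s2 s3 in \<open>simp_all add: z_def One_nat_def\<close>)
    qed (use s0 s2 s3 in \<open>auto simp: z_def\<close>)
    then obtain x where x: "x \<in> cells Q (Suc 2)" "face Q 2 0 x = s0" "face Q 2 2 x = s2" "face Q 2 3 x = s3"
      by (auto simp: z_def)
    have "face Q 1 2 (face Q 2 1 x) = ab" "face Q 1 0 (face Q 2 1 x) = c" "face Q 1 1 (face Q 2 1 x) = d"
      using ff[OF x(1), of 1 3] ff[OF x(1), of 0 1] ff[OF x(1), of 1 2] x s0 s2 s3 by (simp_all add: One_nat_def)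
    then show ?thesis unfolding composite_def using x_in[OF x(1), of 1] by auto
  qed
qed

lemma degenerate_map: "(\<lambda>_\<in>{..1}. 0) \<in> ord_maps 1 0"
  by (rule ord_mapsI) auto

lemma degenerate_edge_in: "simplicial_set Q \<Longrightarrow> x \<in> cells Q 0 \<Longrightarrow> degenerate_edge Q x \<in> cells Q 1"
  unfolding degenerate_edge_def by (rule act_in[OF _ degenerate_map])

lemma degenerate_edge_ends:
  assumes Q: "simplicial_set Q" and x: "x \<in> cells Q 0"
  shows "source Q (degenerate_edge Q x) = x" "target Q (degenerate_edge Q x) = x"
proof -
  have "compose {..0} (\<lambda>_\<in>{..1}. 0) (vertex i) = ord_id 0" if "i \<le> 1" for i
    by (rule ord_maps_eqI[OF ord_maps_compose[OF degenerate_map vertex_in[OF that]] ord_id_in])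
      (use that in \<open>simp add: compose_def\<close>)
  then show "source Q (degenerate_edge Q x) = x" "target Q (degenerate_edge Q x) = x"
    using act_act[OF Q vertex_in degenerate_map x] act_id[OF Q x]
    by (simp_all add: source_def target_def degenerate_edge_def)
qed

lemma composite_degenerate_left:
  assumes Q: "simplicial_set Q" and e: "e \<in> cells Q 1"
  shows "composite Q (degenerate_edge Q (source Q e)) e e"
proof -
  have cg: "codegeneracy 1 0 \<in> ord_maps (Suc 1) 1" by (rule codegeneracy_in) simp
  let ?s = "act Q 2 1 (codegeneracy 1 0) e"
  have s: "?s \<in> cells Q 2" using act_in[OF Q cg e] by simp
  have f: "face Q 1 j ?s = act Q 1 1 (compose {..1} (codegeneracy 1 0) (coface 1 j)) e" if "j \<le> Suc 1" for j
    using act_act[OF Q coface_in[OF that] cg e] by (simp add: face_def)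
  have "compose {..1} (codegeneracy 1 0) (coface 1 j) = ord_id 1" if "j \<le> 1" for j
  proof (rule ord_maps_eqI[OF ord_maps_compose[OF cg coface_in] ord_id_in])
    fix i :: nat assume i: "i \<le> 1"
    have "j = 0 \<or> j = 1" "i = 0 \<or> i = 1" using that i by auto
    then show "compose {..1} (codegeneracy 1 0) (coface 1 j) i = ord_id 1 i" by auto
  qed (use that in simp)
  then have "face Q 1 0 ?s = e" "face Q 1 1 ?s = e" using f act_id[OF Q e] by auto
  moreover have "compose {..1} (codegeneracy 1 0) (coface 1 2) = compose {..1} (vertex 0) (\<lambda>_\<in>{..1}. 0)"
  proof (rule ord_maps_eqI[OF ord_maps_compose[OF cg coface_in] ord_maps_compose[OF vertex_in degenerate_map]])
    fix i :: nat assume i: "i \<le> 1"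
    have "i = 0 \<or> i = 1" using i by auto
    then show "compose {..1} (codegeneracy 1 0) (coface 1 2) i = compose {..1} (vertex 0) (\<lambda>_\<in>{..1}. 0) i" by auto
  qed auto
  then have "face Q 1 2 ?s = degenerate_edge Q (source Q e)"
    using f[of 2] act_act[OF Q degenerate_map vertex_in e, of 0] by (simp add: degenerate_edge_def source_def)
  ultimately show ?thesis unfolding composite_def using s by blast
qed

text \<open>
  With composition written in diagrammatic order, \<open>f g' = f (f' e') = (f f') e' = e'\<close>, and therefore
  \<open>g g' = (e f) g' = e (f g') = e e'\<close> is an identity.
\<close>

lemma composite_inverse:
  assumes Q: "quasi_category Q" and e: "composite Q e e' (degenerate_edge Q (source Q e))"
    and f: "composite Q f f' (degenerate_edge Q (source Q f))"
    and g: "composite Q e f g" and g': "composite Q f' e' g'"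
  shows "composite Q g g' (degenerate_edge Q (source Q g))"
proof -
  have QS: "simplicial_set Q" using Q by (simp add: quasi_category_def)
  have "source Q f = source Q e'"
    using composite_ends(4)[OF QS g] composite_ends(4)[OF QS e] by simp
  then have "composite Q (degenerate_edge Q (source Q f)) e' e'"
    using composite_degenerate_left[OF QS composite_ends(2)[OF QS e]] by simp
  then have "composite Q f g' e'" by (rule composite_assoc_right[OF Q f g'])
  from composite_assoc_left[OF Q g this e] show ?thesis using composite_ends(5)[OF QS g] by simp
qed

lemma equivalence_edge_composite:
  assumes Q: "quasi_category Q" and e: "equivalence_edge Q e" and f: "equivalence_edge Q f"
    and ef: "target Q e = source Q f"
  obtains g where "equivalence_edge Q g" "source Q g = source Q e" "target Q g = target Q f"
proof -
  have QS: "simplicial_set Q" using Q by (simp add: quasi_category_def)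
  have e1: "e \<in> cells Q 1" and f1: "f \<in> cells Q 1" using e f by (auto simp: equivalence_edge_def)
  obtain e' where e': "e' \<in> cells Q 1" "composite Q e e' (degenerate_edge Q (source Q e))"
    "composite Q e' e (degenerate_edge Q (target Q e))" using e unfolding equivalence_edge_def by blast
  obtain f' where f': "f' \<in> cells Q 1" "composite Q f f' (degenerate_edge Q (source Q f))"
    "composite Q f' f (degenerate_edge Q (target Q f))" using f unfolding equivalence_edge_def by blast
  have ends: "source Q e' = target Q e" "target Q f' = source Q f" "source Q f' = target Q f"
    using composite_ends(4)[OF QS e'(2)] composite_ends(4)[OF QS f'(3)] composite_ends(4)[OF QS f'(2)] by simp_all
  obtain g where g: "composite Q e f g" using composite_exists[OF Q e1 f1 ef] .
  obtain g' where g': "composite Q f' e' g'"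
    using composite_exists[OF Q f'(1) e'(1)] ends ef by auto
  have "composite Q g g' (degenerate_edge Q (source Q g))"
    by (rule composite_inverse[OF Q e'(2) f'(2) g g'])
  moreover have "composite Q g' g (degenerate_edge Q (source Q g'))"
    by (rule composite_inverse[OF Q _ _ g' g]) (use e'(3) f'(3) ends in simp_all)
  moreover have "source Q g' = target Q g"
    using composite_ends(5)[OF QS g'] composite_ends(6)[OF QS g] ends by simp
  ultimately have "equivalence_edge Q g"
    using composite_ends(3)[OF QS g] composite_ends(3)[OF QS g'] unfolding equivalence_edge_def by auto
  then show ?thesis using that composite_ends(5,6)[OF QS g] by simp
qed

lemma equiv_objects_equiv:
  assumes Q: "quasi_category Q"
  shows "equiv (cells Q 0) (equiv_objects Q)"
proof (rule equivI)
  have QS: "simplicial_set Q" using Q by (simp add: quasi_category_def)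
  show "equiv_objects Q \<subseteq> cells Q 0 \<times> cells Q 0" by (auto simp: equiv_objects_def)
  show "refl_on (cells Q 0) (equiv_objects Q)"
  proof (rule refl_onI)
    fix x assume x: "x \<in> cells Q 0"
    let ?d = "degenerate_edge Q x"
    have "composite Q (degenerate_edge Q (source Q ?d)) ?d ?d"
      by (rule composite_degenerate_left[OF QS degenerate_edge_in[OF QS x]])
    then have "equivalence_edge Q ?d"
      using degenerate_edge_in[OF QS x] degenerate_edge_ends[OF QS x] by (auto simp: equivalence_edge_def)
    then show "(x, x) \<in> equiv_objects Q" using x degenerate_edge_ends[OF QS x] by (auto simp: equiv_objects_def)
  qed
  show "sym (equiv_objects Q)"
  proof (rule symI)
    fix x y assume "(x, y) \<in> equiv_objects Q"
    then obtain e where xy: "x \<in> cells Q 0" "y \<in> cells Q 0" and e: "equivalence_edge Q e" "source Q e = x" "target Q e = y"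
      by (auto simp: equiv_objects_def)
    obtain e' where e': "e' \<in> cells Q 1" "composite Q e e' (degenerate_edge Q (source Q e))"
      "composite Q e' e (degenerate_edge Q (target Q e))" using e unfolding equivalence_edge_def by blast
    have "source Q e' = y" "target Q e' = x"
      using composite_ends(4)[OF QS e'(2)] composite_ends(4)[OF QS e'(3)] e by simp_all
    moreover have "equivalence_edge Q e'"
      using e e' calculation unfolding equivalence_edge_def by auto
    ultimately show "(y, x) \<in> equiv_objects Q" using xy by (auto simp: equiv_objects_def)
  qed
  show "trans (equiv_objects Q)"
  proof (rule transI)
    fix x y z assume "(x, y) \<in> equiv_objects Q" "(y, z) \<in> equiv_objects Q"
    then obtain e f where xz: "x \<in> cells Q 0" "z \<in> cells Q 0"
      and e: "equivalence_edge Q e" "source Q e = x" "target Q e = y"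
      and f: "equivalence_edge Q f" "source Q f = y" "target Q f = z"
      by (auto simp: equiv_objects_def)
    obtain g where "equivalence_edge Q g" "source Q g = source Q e" "target Q g = target Q f"
      by (rule equivalence_edge_composite[OF Q e(1) f(1)]) (use e f in auto)
    with xz e f show "(x, z) \<in> equiv_objects Q" by (auto simp: equiv_objects_def)
  qed
qed

lemma shom_source: "F \<in> shom Q Q' \<Longrightarrow> e \<in> cells Q 1 \<Longrightarrow> F 0 (source Q e) = source Q' (F 1 e)"
  and shom_target: "F \<in> shom Q Q' \<Longrightarrow> e \<in> cells Q 1 \<Longrightarrow> F 0 (target Q e) = target Q' (F 1 e)"
  and shom_degenerate: "F \<in> shom Q Q' \<Longrightarrow> x \<in> cells Q 0 \<Longrightarrow> F 1 (degenerate_edge Q x) = degenerate_edge Q' (F 0 x)"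
  and shom_face: "F \<in> shom Q Q' \<Longrightarrow> s \<in> cells Q (Suc n) \<Longrightarrow> i \<le> Suc n \<Longrightarrow> F n (face Q n i s) = face Q' n i (F (Suc n) s)"
  unfolding source_def target_def degenerate_edge_def face_def
  by (auto simp: shom_act vertex_in degenerate_map coface_in)

lemma source_in: "simplicial_set Q \<Longrightarrow> e \<in> cells Q 1 \<Longrightarrow> source Q e \<in> cells Q 0"
  and target_in: "simplicial_set Q \<Longrightarrow> e \<in> cells Q 1 \<Longrightarrow> target Q e \<in> cells Q 0"
  unfolding source_def target_def by (auto intro!: act_in vertex_in)

lemma shom_composite:
  assumes F: "F \<in> shom Q Q'" and c: "composite Q e f g"
  shows "composite Q' (F 1 e) (F 1 f) (F 1 g)"
proof -
  obtain s where s: "s \<in> cells Q 2" "face Q 1 2 s = e" "face Q 1 0 s = f" "face Q 1 1 s = g"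
    using c unfolding composite_def by blast
  then show ?thesis
    unfolding composite_def using shom_in[OF F s(1)] shom_face[OF F, of s 1]
    by (intro bexI[of _ "F 2 s"]) auto
qed

lemma shom_equiv_objects:
  assumes F: "F \<in> shom Q Q'" and xy: "(x, y) \<in> equiv_objects Q"
  shows "(F 0 x, F 0 y) \<in> equiv_objects Q'"
proof -
  have QS: "simplicial_set Q" using F by (rule shom_ss)
  obtain e where x: "x \<in> cells Q 0" "y \<in> cells Q 0" and e: "equivalence_edge Q e" "source Q e = x" "target Q e = y"
    using xy by (auto simp: equiv_objects_def)
  obtain e' where e': "e' \<in> cells Q 1" "composite Q e e' (degenerate_edge Q (source Q e))"
    "composite Q e' e (degenerate_edge Q (target Q e))" using e unfolding equivalence_edge_def by blast
  have e1: "e \<in> cells Q 1" using e by (simp add: equivalence_edge_def)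
  have "equivalence_edge Q' (F 1 e)"
    unfolding equivalence_edge_def
    using shom_composite[OF F e'(2)] shom_composite[OF F e'(3)] shom_in[OF F e1] shom_in[OF F e'(1)]
      shom_degenerate[OF F source_in[OF QS e1]] shom_degenerate[OF F target_in[OF QS e1]]
      shom_source[OF F e1] shom_target[OF F e1] by auto
  moreover have "source Q' (F 1 e) = F 0 x" "target Q' (F 1 e) = F 0 y"
    using shom_source[OF F e1] shom_target[OF F e1] e by simp_all
  ultimately show ?thesis
    using shom_in[OF F x(1)] shom_in[OF F x(2)] by (auto simp: equiv_objects_def)
qed

text \<open>
  Lifting objects gives surjectivity on isomorphism classes. For injectivity, lift an equivalence
  and an inverse as edges, and then lift the two triangles which witness that they are inverse.
\<close>

lemma iso_classes_bij:
  assumes Q: "quasi_category Q" and Q': "quasi_category Q'" and F: "F \<in> shom Q Q'"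
    and lift0: "\<And>x. x \<in> cells Q' 0 \<Longrightarrow> \<exists>y\<in>cells Q 0. F 0 y = x"
    and lift1: "\<And>y0 y1 e. y0 \<in> cells Q 0 \<Longrightarrow> y1 \<in> cells Q 0 \<Longrightarrow> e \<in> cells Q' 1 \<Longrightarrow> source Q' e = F 0 y0 \<Longrightarrow>
      target Q' e = F 0 y1 \<Longrightarrow> \<exists>e'\<in>cells Q 1. F 1 e' = e \<and> source Q e' = y0 \<and> target Q e' = y1"
    and lift2: "\<And>e f g. e \<in> cells Q 1 \<Longrightarrow> f \<in> cells Q 1 \<Longrightarrow> g \<in> cells Q 1 \<Longrightarrow> target Q e = source Q f \<Longrightarrow>
      source Q g = source Q e \<Longrightarrow> target Q g = target Q f \<Longrightarrow> composite Q' (F 1 e) (F 1 f) (F 1 g) \<Longrightarrow> composite Q e f g"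
  shows "bij_betw (iso_classes_map Q' F) (iso_classes Q) (iso_classes Q')"
proof -
  have QS: "simplicial_set Q" and QS': "simplicial_set Q'" using F by (auto dest: shom_ss)
  let ?R = "equiv_objects Q" and ?R' = "equiv_objects Q'"
  have R: "equiv (cells Q 0) ?R" and R': "equiv (cells Q' 0) ?R'" using Q Q' by (auto intro: equiv_objects_equiv)
  have map: "iso_classes_map Q' F (?R `` {x}) = ?R' `` {F 0 x}" if x: "x \<in> cells Q 0" for x
  proof -
    have "(x, x) \<in> ?R" using R x by (meson equivE refl_onD)
    moreover have "(F 0 x, F 0 y) \<in> ?R'" if "(x, y) \<in> ?R" for y by (rule shom_equiv_objects[OF F that])
    moreover have "trans ?R'" "sym ?R'" using R' by (auto elim: equivE)
    ultimately show ?thesis unfolding iso_classes_map_def by (blast dest: transD symD)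
  qed
  have reflect: "(x, y) \<in> ?R" if x: "x \<in> cells Q 0" and y: "y \<in> cells Q 0" and xy: "(F 0 x, F 0 y) \<in> ?R'" for x y
  proof -
    obtain e where e: "equivalence_edge Q' e" "source Q' e = F 0 x" "target Q' e = F 0 y"
      using xy by (auto simp: equiv_objects_def)
    obtain e' where e': "e' \<in> cells Q' 1" "composite Q' e e' (degenerate_edge Q' (source Q' e))"
      "composite Q' e' e (degenerate_edge Q' (target Q' e))" using e unfolding equivalence_edge_def by blast
    have ends': "source Q' e' = F 0 y" "target Q' e' = F 0 x"
      using composite_ends(4)[OF QS' e'(2)] composite_ends(4)[OF QS' e'(3)] e by simp_all
    obtain d where d: "d \<in> cells Q 1" "F 1 d = e" "source Q d = x" "target Q d = y"
      using lift1[OF x y] e by (auto simp: equivalence_edge_def)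
    obtain d' where d': "d' \<in> cells Q 1" "F 1 d' = e'" "source Q d' = y" "target Q d' = x"
      using lift1[OF y x e'(1) ends'] by blast
    have "composite Q d d' (degenerate_edge Q x)"
      using e'(2) e d d' shom_degenerate[OF F x] degenerate_edge_ends[OF QS x] degenerate_edge_in[OF QS x]
      by (intro lift2) simp_all
    moreover have "composite Q d' d (degenerate_edge Q y)"
      using e'(3) e d d' shom_degenerate[OF F y] degenerate_edge_ends[OF QS y] degenerate_edge_in[OF QS y]
      by (intro lift2) simp_all
    ultimately have "equivalence_edge Q d" using d d' by (auto simp: equivalence_edge_def)
    then show ?thesis using x y d by (auto simp: equiv_objects_def)
  qed
  show ?thesis
    unfolding bij_betw_def
  proof
    show "inj_on (iso_classes_map Q' F) (iso_classes Q)"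
    proof (rule inj_onI)
      fix K K' assume "K \<in> iso_classes Q" "K' \<in> iso_classes Q" and eq: "iso_classes_map Q' F K = iso_classes_map Q' F K'"
      then obtain x y where x: "x \<in> cells Q 0" "K = ?R `` {x}" and y: "y \<in> cells Q 0" "K' = ?R `` {y}"
        unfolding iso_classes_def by (auto elim!: quotientE)
      have "?R' `` {F 0 x} = ?R' `` {F 0 y}" using eq map x y by simp
      then have "(F 0 x, F 0 y) \<in> ?R'" using eq_equiv_class[OF _ R' shom_in[OF F y(1)]] by blast
      then show "K = K'" using reflect[OF x(1) y(1)] equiv_class_eq[OF R] x y by blast
    qed
    show "iso_classes_map Q' F ` iso_classes Q = iso_classes Q'"
    proof (intro equalityI subsetI)
      fix K assume "K \<in> iso_classes_map Q' F ` iso_classes Q"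
      then obtain x where "x \<in> cells Q 0" "K = iso_classes_map Q' F (?R `` {x})"
        unfolding iso_classes_def by (auto elim!: quotientE)
      then show "K \<in> iso_classes Q'" using map shom_in[OF F] by (auto simp: iso_classes_def intro: quotientI)
    next
      fix K assume "K \<in> iso_classes Q'"
      then obtain x where x: "x \<in> cells Q' 0" "K = ?R' `` {x}" unfolding iso_classes_def by (auto elim!: quotientE)
      obtain y where y: "y \<in> cells Q 0" "F 0 y = x" using lift0[OF x(1)] by blast
      then show "K \<in> iso_classes_map Q' F ` iso_classes Q"
        using map[OF y(1)] x by (auto simp: iso_classes_def intro!: image_eqI[of _ _ "?R `` {y}"] quotientI)
    qed
  qed
qed

section \<open>Mapping spaces\<close>

lemma cells_sfun: "cells (sfun X C) n = shom (sprod X (simplex n)) C"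
  by (simp add: sfun_def)

lemma act_sfun_apply: "x \<in> cells X k \<Longrightarrow> \<alpha> \<in> ord_maps k m \<Longrightarrow>
    act (sfun X C) m n \<theta> h k (x, \<alpha>) = h k (x, compose {..k} \<theta> \<alpha>)"
  by (simp add: sfun_def)

lemma act_sfun_in:
  assumes X: "simplicial_set X" and \<theta>: "\<theta> \<in> ord_maps m n" and h: "h \<in> shom (sprod X (simplex n)) C"
  shows "act (sfun X C) m n \<theta> h \<in> shom (sprod X (simplex m)) C"
proof -
  have "(\<lambda>k. \<lambda>z\<in>cells (sprod X (simplex m)) k. h k (fst z, compose {..k} \<theta> (snd z))) \<in> shom (sprod X (simplex m)) C"
  proof (rule shomI[OF simplicial_sprod[OF X simplicial_simplex] shom_ss(2)[OF h]])
    fix k z assume "z \<in> cells (sprod X (simplex m)) k"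
    then obtain x \<alpha> where z: "z = (x, \<alpha>)" "x \<in> cells X k" "\<alpha> \<in> ord_maps k m" by auto
    have cell: "(x, compose {..k} \<theta> \<alpha>) \<in> cells (sprod X (simplex n)) k" using z ord_maps_compose[OF \<theta>] by simp
    show "h k (fst z, compose {..k} \<theta> (snd z)) \<in> cells C k" using shom_in[OF h cell] by (simp add: z)
    fix l \<phi> assume \<phi>: "\<phi> \<in> ord_maps l k"
    show "h l (fst (act (sprod X (simplex m)) l k \<phi> z), compose {..l} \<theta> (snd (act (sprod X (simplex m)) l k \<phi> z))) =
        act C l k \<phi> (h k (fst z, compose {..k} \<theta> (snd z)))"
      using shom_act[OF h \<phi> cell] by (simp add: z compose_ord_assoc[OF \<phi>])
  qed
  moreover have "(\<lambda>k. \<lambda>z\<in>cells (sprod X (simplex m)) k. h k (fst z, compose {..k} \<theta> (snd z))) = act (sfun X C) m n \<theta> h"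
    by (auto simp: sfun_def fun_eq_iff restrict_def)
  ultimately show ?thesis by simp
qed

lemma simplicial_sfun:
  assumes X: "simplicial_set X"
  shows "simplicial_set (sfun X C)"
proof (rule simplicial_setI)
  fix m n \<theta> h assume "\<theta> \<in> ord_maps m n" "h \<in> cells (sfun X C) n"
  then show "act (sfun X C) m n \<theta> h \<in> cells (sfun X C) m" using act_sfun_in[OF X] by (simp add: cells_sfun)
next
  fix n h assume h: "h \<in> cells (sfun X C) n"
  show "act (sfun X C) n n (ord_id n) h = h"
    by (rule shom_eqI[OF act_sfun_in[OF X ord_id_in] ]) (use h in \<open>auto simp: cells_sfun act_sfun_apply compose_ord_id_left\<close>)
next
  fix l m n \<phi> \<theta> h assume \<phi>: "\<phi> \<in> ord_maps l m" and \<theta>: "\<theta> \<in> ord_maps m n" and "h \<in> cells (sfun X C) n"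
  then have h: "h \<in> shom (sprod X (simplex n)) C" by (simp add: cells_sfun)
  show "act (sfun X C) l m \<phi> (act (sfun X C) m n \<theta> h) = act (sfun X C) l n (compose {..l} \<theta> \<phi>) h"
    by (rule shom_eqI[OF act_sfun_in[OF X \<phi> act_sfun_in[OF X \<theta> h]] act_sfun_in[OF X ord_maps_compose[OF \<theta> \<phi>] h]])
      (auto simp: act_sfun_apply ord_maps_compose[OF \<phi>] compose_ord_assoc)
qed

lemma sfun_evaluate:
  assumes h: "h \<in> cells (sfun X C) n" and x: "x \<in> cells X m" and \<theta>: "\<theta> \<in> ord_maps m n"
  shows "act (sfun X C) m n \<theta> h m (x, ord_id m) = h m (x, \<theta>)"
  using x \<theta> by (simp add: act_sfun_apply compose_ord_id_right)

text \<open>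
  A horn in \<open>Fun(X, C)\<close> is a map on \<open>\<Lambda>\<^sup>n\<^sub>k \<times> X\<close>, which is the part over the horn for the coCartesian fibration
  \<open>id : \<Delta>\<^sup>n \<rightarrow> \<Delta>\<^sup>n\<close> and the factor \<open>X\<close>.
\<close>

lemma quasi_category_sfun:
  fixes C :: "'c sset"
  assumes X: "simplicial_set X" and C: "quasi_category C"
  shows "quasi_category (sfun X C)"
  unfolding quasi_category_def
proof (intro conjI allI impI ballI simplicial_sfun[OF X])
  fix n k u assume k: "0 < k" "k < n" and u: "u \<in> shom (horn n k) (sfun X C)"
  let ?S = "sprod (simplex n) X" and ?W = "horn_part (sid (simplex n)) (simplex n) X (\<lambda>_. {}) n k"
  have CS: "simplicial_set C" using C by (simp add: quasi_category_def)
  have u_in: "u m \<theta> \<in> shom (sprod X (simplex m)) C" if "\<theta> \<in> cells (horn n k) m" for m \<theta>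
    using shom_in[OF u that] by (simp add: cells_sfun)
  have u_compose: "u l (compose {..l} \<theta> \<phi>) l (x, ord_id l) = u m \<theta> l (x, \<phi>)"
    if "\<theta> \<in> cells (horn n k) m" "\<phi> \<in> ord_maps l m" "x \<in> cells X l" for l m \<theta> \<phi> x
    using shom_act[OF u that(2,1)] sfun_evaluate[OF shom_in[OF u that(1)] that(3,2)] by simp
  define f where "f = (\<lambda>m (\<theta>, x). u m \<theta> m (x, ord_id m))"
  have W: "(\<theta>, x) \<in> ?W m \<longleftrightarrow> \<theta> \<in> cells (horn n k) m \<and> x \<in> cells X m" for m \<theta> x
    by (auto simp: horn_part_def horn_subset)
  have f: "simplicial_on ?S ?W C f"
    unfolding simplicial_on_def
  proof (intro conjI allI impI)
    fix m z assume "z \<in> ?W m"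
    then obtain \<theta> x where z: "z = (\<theta>, x)" "\<theta> \<in> cells (horn n k) m" "x \<in> cells X m" using W by (cases z) auto
    show "f m z \<in> cells C m" using shom_in[OF u_in[OF z(2)], of "(x, ord_id m)" m] z by (simp add: f_def)
  next
    fix l m \<phi> z assume \<phi>: "\<phi> \<in> ord_maps l m" and "z \<in> ?W m"
    then obtain \<theta> x where z: "z = (\<theta>, x)" "\<theta> \<in> cells (horn n k) m" "x \<in> cells X m" using W by (cases z) auto
    show "f l (act ?S l m \<phi> z) = act C l m \<phi> (f m z)"
      using shom_act[OF u_in[OF z(2)] \<phi>, of "(x, ord_id m)"] u_compose[OF z(2) \<phi> act_in[OF X \<phi> z(3)]] z(3)
      by (simp add: z(1) f_def compose_ord_id_left[OF \<phi>])
  qed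
  have "subcomplex X (\<lambda>_. {})" by (simp add: subcomplex_def)
  then obtain G where G: "G \<in> shom ?S C" and Gf: "\<And>m z. z \<in> ?W m \<Longrightarrow> G m z = f m z"
    using extend_from_horn[OF cocartesian_fibration_sid k X _ C f] by blast
  define H where "H = (\<lambda>l. \<lambda>z\<in>cells (sprod X (simplex n)) l. G l (snd z, fst z))"
  have H: "H \<in> cells (sfun X C) n"
    unfolding H_def cells_sfun
  proof (rule shomI[OF simplicial_sprod[OF X simplicial_simplex] CS])
    fix l z assume "z \<in> cells (sprod X (simplex n)) l"
    then obtain x \<alpha> where z: "z = (x, \<alpha>)" "(\<alpha>, x) \<in> cells ?S l" by auto
    show "G l (snd z, fst z) \<in> cells C l" using shom_in[OF G z(2)] by (simp add: z(1))
    fix m \<phi> assume \<phi>: "\<phi> \<in> ord_maps m l"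
    show "G m (snd (act (sprod X (simplex n)) m l \<phi> z), fst (act (sprod X (simplex n)) m l \<phi> z)) =
        act C m l \<phi> (G l (snd z, fst z))"
      using shom_act[OF G \<phi> z(2)] by (simp add: z(1))
  qed
  note yo = yoneda_in[OF simplicial_sfun[OF X] H]
  show "\<exists>h\<in>shom (simplex n) (sfun X C). scomp (horn n k) h (horn_incl n k) = u"
  proof (intro bexI[OF _ yo] scomp_eqI[OF _ u])
    fix m \<theta> assume \<theta>: "\<theta> \<in> cells (horn n k) m"
    note \<theta>' = horn_subset[OF \<theta>]
    have "act (sfun X C) m n \<theta> H = u m \<theta>"
    proof (rule shom_eqI[OF act_sfun_in[OF X \<theta>'] u_in[OF \<theta>]])
      show "H \<in> shom (sprod X (simplex n)) C" using H by (simp add: cells_sfun)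
      fix l z assume "z \<in> cells (sprod X (simplex m)) l"
      then obtain x \<alpha> where z: "z = (x, \<alpha>)" "x \<in> cells X l" "\<alpha> \<in> ord_maps l m" by auto
      show "act (sfun X C) m n \<theta> H l z = u m \<theta> l z"
        using Gf[of "(compose {..l} \<theta> \<alpha>, x)" l] horn_compose[OF z(3) \<theta>] u_compose[OF \<theta> z(3,2)] z
          ord_maps_compose[OF \<theta>' z(3)]
        by (simp add: act_sfun_apply H_def W f_def)
    qed
    then show "yoneda (sfun X C) n H m (horn_incl n k m \<theta>) = u m \<theta>" using \<theta> \<theta>' by (simp add: horn_incl_def)
  qed
qed

lemma sfun_pre_apply: "h \<in> cells (sfun Y C) n \<Longrightarrow> x \<in> cells X k \<Longrightarrow> \<alpha> \<in> ord_maps k n \<Longrightarrow>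
    sfun_pre X Y f C n h k (x, \<alpha>) = h k (f k x, \<alpha>)"
  by (simp add: sfun_pre_def)

lemma sfun_pre_cell:
  assumes f: "f \<in> shom X Y" and h: "h \<in> cells (sfun Y C) n"
  shows "sfun_pre X Y f C n h \<in> cells (sfun X C) n"
proof -
  have h': "h \<in> shom (sprod Y (simplex n)) C" using h by (simp add: cells_sfun)
  have X: "simplicial_set X" using f by (rule shom_ss)
  have "(\<lambda>k. \<lambda>z\<in>cells (sprod X (simplex n)) k. h k (f k (fst z), snd z)) \<in> shom (sprod X (simplex n)) C"
  proof (rule shomI[OF simplicial_sprod[OF X simplicial_simplex] shom_ss(2)[OF h']])
    fix k z assume "z \<in> cells (sprod X (simplex n)) k"
    then obtain x \<alpha> where z: "z = (x, \<alpha>)" "x \<in> cells X k" "\<alpha> \<in> ord_maps k n" by auto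
    have cell: "(f k x, \<alpha>) \<in> cells (sprod Y (simplex n)) k" using z shom_in[OF f] by simp
    show "h k (f k (fst z), snd z) \<in> cells C k" using shom_in[OF h' cell] by (simp add: z)
    fix l \<phi> assume \<phi>: "\<phi> \<in> ord_maps l k"
    show "h l (f l (fst (act (sprod X (simplex n)) l k \<phi> z)), snd (act (sprod X (simplex n)) l k \<phi> z)) =
        act C l k \<phi> (h k (f k (fst z), snd z))"
      using shom_act[OF h' \<phi> cell] shom_act[OF f \<phi> z(2)] by (simp add: z)
  qed
  moreover have "(\<lambda>k. \<lambda>z\<in>cells (sprod X (simplex n)) k. h k (f k (fst z), snd z)) = sfun_pre X Y f C n h"
    using h by (auto simp: sfun_pre_def fun_eq_iff restrict_def)
  ultimately show ?thesis by (simp add: cells_sfun)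
qed

lemma sfun_pre_in:
  assumes f: "f \<in> shom X Y"
  shows "sfun_pre X Y f C \<in> shom (sfun Y C) (sfun X C)"
proof -
  have X: "simplicial_set X" and Y: "simplicial_set Y" using f by (auto dest: shom_ss)
  have "(\<lambda>n. \<lambda>h\<in>cells (sfun Y C) n. sfun_pre X Y f C n h) \<in> shom (sfun Y C) (sfun X C)"
  proof (rule shomI[OF simplicial_sfun[OF Y] simplicial_sfun[OF X] sfun_pre_cell[OF f]])
    fix m n \<theta> h assume \<theta>: "\<theta> \<in> ord_maps m n" and h: "h \<in> cells (sfun Y C) n"
    have h': "act (sfun Y C) m n \<theta> h \<in> cells (sfun Y C) m" by (rule act_in[OF simplicial_sfun[OF Y] \<theta> h])
    show "sfun_pre X Y f C m (act (sfun Y C) m n \<theta> h) = act (sfun X C) m n \<theta> (sfun_pre X Y f C n h)"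
    proof (rule shom_eqI)
      show "sfun_pre X Y f C m (act (sfun Y C) m n \<theta> h) \<in> shom (sprod X (simplex m)) C"
        using sfun_pre_cell[OF f h'] by (simp add: cells_sfun)
      show "act (sfun X C) m n \<theta> (sfun_pre X Y f C n h) \<in> shom (sprod X (simplex m)) C"
        using act_sfun_in[OF X \<theta>] sfun_pre_cell[OF f h] by (simp add: cells_sfun)
      fix k z assume "z \<in> cells (sprod X (simplex m)) k"
      then obtain x \<alpha> where z: "z = (x, \<alpha>)" "x \<in> cells X k" "\<alpha> \<in> ord_maps k m" by auto
      show "sfun_pre X Y f C m (act (sfun Y C) m n \<theta> h) k z = act (sfun X C) m n \<theta> (sfun_pre X Y f C n h) k z"
        using z h h' shom_in[OF f z(2)] ord_maps_compose[OF \<theta> z(3)]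
        by (simp add: sfun_pre_apply act_sfun_apply)
    qed
  qed
  moreover have "(\<lambda>n. \<lambda>h\<in>cells (sfun Y C) n. sfun_pre X Y f C n h) = sfun_pre X Y f C"
    by (auto simp: sfun_pre_def fun_eq_iff restrict_def)
  ultimately show ?thesis by simp
qed

section \<open>Restriction along the pulled back map\<close>

text \<open>
  The right lifting property of the restriction against \<open>\<partial>\<Delta>\<^sup>n \<rightarrow> \<Delta>\<^sup>n\<close>, obtained from \<open>extend_along_pullback\<close> by
  adjunction.
\<close>

lemma restriction_lift:
  fixes C :: "'c sset"
  assumes cocart: "cocartesian_fibration Y B q" and pb: "is_pullback X Y A B j p i q" and i: "inner_anodyne A B i"
    and C: "quasi_category C" and \<sigma>: "\<sigma> \<in> cells (sfun X C) n"
    and l: "simplicial_on (simplex n) (missing_some n {..n}) (sfun Y C) l"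
    and agree: "\<And>m \<theta>. \<theta> \<in> missing_some n {..n} m \<Longrightarrow> sfun_pre X Y j C m (l m \<theta>) = act (sfun X C) m n \<theta> \<sigma>"
  obtains \<tau> where "\<tau> \<in> cells (sfun Y C) n" "sfun_pre X Y j C n \<tau> = \<sigma>"
    "\<And>m \<theta>. \<theta> \<in> missing_some n {..n} m \<Longrightarrow> act (sfun Y C) m n \<theta> \<tau> = l m \<theta>"
proof -
  let ?L = "missing_some n {..n}"
  have j: "j \<in> shom X Y" using pb by (simp add: is_pullback_def)
  have X: "simplicial_set X" and Y: "simplicial_set Y" using j by (auto dest: shom_ss)
  have L: "subcomplex (simplex n) ?L" by (rule missing_some_subcomplex)
  have L_ord: "\<theta> \<in> ord_maps m n" if "\<theta> \<in> ?L m" for m \<theta> using subcomplex_cells[OF L that] by simp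
  have l_cell: "l m \<theta> \<in> cells (sfun Y C) m" if "\<theta> \<in> ?L m" for m \<theta> using simplicial_on_in[OF l] that by simp
  have l_in: "l m \<theta> \<in> shom (sprod Y (simplex m)) C" if "\<theta> \<in> ?L m" for m \<theta>
    using l_cell[OF that] by (simp add: cells_sfun)
  have l_compose: "l k (compose {..k} \<theta> \<phi>) k (y, ord_id k) = l m \<theta> k (y, \<phi>)"
    if "\<theta> \<in> ?L m" "\<phi> \<in> ord_maps k m" "y \<in> cells Y k" for k m \<theta> \<phi> y
    using simplicial_on_act[OF l that(2,1)] sfun_evaluate[OF l_cell[OF that(1)] that(3,2)] by simp
  have \<sigma>': "\<sigma> \<in> shom (sprod X (simplex n)) C" using \<sigma> by (simp add: cells_sfun)
  define f where "f = (\<lambda>m (y, \<theta>). l m \<theta> m (y, ord_id m))"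
  have f: "simplicial_on (sprod Y (simplex n)) (\<lambda>m. cells Y m \<times> ?L m) C f"
    unfolding simplicial_on_def
  proof (intro conjI allI impI)
    fix m z assume "z \<in> cells Y m \<times> ?L m"
    then obtain y \<theta> where z: "z = (y, \<theta>)" "y \<in> cells Y m" "\<theta> \<in> ?L m" by auto
    show "f m z \<in> cells C m" using shom_in[OF l_in[OF z(3)], of "(y, ord_id m)" m] z by (simp add: f_def)
  next
    fix k m \<phi> z assume \<phi>: "\<phi> \<in> ord_maps k m" and "z \<in> cells Y m \<times> ?L m"
    then obtain y \<theta> where z: "z = (y, \<theta>)" "y \<in> cells Y m" "\<theta> \<in> ?L m" by auto
    show "f k (act (sprod Y (simplex n)) k m \<phi> z) = act C k m \<phi> (f m z)"
      using shom_act[OF l_in[OF z(3)] \<phi>, of "(y, ord_id m)"] l_compose[OF z(3) \<phi> act_in[OF Y \<phi> z(2)]] z(2)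
      by (simp add: z(1) f_def compose_ord_id_left[OF \<phi>])
  qed
  have agree': "\<sigma> m (x, \<theta>) = f m (j m x, \<theta>)" if x: "x \<in> cells X m" and \<theta>: "\<theta> \<in> ?L m" for m x \<theta>
  proof -
    have "\<sigma> m (x, \<theta>) = sfun_pre X Y j C m (l m \<theta>) m (x, ord_id m)"
      using sfun_evaluate[OF \<sigma> x L_ord[OF \<theta>]] agree[OF \<theta>] by simp
    then show ?thesis using sfun_pre_apply[OF l_cell[OF \<theta>] x ord_id_in] by (simp add: f_def)
  qed
  obtain g where g: "g \<in> shom (sprod Y (simplex n)) C"
    and gj: "\<And>m x \<kappa>. x \<in> cells X m \<Longrightarrow> \<kappa> \<in> cells (simplex n) m \<Longrightarrow> g m (j m x, \<kappa>) = \<sigma> m (x, \<kappa>)"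
    and gf: "\<And>m y \<kappa>. y \<in> cells Y m \<Longrightarrow> \<kappa> \<in> ?L m \<Longrightarrow> g m (y, \<kappa>) = f m (y, \<kappa>)"
    using extend_along_pullback[OF cocart pb i simplicial_simplex L C \<sigma>' f agree'] by blast
  have g_cell: "g \<in> cells (sfun Y C) n" using g by (simp add: cells_sfun)
  show ?thesis
  proof
    show "g \<in> cells (sfun Y C) n" by (rule g_cell)
    show "sfun_pre X Y j C n g = \<sigma>"
    proof (rule shom_eqI[OF _ \<sigma>'])
      show "sfun_pre X Y j C n g \<in> shom (sprod X (simplex n)) C"
        using sfun_pre_cell[OF j g_cell] by (simp add: cells_sfun)
    qed (auto simp: sfun_pre_apply[OF g_cell] gj)
    fix m \<theta> assume \<theta>: "\<theta> \<in> ?L m"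
    show "act (sfun Y C) m n \<theta> g = l m \<theta>"
    proof (rule shom_eqI[OF act_sfun_in[OF Y L_ord[OF \<theta>] g] l_in[OF \<theta>]])
      fix k z assume "z \<in> cells (sprod Y (simplex m)) k"
      then obtain y \<phi> where z: "z = (y, \<phi>)" "y \<in> cells Y k" "\<phi> \<in> ord_maps k m" by auto
      have "compose {..k} \<theta> \<phi> \<in> ?L k" using subcomplex_act[OF L z(3) \<theta>] by simp
      then show "act (sfun Y C) m n \<theta> g k z = l m \<theta> k z"
        using gf[OF z(2)] l_compose[OF \<theta> z(3,2)] z by (simp add: act_sfun_apply f_def)
    qed
  qed
qed

lemma restriction_lift_faces:
  fixes C :: "'c sset"
  assumes cocart: "cocartesian_fibration Y B q" and pb: "is_pullback X Y A B j p i q" and i: "inner_anodyne A B i"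
    and C: "quasi_category C" and \<sigma>: "\<sigma> \<in> cells (sfun X C) (Suc N)"
    and z: "\<And>k. k \<le> Suc N \<Longrightarrow> z k \<in> cells (sfun Y C) N"
    and compat: "\<And>M k k'. N = Suc M \<Longrightarrow> k < k' \<Longrightarrow> k' \<le> Suc N \<Longrightarrow>
      face (sfun Y C) M k (z k') = face (sfun Y C) M (k' - 1) (z k)"
    and agree: "\<And>k. k \<le> Suc N \<Longrightarrow> sfun_pre X Y j C N (z k) = face (sfun X C) N k \<sigma>"
  obtains \<tau> where "\<tau> \<in> cells (sfun Y C) (Suc N)" "sfun_pre X Y j C (Suc N) \<tau> = \<sigma>"
    "\<And>k. k \<le> Suc N \<Longrightarrow> face (sfun Y C) N k \<tau> = z k"
proof -
  have j: "j \<in> shom X Y" using pb by (simp add: is_pullback_def)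
  have X: "simplicial_set X" and Y: "simplicial_set Y" using j by (auto dest: shom_ss)
  let ?QX = "sfun X C" and ?QY = "sfun Y C" and ?F = "sfun_pre X Y j C" and ?L = "missing_some (Suc N) {..Suc N}"
  have QX: "simplicial_set ?QX" and QY: "simplicial_set ?QY" using X Y by (auto intro: simplicial_sfun)
  have F: "?F \<in> shom ?QY ?QX" by (rule sfun_pre_in[OF j])
  obtain l where l: "simplicial_on (simplex (Suc N)) ?L ?QY l"
    and lz: "\<And>k. k \<in> {..Suc N} \<Longrightarrow> l N (coface N k) = z k"
    by (rule glue_faces[OF QY, of "{..Suc N}" N z]) (use z compat in auto)
  have cf: "coface N k \<in> ?L N" if "k \<le> Suc N" for k
    using that coface_in[OF that] by (auto simp: missing_some_def intro!: bexI[of _ k] split: if_splits)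
  have "?F m (l m \<theta>) = act ?QX m (Suc N) \<theta> \<sigma>" if "\<theta> \<in> ?L m" for m \<theta>
  proof -
    obtain k where k: "k \<le> Suc N" "k \<notin> \<theta> ` {..m}" and \<theta>: "\<theta> \<in> ord_maps m (Suc N)"
      using \<open>\<theta> \<in> ?L m\<close> by (auto simp: missing_some_def)
    obtain \<theta>' where \<theta>': "\<theta>' \<in> ord_maps m N" "\<theta> = compose {..m} (coface N k) \<theta>'" using factor_coface[OF \<theta> k] .
    have "l m \<theta> = act ?QY m N \<theta>' (z k)"
      using simplicial_on_act[OF l \<theta>'(1) cf[OF k(1)]] lz k(1) \<theta>'(2) by simp
    then have "?F m (l m \<theta>) = act ?QX m N \<theta>' (face ?QX N k \<sigma>)"
      using shom_act[OF F \<theta>'(1) z[OF k(1)]] agree[OF k(1)] by simp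
    then show ?thesis
      using act_act[OF QX \<theta>'(1) coface_in[OF k(1)] \<sigma>] \<theta>'(2) by (simp add: face_def)
  qed
  then obtain \<tau> where "\<tau> \<in> cells ?QY (Suc N)" "?F (Suc N) \<tau> = \<sigma>"
    "\<And>m \<theta>. \<theta> \<in> ?L m \<Longrightarrow> act ?QY m (Suc N) \<theta> \<tau> = l m \<theta>"
    using restriction_lift[OF cocart pb i C \<sigma> l] by blast
  then show ?thesis using that cf lz by (simp add: face_def)
qed

theorem theorem4p7:
  fixes A B :: "'u sset" and X :: "'x sset" and Y :: "'y sset"
    and i :: "('u, 'u) smap" and p :: "('x, 'u) smap"
    and q :: "('y, 'u) smap" and j :: "('x, 'y) smap"
  assumes "cocartesian_fibration Y B q"
    and "cocartesian_fibration X A p"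
    and "is_pullback X Y A B j p i q"
    and "inner_anodyne A B i"
  shows "joyal_equivalence TYPE('c) X Y j"
  unfolding joyal_equivalence_def
proof (intro conjI allI impI)
  show j: "j \<in> shom X Y" using assms(3) by (simp add: is_pullback_def)
  then have X: "simplicial_set X" and Y: "simplicial_set Y" by (auto dest: shom_ss)
  fix C :: "'c sset" assume C: "quasi_category C"
  let ?QX = "sfun X C" and ?QY = "sfun Y C" and ?F = "sfun_pre X Y j C"
  have F: "?F \<in> shom ?QY ?QX" by (rule sfun_pre_in[OF j])
  note faces = restriction_lift_faces[OF assms(1,3,4) C]
  show "bij_betw (iso_classes_map ?QX ?F) (iso_classes ?QY) (iso_classes ?QX)"
  proof (rule iso_classes_bij[OF quasi_category_sfun[OF Y C] quasi_category_sfun[OF X C] F])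
    fix x assume x: "x \<in> cells ?QX 0"
    have none: "\<theta> \<notin> missing_some 0 {..0} m" for m \<theta>
      using ord_maps_le[of \<theta> m 0 0] by (auto simp: missing_some_def image_iff)
    then have "simplicial_on (simplex 0) (missing_some 0 {..0}) ?QY undefined" by (simp add: simplicial_on_def)
    then show "\<exists>y\<in>cells ?QY 0. ?F 0 y = x"
      using restriction_lift[OF assms(1,3,4) C x] none by blast
  next
    fix y0 y1 e assume y: "y0 \<in> cells ?QY 0" "y1 \<in> cells ?QY 0" and e: "e \<in> cells ?QX 1"
      and ends: "source ?QX e = ?F 0 y0" "target ?QX e = ?F 0 y1"
    define z where "z k = (if k = 0 then y1 else y0)" for k :: nat
    have e': "e \<in> cells ?QX (Suc 0)" using e by (simp add: One_nat_def)
    obtain \<tau> where \<tau>: "\<tau> \<in> cells ?QY (Suc 0)" "?F (Suc 0) \<tau> = e" "\<And>k. k \<le> Suc 0 \<Longrightarrow> face ?QY 0 k \<tau> = z k"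
    proof (rule faces[OF e', of z])
      fix k :: nat assume "k \<le> Suc 0"
      then have "k = 0 \<or> k = 1" by auto
      then show "?F 0 (z k) = face ?QX 0 k e" using ends by (auto simp: z_def source_face target_face)
    qed (use y in \<open>auto simp: z_def\<close>)
    then show "\<exists>e'\<in>cells ?QY 1. ?F 1 e' = e \<and> source ?QY e' = y0 \<and> target ?QY e' = y1"
      using \<tau>(3)[of 0] \<tau>(3)[of 1] by (intro bexI[of _ \<tau>]) (auto simp: z_def source_face target_face One_nat_def)
  next
    fix e f g assume efg: "e \<in> cells ?QY 1" "f \<in> cells ?QY 1" "g \<in> cells ?QY 1"
      and ends: "target ?QY e = source ?QY f" "source ?QY g = source ?QY e" "target ?QY g = target ?QY f"
      and "composite ?QX (?F 1 e) (?F 1 f) (?F 1 g)"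
    then obtain \<sigma> where \<sigma>: "\<sigma> \<in> cells ?QX (Suc 1)" "face ?QX 1 2 \<sigma> = ?F 1 e" "face ?QX 1 0 \<sigma> = ?F 1 f" "face ?QX 1 1 \<sigma> = ?F 1 g"
      unfolding composite_def by auto
    define z where "z k = (if k = 0 then f else if k = 1 then g else e)" for k :: nat
    obtain \<tau> where \<tau>: "\<tau> \<in> cells ?QY (Suc 1)" "\<And>k. k \<le> Suc 1 \<Longrightarrow> face ?QY 1 k \<tau> = z k"
    proof (rule faces[OF \<sigma>(1), of z])
      fix k :: nat assume "k \<le> Suc 1"
      then have "k = 0 \<or> k = 1 \<or> k = 2" by auto
      then show "?F 1 (z k) = face ?QX 1 k \<sigma>" using \<sigma> by (auto simp: z_def)
    next
      fix M k k' :: nat assume "1 = Suc M" "k < k'" "k' \<le> Suc 1"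
      then have "M = 0" "k = 0 \<and> k' = 1 \<or> k = 0 \<and> k' = 2 \<or> k = 1 \<and> k' = 2" by auto
      then show "face ?QY M k (z k') = face ?QY M (k' - 1) (z k)"
        using ends by (auto simp: z_def source_face target_face One_nat_def)
    qed (use efg in \<open>auto simp: z_def\<close>)
    then show "composite ?QY e f g"
      using \<tau>(2)[of 0] \<tau>(2)[of 1] \<tau>(2)[of 2] unfolding composite_def by (intro bexI[of _ \<tau>]) (auto simp: z_def)
  qed
qed

end
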